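(* Let $m\geq 2$. Let $\mathbf P^-$, $\mathbf P^+$ and $\mathbf Q$ be disjointified copies of the Sugihara algebras $\mathbf Z_{2m-1}$, $\mathbf Z_{2m-1}$ and $\mathbf Z_{2m}$, respectively, with carrier maps $\delta^-$, $\delta^+$ and $\beta$, respectively. Let $\mathcal M=\{\mathbf P^-,\mathbf P^+,\mathbf Q\}$ and let $\mathcal T$ be the disjoint union topology on $M_0=P^-\,\dot\cup\,P^+\,\dot\cup\,Q$ derived from the discrete topology on each sort. Let $\underset{\sim}{\mathcal M}=(M_0;G,H,K,\mathcal T)$, where $K=\{\mathbf 0_{\mathbf P^-}\}$ and $G\cup H$ ($G$ the total maps, $H$ the partial ones) consists of the following maps: - from $\mathbf P^-$ to $\mathbf P^-$: $f_1,\dots,f_{m-1}$ and $g$; - from $\mathbf P^-$ to $\mathbf Q$: the partial isomorphism $v^-$; - from $\mathbf P^-$ to $\mathbf P^+$: the isomorphism $\mathrm{id}_{-+}$; - from $\mathbf Q$ to $\mathbf P^-$: the surjective homomorphism $u^-$; - from $\mathbf Q$ to $\mathbf Q$: $h_2,\dots,h_m$ and $j$; - from $\mathbf P^+$ to $\mathbf P^-$: the isomorphism $\mathrm{id}_{+-}$. Then $\underset{\sim}{\mathcal M}$ strongly dualises (i.e. yields a strong duality on) the variety $\mathcal V(\mathbf Z_{2m})=\mathbb{HSP}(\mathbf Z_{2m})=\mathbb{ISP}(\mathbf Z_{2m},\mathbf Z_{2m-1})$.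
   Context: **Sugihara algebras.** $\mathbf Z=(\mathbb Z;\wedge,\vee,\to,\neg)$ has the usual chain order on $\mathbb Z$, $\neg a=-a$, and $a\to b=(-a)\vee b$ if $a\leq b$, $a\to b=(-a)\wedge b$ otherwise. $\mathbf Z_{2n+1}$ ($n\ge 0$) is the subalgebra with universe $\{a: -n\leq a\leq n\}$ and $\mathbf Z_{2n}$ ($n\geq1$) is the subalgebra with universe $\{a:-n\le a\le n\}\setminus\{0\}$. **Maps.** On $\mathbf Z_{2m-1}$: $f_1$ has domain $\mathbf Z_{2m-1}\setminus\{1,-1\}$ and $f_1(a)=a$; for $1<i<m$, $f_i$ has domain $\mathbf Z_{2m-1}\setminus\{i,-i\}$, with $f_i(i-1)=i$, $f_i(-(i-1))=-i$, $f_i(a)=a$ otherwise; $g(a)=a-1$ if $a>0$, $g(a)=a+1$ if $a<0$, $g(0)=0$. On $\mathbf Z_{2m}$: for $2\le i\le m$, $h_i$ has domain $\mathbf Z_{2m}\setminus\{i,-i\}$, with $h_i(i-1)=i$, $h_i(-(i-1))=-i$, $h_i(a)=a$ otherwise; $j$ has domain $\mathbf Z_{2m}\setminus\{1,-1\}$, with $j(a)=a-1$ if $a>0$, $j(a)=a+1$ if $a<0$. $u^-:\mathbf Q\to\mathbf P^-$ is given by $u^-(a)=a-1$ if $a>0$, $u^-(a)=a+1$ if $a<0$. $v^-$ has domain $\mathbf P^-\setminus\{0\}$ and is the inverse of the bijection $u^-{\restriction}:\mathbf Q\setminus\{\pm1\}\to\mathbf P^-\setminus\{0\}$. $\mathrm{id}_{-+}$,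 $\mathrm{id}_{+-}$ are the natural mutually inverse isomorphisms between $\mathbf P^-$ and $\mathbf P^+$. $\mathbf 0_{\mathbf P^-}$ is the element $0$ of $\mathbf P^-$ (a one-element subalgebra), viewed as a nullary operation. **Carrier maps** (lattice homomorphisms to $\{0,1\}$; not part of the alter ego's structure): on $\mathbf P^-$, $\delta^-(a)=1\iff a\geq0$; on $\mathbf P^+$, $\delta^+(a)=1\iff a\geq1$; on $\mathbf Q$, $\beta(a)=1\iff a>0$. **Multisorted dualities.** Let $\mathcal M=\{\mathbf M_1,\dots,\mathbf M_N\}$ be a finite set of finite algebras of a common type with disjoint universes, and $\mathcal A=\mathbb{ISP}(\mathcal M)$, a category with all homomorphisms. An alter ego is $\underset{\sim}{\mathcal M}=(M_1\dot\cup\cdots\dot\cup M_N;G,H,K,\mathcal T)$, where $G$ (resp. $H$) is a set of homomorphisms (resp. partial homomorphisms, i.e. homomorphisms whose domain is a subalgebra), each from some $\mathbf M_i$ to some $\mathbf M_j$, $K$ is a set of elements forming one-element subalgebras (nullary operations), and $\mathcal T$ is discrete. An $\underset{\sim}{\mathcal M}$-structure is $\mathbf X=X_1\dot\cup\cdots\dot\cup X_N$, with each $X_i$ a (possibly empty) Boolean space, the disjoint union topology, and interpretations of the symbols of $G,H,K$ between the corresponding sorts. Morphisms are continuous maps $\phi$ with $\phi(X_i)\subseteq Y_i$ preserving the structure (for $h\in H$: if $x\in\operatorname{dom}h^{\mathbf X}$ then $\phi(x)\in\operatorname{dom}h^{\mathbf Y}$ and $\phi(h^{\mathbf X}(x))=h^{\mathbf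 Y}(\phi(x))$). A substructure $\mathbf X$ of $\mathbf Y$ is a subset closed under the operations, partial operations and constants, with $\operatorname{dom}h^{\mathbf X}=\operatorname{dom}h^{\mathbf Y}\cap X$; an embedding is an isomorphism onto a closed substructure. Powers are formed by sorts: $\underset{\sim}{\mathcal M}^S=M_1^S\dot\cup\cdots\dot\cup M_N^S$ ($S\neq\emptyset$), with product topologies and pointwise structure (a partial operation $h$ is defined at $x$ iff $x(s)\in\operatorname{dom}h$ for all $s$). $\mathcal X=\mathbb{IS}_c\mathbb P^+(\underset{\sim}{\mathcal M})$ is the category of isomorphic copies of closed substructures of such powers (with the empty structure also included when it is a structure of this type). Define $\mathsf D(\mathbf A)=\mathcal A(\mathbf A,\mathbf M_1)\dot\cup\cdots\dot\cup\mathcal A(\mathbf A,\mathbf M_N)\leq\underset{\sim}{\mathcal M}^A$ and $\mathsf E(\mathbf X)=\mathcal X(\mathbf X,\underset{\sim}{\mathcal M})\leq\mathbf M_1^{X_1}\times\cdots\times\mathbf M_N^{X_N}$, with both functors acting on morphisms by precomposition. $\underset{\sim}{\mathcal M}$ *yields a duality* on $\mathcal A$ if the evaluation $e_{\mathbf A}:\mathbf A\to\mathsf{ED}(\mathbf A)$, $e_{\mathbf A}(a)(x)=x(a)$, is an isomorphism for all $\mathbf A\in\mathcal A$. The duality is *full* if also the evaluation $\varepsilon_{\mathbf X}:\mathbf X\to\mathsf{DE}(\mathbf X)$, $\varepsilon_{\mathbf X}(x)(\phi)=\phi(x)$, is an isomorphism for all $\mathbf X\in\mathcal X$ (so $\mathsf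 D,\mathsf E$ form a dual equivalence). It is *strong* if it is full and $\underset{\sim}{\mathcal M}$ is injective in $\mathcal X$ with respect to embeddings (for any embedding $\mathbf X\to\mathbf Y$ in $\mathcal X$, every morphism $\mathbf X\to\underset{\sim}{\mathcal M}$ extends to $\mathbf Y$). *)

theory Defs
  imports "HOL-Analysis.Analysis"
begin

section \<open>Algebras of the type of Sugihara algebras\<close>

record 'a salg =
  univ :: "'a set"
  meet :: "'a \<Rightarrow> 'a \<Rightarrow> 'a"
  join :: "'a \<Rightarrow> 'a \<Rightarrow> 'a"
  imp  :: "'a \<Rightarrow> 'a \<Rightarrow> 'a"
  neg  :: "'a \<Rightarrow> 'a"

definition subuniverse :: "'a set \<Rightarrow> 'a salg \<Rightarrow> bool" where
  "subuniverse B A \<longleftrightarrow> B \<subseteq> univ A \<and> B \<noteq> {} \<and>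
     (\<forall>a\<in>B. neg A a \<in> B \<and> (\<forall>b\<in>B. meet A a b \<in> B \<and> join A a b \<in> B \<and> imp A a b \<in> B))"

text \<open>As usual, algebras are non-empty. The values of the operations outside the universe are
  irrelevant: all notions below respect this.\<close>

definition salgebra :: "'a salg \<Rightarrow> bool" where
  "salgebra A \<longleftrightarrow> subuniverse (univ A) A"

definition subalg :: "'a salg \<Rightarrow> 'a set \<Rightarrow> 'a salg" where
  "subalg A B = A\<lparr>univ := B\<rparr>"

definition prod_alg :: "'i set \<Rightarrow> ('i \<Rightarrow> 'b salg) \<Rightarrow> ('i \<Rightarrow> 'b) salg" where
  "prod_alg I N =
     \<lparr>univ = (\<Pi>\<^sub>E i\<in>I. univ (N i)),
      meet = (\<lambda>f g. \<lambda>i\<in>I. meet (N i) (f i) (g i)),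
      join = (\<lambda>f g. \<lambda>i\<in>I. join (N i) (f i) (g i)),
      imp = (\<lambda>f g. \<lambda>i\<in>I. imp (N i) (f i) (g i)),
      neg = (\<lambda>f. \<lambda>i\<in>I. neg (N i) (f i))\<rparr>"

text \<open>Homomorphisms are extensional functions, so that hom-sets have the right elements.\<close>

definition alg_hom :: "'a salg \<Rightarrow> 'b salg \<Rightarrow> ('a \<Rightarrow> 'b) set" where
  "alg_hom A B = {h \<in> univ A \<rightarrow>\<^sub>E univ B. \<forall>a\<in>univ A. h (neg A a) = neg B (h a) \<and>
     (\<forall>b\<in>univ A. h (meet A a b) = meet B (h a) (h b) \<and> h (join A a b) = join B (h a) (h b) \<and>
        h (imp A a b) = imp B (h a) (h b))}"

definition alg_iso :: "'a salg \<Rightarrow> 'b salg \<Rightarrow> ('a \<Rightarrow> 'b) set" where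
  "alg_iso A B = {h \<in> alg_hom A B. bij_betw h (univ A) (univ B)}"

text \<open>Class operators. HOL cannot quantify over the type of the index set of a product inside a
  formula, so a sufficiently large index type is fixed. This loses nothing, see
  \<open>ISP_I\<close> and \<open>HSP_I\<close> below.\<close>

definition ISP :: "'b salg set \<Rightarrow> 'a salg set" where
  "ISP \<K> = {A. salgebra A \<and>
     (\<exists>(I :: ('a \<times> 'a) set) N B. N ` I \<subseteq> \<K> \<and> subuniverse B (prod_alg I N) \<and>
        alg_iso A (subalg (prod_alg I N) B) \<noteq> {})}"

definition HSP :: "'b salg set \<Rightarrow> 'a salg set" where
  "HSP \<K> = {A. salgebra A \<and>
     (\<exists>(I :: ('b salg \<times> ('a \<Rightarrow> 'b)) set) N B. N ` I \<subseteq> \<K> \<and> subuniverse B (prod_alg I N) \<and>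
        (\<exists>h \<in> alg_hom (subalg (prod_alg I N) B) A. h ` B = univ A))}"

lemma salgebra_closed:
  assumes "salgebra A" "a \<in> univ A" "b \<in> univ A"
  shows "neg A a \<in> univ A" "meet A a b \<in> univ A" "join A a b \<in> univ A" "imp A a b \<in> univ A"
  using assms by (auto simp: salgebra_def subuniverse_def)

lemma ISP_I:
  fixes A :: "'a salg" and I :: "'i set"
  assumes A: "salgebra A" and N: "N ` I \<subseteq> \<K>" and B: "subuniverse B (prod_alg I N)"
    and h: "h \<in> alg_iso A (subalg (prod_alg I N) B)"
  shows "A \<in> ISP \<K>"
proof -
  define J where "J = {(a, b). a \<in> univ A \<and> b \<in> univ A \<and> a \<noteq> b}"
  define c where "c = (\<lambda>(a, b). SOME i. i \<in> I \<and> h a i \<noteq> h b i)"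
  have hB: "h a \<in> B" "h a \<in> (\<Pi>\<^sub>E i\<in>I. univ (N i))" if "a \<in> univ A" for a
    using h B that by (auto simp: alg_iso_def alg_hom_def subalg_def subuniverse_def prod_alg_def)
  have c: "c (a, b) \<in> I \<and> h a (c (a, b)) \<noteq> h b (c (a, b))" if "(a, b) \<in> J" for a b
  proof -
    have "h a \<noteq> h b" using h that by (auto simp: alg_iso_def J_def bij_betw_def inj_on_def)
    then have "\<exists>i. i \<in> I \<and> h a i \<noteq> h b i"
      using that hB by (metis (mono_tags, lifting) J_def PiE_ext case_prodD mem_Collect_eq)
    then show ?thesis unfolding c_def using someI_ex[of "\<lambda>i. i \<in> I \<and> h a i \<noteq> h b i"] by simp
  qed
  have cI: "c p \<in> I" if "p \<in> J" for p using c that by (cases p) auto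
  define M where "M = (\<lambda>p. N (c p))"
  define k where "k = (\<lambda>a\<in>univ A. \<lambda>p\<in>J. h a (c p))"
  have ops: "k (neg A a) = neg (prod_alg J M) (k a)"
    "k (meet A a b) = meet (prod_alg J M) (k a) (k b)"
    "k (join A a b) = join (prod_alg J M) (k a) (k b)"
    "k (imp A a b) = imp (prod_alg J M) (k a) (k b)" if "a \<in> univ A" "b \<in> univ A" for a b
    using h that cI salgebra_closed[OF A that]
    by (auto simp: alg_iso_def alg_hom_def subalg_def k_def prod_alg_def M_def fun_eq_iff)
  have kP: "k a \<in> univ (prod_alg J M)" if "a \<in> univ A" for a
    using hB(2)[OF that] cI that by (auto simp: k_def prod_alg_def M_def)
  have sub: "subuniverse (k ` univ A) (prod_alg J M)"
    using A kP unfolding subuniverse_def salgebra_def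
    by (auto simp: ops[symmetric] simp flip: ops)
  have inj: "inj_on k (univ A)"
  proof (rule inj_onI, rule ccontr)
    fix a b assume *: "a \<in> univ A" "b \<in> univ A" "k a = k b" "a \<noteq> b"
    then have "(a, b) \<in> J" by (auto simp: J_def)
    with * show False using c[of a b] by (auto simp: k_def dest: fun_cong[of _ _ "(a, b)"])
  qed
  have "k \<in> alg_iso A (subalg (prod_alg J M) (k ` univ A))"
    using inj ops by (auto simp: alg_iso_def alg_hom_def subalg_def bij_betw_def k_def)
  moreover have "M ` J \<subseteq> \<K>" using N cI by (auto simp: M_def)
  ultimately show ?thesis using A sub unfolding ISP_def by blast
qed

lemma HSP_I:
  fixes A :: "'a salg" and I :: "'i set" and N :: "'i \<Rightarrow> 'b salg"
  assumes A: "salgebra A" and K: "\<And>M. M \<in> \<K> \<Longrightarrow> salgebra M"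
    and N: "N ` I \<subseteq> \<K>" and B: "subuniverse B (prod_alg I N)"
    and h: "h \<in> alg_hom (subalg (prod_alg I N) B) A" "h ` B = univ A"
  shows "A \<in> HSP \<K>"
proof -
  define J where "J = {(M, f). M \<in> \<K> \<and> f \<in> univ A \<rightarrow>\<^sub>E univ M}"
  define P where "P = prod_alg J (fst :: 'b salg \<times> ('a \<Rightarrow> 'b) \<Rightarrow> 'b salg)"
  obtain s where s: "\<And>a. a \<in> univ A \<Longrightarrow> s a \<in> B \<and> h (s a) = a"
  proof -
    have "\<forall>a\<in>univ A. \<exists>b. b \<in> B \<and> h b = a" unfolding h(2)[symmetric] by blast
    then show ?thesis using that by (auto dest!: bchoice)
  qed
  define t where "t = (\<lambda>i. (N i, \<lambda>a\<in>univ A. s a i))"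
  define T :: "('b salg \<times> ('a \<Rightarrow> 'b) \<Rightarrow> 'b) \<Rightarrow> 'i \<Rightarrow> 'b" where "T = (\<lambda>g. \<lambda>i\<in>I. g (t i))"
  have sP: "s a \<in> (\<Pi>\<^sub>E i\<in>I. univ (N i))" if "a \<in> univ A" for a
    using s[OF that] B by (auto simp: subuniverse_def prod_alg_def)
  have t: "t i \<in> J" if "i \<in> I" for i
    using that N sP by (auto simp: t_def J_def PiE_def Pi_def)
  define C where "C = {g \<in> univ P. T g \<in> B}"
  have JK: "fst p \<in> \<K>" if "p \<in> J" for p using that by (auto simp: J_def)
  have P: "salgebra P"
  proof -
    have "(\<lambda>p\<in>J. SOME x. x \<in> univ (fst p)) \<in> univ P"
      using K JK by (auto simp: P_def prod_alg_def salgebra_def subuniverse_def some_in_eq)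
    moreover have "\<forall>a\<in>univ P. neg P a \<in> univ P \<and> (\<forall>b\<in>univ P. meet P a b \<in> univ P \<and> join P a b \<in> univ P \<and> imp P a b \<in> univ P)"
      by (auto simp: P_def prod_alg_def PiE_iff simp del: split_paired_All
          intro!: salgebra_closed[OF K[OF JK]] salgebra_closed(1)[OF K[OF JK]])
    ultimately show ?thesis by (auto simp: salgebra_def subuniverse_def)
  qed
  have Tops: "T (neg P f) = neg (prod_alg I N) (T f)"
    "T (meet P f g) = meet (prod_alg I N) (T f) (T g)"
    "T (join P f g) = join (prod_alg I N) (T f) (T g)"
    "T (imp P f g) = imp (prod_alg I N) (T f) (T g)" for f g
    using t by (auto simp: T_def P_def prod_alg_def t_def fun_eq_iff)
  have proj: "\<exists>g\<in>C. T g = s a" if a: "a \<in> univ A" for a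
  proof
    let ?g = "\<lambda>p\<in>J. snd p a"
    have "T ?g = s a"
      using sP[OF a] t a by (auto simp: T_def t_def fun_eq_iff PiE_def extensional_def)
    moreover have "?g \<in> univ P" using a by (auto simp: P_def prod_alg_def J_def)
    ultimately show "?g \<in> C" "T ?g = s a" using s[OF a] by (auto simp: C_def)
  qed
  have C: "subuniverse C P"
  proof -
    have "univ A \<noteq> {}" using A by (auto simp: salgebra_def subuniverse_def)
    then have "C \<noteq> {}" using proj by blast
    then show ?thesis using salgebra_closed[OF P] B by (auto simp: subuniverse_def C_def Tops)
  qed
  define k where "k = (\<lambda>g\<in>C. h (T g))"
  have hh: "h \<in> alg_hom (subalg (prod_alg I N) B) A" by fact
  have TB: "T g \<in> B" if "g \<in> C" for g using that by (simp add: C_def)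
  have "k \<in> alg_hom (subalg P C) A"
    using C hh TB unfolding subuniverse_def
    by (auto simp: k_def alg_hom_def subalg_def Tops)
  moreover have "k ` C = univ A"
  proof
    show "k ` C \<subseteq> univ A" using h(2) by (auto simp: k_def C_def)
    show "univ A \<subseteq> k ` C"
    proof
      fix a assume "a \<in> univ A"
      then obtain g where "g \<in> C" "T g = s a" using proj by blast
      then show "a \<in> k ` C" using s[OF \<open>a \<in> univ A\<close>] by (force simp: k_def)
    qed
  qed
  moreover have "fst ` J \<subseteq> \<K>" using JK by auto
  ultimately show ?thesis using A C unfolding HSP_def P_def by blast
qed


section \<open>Multisorted structures\<close>

text \<open>\<open>gops\<close>, \<open>hops\<close> and \<open>kops\<close> are the symbols for total operations, partial operations and
  nullary operations. Every element of the type \<open>'s\<close> is a sort.\<close>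

record ('s, 'r, 'k) msig =
  gops :: "'r set"
  hops :: "'r set"
  kops :: "'k set"
  src :: "'r \<Rightarrow> 's"
  tgt :: "'r \<Rightarrow> 's"
  csort :: "'k \<Rightarrow> 's"

text \<open>A structure on the disjoint union of a family of sorts: the point \<open>x\<close> of sort \<open>i\<close> is the pair
  \<open>(i, x)\<close> of \<open>sum_topology (stop X) UNIV\<close>, so the sorts need not be disjoint as subsets of
  \<open>'x\<close>. Total operations are also given a domain, which has to be the full source sort.\<close>

record ('s, 'x, 'r, 'k) mstruct =
  stop :: "'s \<Rightarrow> 'x topology"
  odom :: "'r \<Rightarrow> 'x set"
  oapp :: "'r \<Rightarrow> 'x \<Rightarrow> 'x"
  cval :: "'k \<Rightarrow> 'x"

abbreviation pts :: "('s, 'x, 'r, 'k) mstruct \<Rightarrow> 's \<Rightarrow> 'x set" where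
  "pts X i \<equiv> topspace (stop X i)"

abbreviation total_space :: "('s, 'x, 'r, 'k) mstruct \<Rightarrow> ('s \<times> 'x) topology" where
  "total_space X \<equiv> sum_topology (stop X) UNIV"

definition boolean_space :: "'x topology \<Rightarrow> bool" where
  "boolean_space T \<longleftrightarrow> compact_space T \<and> Hausdorff_space T \<and>
     (\<forall>U x. openin T U \<and> x \<in> U \<longrightarrow> (\<exists>V. openin T V \<and> closedin T V \<and> x \<in> V \<and> V \<subseteq> U))"

definition mstructure :: "('s, 'r, 'k) msig \<Rightarrow> ('s, 'x, 'r, 'k) mstruct \<Rightarrow> bool" where
  "mstructure \<Sigma> X \<longleftrightarrow>
     (\<forall>i. boolean_space (stop X i)) \<and>
     (\<forall>r\<in>gops \<Sigma>. odom X r = pts X (src \<Sigma> r)) \<and>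
     (\<forall>r\<in>hops \<Sigma>. odom X r \<subseteq> pts X (src \<Sigma> r)) \<and>
     (\<forall>r\<in>gops \<Sigma> \<union> hops \<Sigma>. oapp X r \<in> odom X r \<rightarrow> pts X (tgt \<Sigma> r)) \<and>
     (\<forall>k\<in>kops \<Sigma>. cval X k \<in> pts X (csort \<Sigma> k))"

definition mor ::
  "('s, 'r, 'k) msig \<Rightarrow> ('s, 'x, 'r, 'k) mstruct \<Rightarrow> ('s, 'y, 'r, 'k) mstruct \<Rightarrow> ('s \<Rightarrow> 'x \<Rightarrow> 'y) set" where
  "mor \<Sigma> X Y = {\<phi>.
     (\<forall>i. \<phi> i \<in> pts X i \<rightarrow>\<^sub>E pts Y i) \<and>
     continuous_map (total_space X) (total_space Y) (\<lambda>(i, x). (i, \<phi> i x)) \<and>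
     (\<forall>r\<in>gops \<Sigma> \<union> hops \<Sigma>. \<forall>x\<in>odom X r.
        \<phi> (src \<Sigma> r) x \<in> odom Y r \<and> \<phi> (tgt \<Sigma> r) (oapp X r x) = oapp Y r (\<phi> (src \<Sigma> r) x)) \<and>
     (\<forall>k\<in>kops \<Sigma>. \<phi> (csort \<Sigma> k) (cval X k) = cval Y k)}"

definition mor_iso ::
  "('s, 'r, 'k) msig \<Rightarrow> ('s, 'x, 'r, 'k) mstruct \<Rightarrow> ('s, 'y, 'r, 'k) mstruct \<Rightarrow> ('s \<Rightarrow> 'x \<Rightarrow> 'y) set" where
  "mor_iso \<Sigma> X Y = {\<phi> \<in> mor \<Sigma> X Y. \<exists>\<psi>\<in>mor \<Sigma> Y X.
     (\<forall>i. \<forall>x\<in>pts X i. \<psi> i (\<phi> i x) = x) \<and> (\<forall>i. \<forall>y\<in>pts Y i. \<phi> i (\<psi> i y) = y)}"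

lemma continuous_map_total_space:
  assumes "\<And>i. \<phi> i \<in> pts X i \<rightarrow> pts Y i"
  shows "continuous_map (total_space X) (total_space Y) (\<lambda>(i, x). (i, \<phi> i x)) \<longleftrightarrow>
    (\<forall>i. continuous_map (stop X i) (stop Y i) (\<phi> i))"
proof -
  have B: "openin (total_space Y) (Pair i ` V)" if "openin (stop Y i) V" for i V
  proof -
    have "{x. (j, x) \<in> Pair i ` V} = (if j = i then V else {})" for j by auto
    then show ?thesis using that openin_subset[OF that] by (auto simp: openin_sum_topology)
  qed
  show ?thesis
  proof (intro iffI allI)
    fix i assume c: "continuous_map (total_space X) (total_space Y) (\<lambda>(i, x). (i, \<phi> i x))"
    show "continuous_map (stop X i) (stop Y i) (\<phi> i)"
      unfolding continuous_map_def
    proof (intro conjI allI impI)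
      show "\<phi> i \<in> pts X i \<rightarrow> pts Y i" by fact
      fix V assume "openin (stop Y i) V"
      then have "openin (total_space X) {p \<in> topspace (total_space X). (case p of (i, x) \<Rightarrow> (i, \<phi> i x)) \<in> Pair i ` V}"
        using c B unfolding continuous_map_def by blast
      then have "openin (stop X i) {x. (i,x) \<in> {p \<in> topspace (total_space X). (case p of (i, x) \<Rightarrow> (i, \<phi> i x)) \<in> Pair i ` V}}"
        unfolding openin_sum_topology by blast
      moreover have "{x. (i,x) \<in> {p \<in> topspace (total_space X). (case p of (i, x) \<Rightarrow> (i, \<phi> i x)) \<in> Pair i ` V}} = {x \<in> pts X i. \<phi> i x \<in> V}"
        by auto
      ultimately show "openin (stop X i) {x \<in> pts X i. \<phi> i x \<in> V}" by simp
    qed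
  next
    assume c: "\<forall>i. continuous_map (stop X i) (stop Y i) (\<phi> i)"
    show "continuous_map (total_space X) (total_space Y) (\<lambda>(i, x). (i, \<phi> i x))"
      unfolding continuous_map_def
    proof (intro conjI allI impI)
      show "(\<lambda>(i, x). (i, \<phi> i x)) \<in> topspace (total_space X) \<rightarrow> topspace (total_space Y)"
        using assms by fastforce
      fix U assume U: "openin (total_space Y) U"
      have "openin (stop X i) {x \<in> pts X i. \<phi> i x \<in> {y. (i, y) \<in> U}}" for i
        using c U unfolding continuous_map_def openin_sum_topology by blast
      then show "openin (total_space X) {x \<in> topspace (total_space X). (case x of (i, x) \<Rightarrow> (i, \<phi> i x)) \<in> U}"
        unfolding openin_sum_topology by (auto simp: case_prod_beta)
    qed
  qed
qed

lemma closedin_total_space: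
  "closedin (total_space Y) (Sigma UNIV C) \<longleftrightarrow> (\<forall>i. closedin (stop Y i) (C i))"
  by (simp add: closedin_disjoint_union)

definition closed_substructure ::
  "('s, 'r, 'k) msig \<Rightarrow> ('s, 'y, 'r, 'k) mstruct \<Rightarrow> ('s \<Rightarrow> 'y set) \<Rightarrow> bool" where
  "closed_substructure \<Sigma> Y C \<longleftrightarrow>
     closedin (total_space Y) (Sigma UNIV C) \<and>
     (\<forall>r\<in>gops \<Sigma> \<union> hops \<Sigma>. \<forall>y \<in> odom Y r \<inter> C (src \<Sigma> r). oapp Y r y \<in> C (tgt \<Sigma> r)) \<and>
     (\<forall>k\<in>kops \<Sigma>. cval Y k \<in> C (csort \<Sigma> k))"

definition substruct ::
  "('s, 'r, 'k) msig \<Rightarrow> ('s, 'y, 'r, 'k) mstruct \<Rightarrow> ('s \<Rightarrow> 'y set) \<Rightarrow> ('s, 'y, 'r, 'k) mstruct" where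
  "substruct \<Sigma> Y C =
     \<lparr>stop = (\<lambda>i. subtopology (stop Y i) (C i)),
      odom = (\<lambda>r. odom Y r \<inter> C (src \<Sigma> r)),
      oapp = oapp Y,
      cval = cval Y\<rparr>"

definition embedding ::
  "('s, 'r, 'k) msig \<Rightarrow> ('s, 'x, 'r, 'k) mstruct \<Rightarrow> ('s, 'y, 'r, 'k) mstruct \<Rightarrow> ('s \<Rightarrow> 'x \<Rightarrow> 'y) set" where
  "embedding \<Sigma> X Y = {\<phi>. \<exists>C. closed_substructure \<Sigma> Y C \<and> \<phi> \<in> mor_iso \<Sigma> X (substruct \<Sigma> Y C)}"

definition power_struct ::
  "('s, 'r, 'k) msig \<Rightarrow> ('s, 'm, 'r, 'k) mstruct \<Rightarrow> 'i set \<Rightarrow> ('s, 'i \<Rightarrow> 'm, 'r, 'k) mstruct" where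
  "power_struct \<Sigma> M S =
     \<lparr>stop = (\<lambda>i. product_topology (\<lambda>_. stop M i) S),
      odom = (\<lambda>r. {x \<in> S \<rightarrow>\<^sub>E pts M (src \<Sigma> r). \<forall>s\<in>S. x s \<in> odom M r}),
      oapp = (\<lambda>r x. \<lambda>s\<in>S. oapp M r (x s)),
      cval = (\<lambda>k. \<lambda>s\<in>S. cval M k)\<rparr>"

text \<open>Again the index type of the power is fixed without loss of generality, see \<open>IScP_I\<close> below.
  If \<open>kops \<Sigma>\<close> is non-empty then no structure has all its sorts empty.\<close>

definition IScP ::
  "('s, 'r, 'k) msig \<Rightarrow> ('s, 'm, 'r, 'k) mstruct \<Rightarrow> ('s, 'x, 'r, 'k) mstruct set" where
  "IScP \<Sigma> M = {X. mstructure \<Sigma> X \<and>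
     ((\<forall>i. pts X i = {}) \<or>
      (\<exists>S :: ('s \<Rightarrow> 'x \<Rightarrow> 'm) set. S \<noteq> {} \<and> embedding \<Sigma> X (power_struct \<Sigma> M S) \<noteq> {}))}"

lemma IScP_I:
  fixes X :: "('s, 'x, 'r, 'k) mstruct" and M :: "('s, 'm, 'r, 'k) mstruct" and S :: "'i set"
  assumes X: "mstructure \<Sigma> X" and M: "\<And>i. Hausdorff_space (stop M i)"
    and S: "S \<noteq> {}" and e: "e \<in> embedding \<Sigma> X (power_struct \<Sigma> M S)"
  shows "X \<in> IScP \<Sigma> M"
proof -
  define P where "P = power_struct \<Sigma> M S"
  obtain C where "closed_substructure \<Sigma> P C" and eC: "e \<in> mor_iso \<Sigma> X (substruct \<Sigma> P C)"
    using e by (auto simp: embedding_def P_def)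
  then have em: "e \<in> mor \<Sigma> X (substruct \<Sigma> P C)" by (simp add: mor_iso_def)
  obtain d where dm: "d \<in> mor \<Sigma> (substruct \<Sigma> P C) X"
    and de: "\<And>i x. x \<in> pts X i \<Longrightarrow> d i (e i x) = x"
    using eC by (auto simp: mor_iso_def)
  let ?ops = "gops \<Sigma> \<union> hops \<Sigma>"
  have cont: "continuous_map (stop Y i) (stop Z i) (f i)" if "f \<in> mor \<Sigma> Y Z"
    for Y :: "('s, 'u, 'r, 'k) mstruct" and Z :: "('s, 'v, 'r, 'k) mstruct" and f i
  proof -
    have "\<And>i. f i \<in> pts Y i \<rightarrow> pts Z i" using that by (auto simp: mor_def)
    then show ?thesis using that continuous_map_total_space[of f Y Z] by (auto simp: mor_def)
  qed
  have morI: "f \<in> mor \<Sigma> Y Z" if "\<And>i. f i \<in> extensional (pts Y i)"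
    "\<And>i. continuous_map (stop Y i) (stop Z i) (f i)"
    "\<And>r x. r \<in> ?ops \<Longrightarrow> x \<in> odom Y r \<Longrightarrow>
        f (src \<Sigma> r) x \<in> odom Z r \<and> f (tgt \<Sigma> r) (oapp Y r x) = oapp Z r (f (src \<Sigma> r) x)"
    "\<And>k. k \<in> kops \<Sigma> \<Longrightarrow> f (csort \<Sigma> k) (cval Y k) = cval Z k"
    for Y :: "('s, 'u, 'r, 'k) mstruct" and Z :: "('s, 'v, 'r, 'k) mstruct" and f
  proof -
    have "\<And>i. f i \<in> pts Y i \<rightarrow> pts Z i" using that(2) by (auto simp: continuous_map_def)
    then show ?thesis using that continuous_map_total_space[of f Y Z] by (auto simp: mor_def PiE_def)
  qed
  have Xdom: "x \<in> pts X (src \<Sigma> r)" "oapp X r x \<in> pts X (tgt \<Sigma> r)" if "r \<in> ?ops" "x \<in> odom X r" for r x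
    using X that by (auto simp: mstructure_def)
  have Xc: "cval X k \<in> pts X (csort \<Sigma> k)" if "k \<in> kops \<Sigma>" for k
    using X that by (auto simp: mstructure_def)
  have e1: "e i x \<in> pts (substruct \<Sigma> P C) i" if "x \<in> pts X i" for i x
    using em that unfolding mor_def by blast
  have e2: "e (src \<Sigma> r) x \<in> odom (substruct \<Sigma> P C) r"
    "e (tgt \<Sigma> r) (oapp X r x) = oapp (substruct \<Sigma> P C) r (e (src \<Sigma> r) x)"
    if "r \<in> ?ops" "x \<in> odom X r" for r x
    using em that unfolding mor_def by blast+
  have e3: "e (csort \<Sigma> k) (cval X k) = cval (substruct \<Sigma> P C) k" if "k \<in> kops \<Sigma>" for k
    using em that unfolding mor_def by blast
  have e_pts: "e i x \<in> C i" "e i x \<in> S \<rightarrow>\<^sub>E pts M i" if "x \<in> pts X i" for i x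
    using e1[OF that] by (simp_all add: substruct_def P_def power_struct_def)
  have e_op: "s \<in> S \<Longrightarrow> e (src \<Sigma> r) x s \<in> odom M r"
    "s \<in> S \<Longrightarrow> e (tgt \<Sigma> r) (oapp X r x) s = oapp M r (e (src \<Sigma> r) x s)"
    if "r \<in> ?ops" "x \<in> odom X r" for r x s
    using e2[OF that] by (simp_all add: substruct_def P_def power_struct_def)
  have e_c: "e (csort \<Sigma> k) (cval X k) s = cval M k" if "k \<in> kops \<Sigma>" "s \<in> S" for k s
    using e3 that by (simp add: substruct_def P_def power_struct_def)
  have refl: "x \<in> odom X r" if "r \<in> ?ops" "x \<in> pts X (src \<Sigma> r)" "\<forall>s\<in>S. e (src \<Sigma> r) x s \<in> odom M r" for r x
  proof -
    have "e (src \<Sigma> r) x \<in> odom (substruct \<Sigma> P C) r"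
      using that e_pts[OF that(2)] by (auto simp: substruct_def P_def power_struct_def)
    then have "d (src \<Sigma> r) (e (src \<Sigma> r) x) \<in> odom X r" using dm that(1) unfolding mor_def by blast
    then show ?thesis using de that by simp
  qed

  define p where "p = (\<lambda>s i. \<lambda>x\<in>pts X i. e i x s)"
  define S' where "S' = p ` S"
  define P' where "P' = power_struct \<Sigma> M S'"
  define e' where "e' = (\<lambda>i. \<lambda>x\<in>pts X i. \<lambda>f\<in>S'. f i x)"
  define C' where "C' = (\<lambda>i. e' i ` pts X i)"
  define R where "R = (\<lambda>y :: ('s \<Rightarrow> 'x \<Rightarrow> 'm) \<Rightarrow> 'm. \<lambda>s\<in>S. y (p s))"
  define d' where "d' = (\<lambda>i. \<lambda>y\<in>C' i. d i (R y))"
  have R: "R (e' i x) = e i x" if "x \<in> pts X i" for i x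
    using e_pts(2)[OF that] that
    by (auto simp: R_def e'_def S'_def p_def fun_eq_iff PiE_def extensional_def)
  have d'e': "d' i (e' i x) = x" if "x \<in> pts X i" for i x
    using that R de by (simp add: d'_def C'_def)
  have stopP: "stop P i = product_topology (\<lambda>_. stop M i) S"
    "stop P' i = product_topology (\<lambda>_. stop M i) S'" for i
    by (simp_all add: P_def P'_def power_struct_def)
  have stopsub: "stop (substruct \<Sigma> Z D) i = subtopology (stop Z i) (D i)"
    for Z :: "('s, 'u, 'r, 'k) mstruct" and D i
    by (simp add: substruct_def)
  have e'P: "continuous_map (stop X i) (stop P' i) (e' i)" for i
    unfolding stopP continuous_map_componentwise
  proof (intro conjI ballI)
    show "e' i ` pts X i \<subseteq> extensional S'" by (auto simp: e'_def)
    fix f assume "f \<in> S'"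
    then obtain s where s: "s \<in> S" "f = p s" by (auto simp: S'_def)
    have "continuous_map (stop X i) (product_topology (\<lambda>_. stop M i) S) (e i)"
      using cont[OF em, of i] by (simp add: stopsub stopP continuous_map_in_subtopology)
    then have "continuous_map (stop X i) (stop M i) (\<lambda>x. e i x s)"
      using s(1) by (simp add: continuous_map_componentwise)
    then show "continuous_map (stop X i) (stop M i) (\<lambda>x. e' i x f)"
      by (rule continuous_map_eq) (use s \<open>f \<in> S'\<close> in \<open>auto simp: e'_def p_def\<close>)
  qed
  have C'P: "C' i \<subseteq> pts P' i" for i
    using e'P[of i] by (auto simp: C'_def continuous_map_def)
  have odomP': "e' (src \<Sigma> r) x \<in> odom P' r \<longleftrightarrow> x \<in> odom X r"
    if "r \<in> ?ops" "x \<in> pts X (src \<Sigma> r)" for r x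
  proof
    assume "x \<in> odom X r"
    moreover have "e' (src \<Sigma> r) x \<in> pts P' (src \<Sigma> r)" using C'P that(2) by (auto simp: C'_def)
    ultimately show "e' (src \<Sigma> r) x \<in> odom P' r"
      using that e_op(1)[OF that(1)] unfolding stopP by (auto simp: P'_def power_struct_def e'_def S'_def p_def)
  next
    assume "e' (src \<Sigma> r) x \<in> odom P' r"
    then show "x \<in> odom X r"
      using that by (intro refl) (auto simp: P'_def power_struct_def e'_def S'_def p_def)
  qed
  have oappP': "oapp P' r (e' (src \<Sigma> r) x) = e' (tgt \<Sigma> r) (oapp X r x)"
    if "r \<in> ?ops" "x \<in> odom X r" for r x
    using Xdom[OF that] e_op(2)[OF that]
    by (auto simp: P'_def power_struct_def e'_def S'_def p_def fun_eq_iff)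
  have cvalP': "e' (csort \<Sigma> k) (cval X k) = cval P' k" if "k \<in> kops \<Sigma>" for k
    using Xc[OF that] e_c[OF that]
    by (auto simp: P'_def power_struct_def e'_def S'_def p_def fun_eq_iff)
  have "closedin (stop P' i) (C' i)" for i
  proof (rule compactin_imp_closedin)
    show "Hausdorff_space (stop P' i)" unfolding stopP using M by (simp add: Hausdorff_space_product_topology)
    have "compactin (stop X i) (pts X i)"
      using X by (auto simp: mstructure_def boolean_space_def compact_space_def)
    then show "compactin (stop P' i) (C' i)" unfolding C'_def by (rule image_compactin[OF _ e'P])
  qed
  then have cs: "closed_substructure \<Sigma> P' C'"
    unfolding closed_substructure_def closedin_total_space
  proof (intro conjI ballI allI)
    fix r y assume r: "r \<in> ?ops" and y: "y \<in> odom P' r \<inter> C' (src \<Sigma> r)"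
    then obtain x where x: "x \<in> pts X (src \<Sigma> r)" "y = e' (src \<Sigma> r) x" by (auto simp: C'_def)
    then have "x \<in> odom X r" using odomP' r y by auto
    then show "oapp P' r y \<in> C' (tgt \<Sigma> r)"
      using oappP'[OF r] Xdom[OF r] by (auto simp: C'_def x)
  next
    fix k assume k: "k \<in> kops \<Sigma>"
    then show "cval P' k \<in> C' (csort \<Sigma> k)" using cvalP'[OF k, symmetric] Xc by (auto simp: C'_def)
  qed blast
  have e'm: "e' \<in> mor \<Sigma> X (substruct \<Sigma> P' C')"
  proof (rule morI)
    show "e' i \<in> extensional (pts X i)" for i by (simp add: e'_def)
    show "continuous_map (stop X i) (stop (substruct \<Sigma> P' C') i) (e' i)" for i
      using e'P by (auto simp: stopsub continuous_map_in_subtopology C'_def)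
    show "e' (csort \<Sigma> k) (cval X k) = cval (substruct \<Sigma> P' C') k" if "k \<in> kops \<Sigma>" for k
      using cvalP'[OF that] by (simp add: substruct_def)
  next
    fix r x assume "r \<in> ?ops" "x \<in> odom X r"
    then show "e' (src \<Sigma> r) x \<in> odom (substruct \<Sigma> P' C') r \<and>
       e' (tgt \<Sigma> r) (oapp X r x) = oapp (substruct \<Sigma> P' C') r (e' (src \<Sigma> r) x)"
      using odomP' oappP' Xdom by (auto simp: substruct_def C'_def)
  qed
  have ptsC': "pts (substruct \<Sigma> P' C') i = C' i" for i
    using C'P by (auto simp: stopsub)
  have d'm: "d' \<in> mor \<Sigma> (substruct \<Sigma> P' C') X"
  proof (rule morI)
    show "d' i \<in> extensional (pts (substruct \<Sigma> P' C') i)" for i by (simp add: d'_def ptsC')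
  next
    fix i
    have "continuous_map (stop P' i) (stop P i) R"
      unfolding stopP continuous_map_componentwise
    proof (intro conjI ballI)
      show "R ` topspace (product_topology (\<lambda>_. stop M i) S') \<subseteq> extensional S" by (auto simp: R_def)
      fix s assume s: "s \<in> S"
      then have "continuous_map (product_topology (\<lambda>_. stop M i) S') (stop M i) (\<lambda>y. y (p s))"
        by (intro continuous_map_product_projection) (auto simp: S'_def)
      then show "continuous_map (product_topology (\<lambda>_. stop M i) S') (stop M i) (\<lambda>y. R y s)"
        using s by (simp add: R_def)
    qed
    then have "continuous_map (stop (substruct \<Sigma> P' C') i) (stop (substruct \<Sigma> P C) i) R"
      using R e_pts by (auto simp: stopsub continuous_map_in_subtopology continuous_map_from_subtopology C'_def)
    then have "continuous_map (stop (substruct \<Sigma> P' C') i) (stop X i) (d i \<circ> R)"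
      using cont[OF dm, of i] continuous_map_compose by blast
    then show "continuous_map (stop (substruct \<Sigma> P' C') i) (stop X i) (d' i)"
      by (rule continuous_map_eq) (simp add: ptsC' d'_def)
  next
    fix k assume k: "k \<in> kops \<Sigma>"
    then show "d' (csort \<Sigma> k) (cval (substruct \<Sigma> P' C') k) = cval X k"
      using d'e'[OF Xc[OF k]] cvalP'[OF k] by (simp add: substruct_def)
  next
    fix r y assume r: "r \<in> ?ops" and y: "y \<in> odom (substruct \<Sigma> P' C') r"
    then obtain x where x: "x \<in> pts X (src \<Sigma> r)" "y = e' (src \<Sigma> r) x"
      by (auto simp: C'_def substruct_def)
    then have xr: "x \<in> odom X r" using odomP' r y by (auto simp: substruct_def)
    then show "d' (src \<Sigma> r) y \<in> odom X r \<and>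
       d' (tgt \<Sigma> r) (oapp (substruct \<Sigma> P' C') r y) = oapp X r (d' (src \<Sigma> r) y)"
      using x oappP'[OF r xr] d'e'[OF x(1)] d'e'[OF Xdom(2)[OF r xr]] by (simp add: substruct_def)
  qed
  have "e' \<in> mor_iso \<Sigma> X (substruct \<Sigma> P' C')"
  proof -
    have "e' i (d' i y) = y" if "y \<in> pts (substruct \<Sigma> P' C') i" for i y
      using that d'e' unfolding ptsC' by (auto simp: C'_def)
    then show ?thesis using e'm d'm d'e' unfolding mor_iso_def by blast
  qed
  then have "e' \<in> embedding \<Sigma> X (power_struct \<Sigma> M S')"
    using cs by (auto simp: embedding_def P'_def)
  moreover have "S' \<noteq> {}" using S by (simp add: S'_def)
  ultimately show ?thesis using X by (auto simp: IScP_def)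
qed


section \<open>Alter egos and dualities\<close>

text \<open>\<open>\<MM>\<close> is the family of algebras, one for each sort, and \<open>M\<close> is the structure on the disjoint
  union of their universes.\<close>

definition alter_ego ::
  "('s, 'r, 'k) msig \<Rightarrow> ('s \<Rightarrow> 'm salg) \<Rightarrow> ('s, 'm, 'r, 'k) mstruct \<Rightarrow> bool" where
  "alter_ego \<Sigma> \<MM> M \<longleftrightarrow>
     finite (UNIV :: 's set) \<and>
     (\<forall>i. salgebra (\<MM> i) \<and> finite (univ (\<MM> i)) \<and> stop M i = discrete_topology (univ (\<MM> i))) \<and>
     (\<forall>r\<in>gops \<Sigma>. odom M r = univ (\<MM> (src \<Sigma> r))) \<and>
     (\<forall>r\<in>gops \<Sigma> \<union> hops \<Sigma>. subuniverse (odom M r) (\<MM> (src \<Sigma> r)) \<and>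
        restrict (oapp M r) (odom M r) \<in> alg_hom (subalg (\<MM> (src \<Sigma> r)) (odom M r)) (\<MM> (tgt \<Sigma> r))) \<and>
     (\<forall>k\<in>kops \<Sigma>. subuniverse {cval M k} (\<MM> (csort \<Sigma> k)))"

definition Dual ::
  "('s, 'r, 'k) msig \<Rightarrow> ('s \<Rightarrow> 'm salg) \<Rightarrow> ('s, 'm, 'r, 'k) mstruct \<Rightarrow> 'a salg
     \<Rightarrow> ('s, 'a \<Rightarrow> 'm, 'r, 'k) mstruct" where
  "Dual \<Sigma> \<MM> M A = substruct \<Sigma> (power_struct \<Sigma> M (univ A)) (\<lambda>i. alg_hom A (\<MM> i))"

definition Edual ::
  "('s, 'r, 'k) msig \<Rightarrow> ('s \<Rightarrow> 'm salg) \<Rightarrow> ('s, 'm, 'r, 'k) mstruct \<Rightarrow> ('s, 'x, 'r, 'k) mstruct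
     \<Rightarrow> ('s \<Rightarrow> 'x \<Rightarrow> 'm) salg" where
  "Edual \<Sigma> \<MM> M X =
     \<lparr>univ = mor \<Sigma> X M,
      meet = (\<lambda>\<phi> \<psi> i. \<lambda>x\<in>pts X i. meet (\<MM> i) (\<phi> i x) (\<psi> i x)),
      join = (\<lambda>\<phi> \<psi> i. \<lambda>x\<in>pts X i. join (\<MM> i) (\<phi> i x) (\<psi> i x)),
      imp = (\<lambda>\<phi> \<psi> i. \<lambda>x\<in>pts X i. imp (\<MM> i) (\<phi> i x) (\<psi> i x)),
      neg = (\<lambda>\<phi> i. \<lambda>x\<in>pts X i. neg (\<MM> i) (\<phi> i x))\<rparr>"

definition eval_alg ::
  "('s, 'r, 'k) msig \<Rightarrow> ('s \<Rightarrow> 'm salg) \<Rightarrow> ('s, 'm, 'r, 'k) mstruct \<Rightarrow> 'a salg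
     \<Rightarrow> 'a \<Rightarrow> 's \<Rightarrow> ('a \<Rightarrow> 'm) \<Rightarrow> 'm" where
  "eval_alg \<Sigma> \<MM> M A = (\<lambda>a\<in>univ A. \<lambda>i. \<lambda>x\<in>pts (Dual \<Sigma> \<MM> M A) i. x a)"

definition eval_struct ::
  "('s, 'r, 'k) msig \<Rightarrow> ('s \<Rightarrow> 'm salg) \<Rightarrow> ('s, 'm, 'r, 'k) mstruct \<Rightarrow> ('s, 'x, 'r, 'k) mstruct
     \<Rightarrow> 's \<Rightarrow> 'x \<Rightarrow> ('s \<Rightarrow> 'x \<Rightarrow> 'm) \<Rightarrow> 'm" where
  "eval_struct \<Sigma> \<MM> M X = (\<lambda>i. \<lambda>x\<in>pts X i. \<lambda>\<phi>\<in>mor \<Sigma> X M. \<phi> i x)"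

text \<open>In the following notions \<open>\<A>\<close> is the class of all algebras with universe in \<open>'a\<close> that belong
  to the class under consideration; the structures have their points in \<open>'x\<close> and \<open>'y\<close>. Truth for
  all algebras and structures is obtained by letting these types be arbitrary.\<close>

definition yields_duality ::
  "('s, 'r, 'k) msig \<Rightarrow> ('s \<Rightarrow> 'm salg) \<Rightarrow> ('s, 'm, 'r, 'k) mstruct \<Rightarrow> 'a salg set \<Rightarrow> bool" where
  "yields_duality \<Sigma> \<MM> M \<A> \<longleftrightarrow>
     alter_ego \<Sigma> \<MM> M \<and> \<A> = ISP (range \<MM>) \<and>
     (\<forall>A\<in>\<A>. eval_alg \<Sigma> \<MM> M A \<in> alg_iso A (Edual \<Sigma> \<MM> M (Dual \<Sigma> \<MM> M A)))"

definition yields_full_duality ::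
  "'x itself \<Rightarrow> ('s, 'r, 'k) msig \<Rightarrow> ('s \<Rightarrow> 'm salg) \<Rightarrow> ('s, 'm, 'r, 'k) mstruct \<Rightarrow> 'a salg set \<Rightarrow> bool" where
  "yields_full_duality _ \<Sigma> \<MM> M \<A> \<longleftrightarrow>
     yields_duality \<Sigma> \<MM> M \<A> \<and>
     (\<forall>X :: ('s, 'x, 'r, 'k) mstruct. X \<in> IScP \<Sigma> M \<longrightarrow>
        eval_struct \<Sigma> \<MM> M X \<in> mor_iso \<Sigma> X (Dual \<Sigma> \<MM> M (Edual \<Sigma> \<MM> M X)))"

definition yields_strong_duality ::
  "'x itself \<Rightarrow> 'y itself \<Rightarrow> ('s, 'r, 'k) msig \<Rightarrow> ('s \<Rightarrow> 'm salg) \<Rightarrow> ('s, 'm, 'r, 'k) mstruct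
     \<Rightarrow> 'a salg set \<Rightarrow> bool" where
  "yields_strong_duality _ _ \<Sigma> \<MM> M \<A> \<longleftrightarrow>
     yields_full_duality TYPE('x) \<Sigma> \<MM> M \<A> \<and>
     (\<forall>(X :: ('s, 'x, 'r, 'k) mstruct) (Y :: ('s, 'y, 'r, 'k) mstruct).
        X \<in> IScP \<Sigma> M \<and> Y \<in> IScP \<Sigma> M \<longrightarrow>
        (\<forall>\<epsilon> \<in> embedding \<Sigma> X Y. \<forall>\<phi> \<in> mor \<Sigma> X M. \<exists>\<psi> \<in> mor \<Sigma> Y M.
           \<forall>i. \<forall>x\<in>pts X i. \<psi> i (\<epsilon> i x) = \<phi> i x))"


section \<open>The Sugihara algebras and their alter ego\<close>

text \<open>For \<open>k \<ge> 1\<close> this is the algebra with universe \<open>{-n..n}\<close> if \<open>k = 2 * n + 1\<close>, and with universe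
  \<open>{-n..n} - {0}\<close> if \<open>k = 2 * n\<close>.\<close>

definition Z_alg :: "nat \<Rightarrow> int salg" where
  "Z_alg k =
     \<lparr>univ = {- int (k div 2)..int (k div 2)} - (if even k then {0} else {}),
      meet = min,
      join = max,
      imp = (\<lambda>a b. if a \<le> b then max (- a) b else min (- a) b),
      neg = uminus\<rparr>"

datatype sort = Pm | Pp | Q

primrec sort_alg :: "nat \<Rightarrow> sort \<Rightarrow> int salg" where
  "sort_alg m Pm = Z_alg (2 * m - 1)"
| "sort_alg m Pp = Z_alg (2 * m - 1)"
| "sort_alg m Q = Z_alg (2 * m)"

text \<open>The carrier maps \<open>\<delta>\<^sup>-\<close>, \<open>\<delta>\<^sup>+\<close> and \<open>\<beta>\<close> are not part of the alter ego.\<close>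

primrec carrier_map :: "sort \<Rightarrow> int \<Rightarrow> bool" where
  "carrier_map Pm a \<longleftrightarrow> a \<ge> 0"
| "carrier_map Pp a \<longleftrightarrow> a \<ge> 1"
| "carrier_map Q a \<longleftrightarrow> a > 0"

datatype opsym = Fop nat | Gop | Vop | IdMP | Uop | Hop nat | Jop | IdPM

datatype constsym = Zero_Pm

primrec op_src :: "opsym \<Rightarrow> sort" where
  "op_src (Fop i) = Pm"
| "op_src Gop = Pm"
| "op_src Vop = Pm"
| "op_src IdMP = Pm"
| "op_src Uop = Q"
| "op_src (Hop i) = Q"
| "op_src Jop = Q"
| "op_src IdPM = Pp"

primrec op_tgt :: "opsym \<Rightarrow> sort" where
  "op_tgt (Fop i) = Pm"
| "op_tgt Gop = Pm"
| "op_tgt Vop = Q"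
| "op_tgt IdMP = Pp"
| "op_tgt Uop = Pm"
| "op_tgt (Hop i) = Q"
| "op_tgt Jop = Q"
| "op_tgt IdPM = Pm"

definition sug_sig :: "nat \<Rightarrow> (sort, opsym, constsym) msig" where
  "sug_sig m =
     \<lparr>gops = {Gop, IdMP, Uop, IdPM},
      hops = Fop ` {1..m - 1} \<union> Hop ` {2..m} \<union> {Vop, Jop},
      kops = {Zero_Pm},
      src = op_src,
      tgt = op_tgt,
      csort = (\<lambda>_. Pm)\<rparr>"

definition shrink :: "int \<Rightarrow> int" where
  "shrink a = (if a > 0 then a - 1 else if a < 0 then a + 1 else 0)"

definition raise :: "nat \<Rightarrow> int \<Rightarrow> int" where
  "raise i a = (if a = int i - 1 then int i else if a = - (int i - 1) then - int i else a)"

primrec op_dom :: "nat \<Rightarrow> opsym \<Rightarrow> int set" where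
  "op_dom m (Fop i) = univ (sort_alg m Pm) - {int i, - int i}"
| "op_dom m Gop = univ (sort_alg m Pm)"
| "op_dom m Vop = univ (sort_alg m Pm) - {0}"
| "op_dom m IdMP = univ (sort_alg m Pm)"
| "op_dom m Uop = univ (sort_alg m Q)"
| "op_dom m (Hop i) = univ (sort_alg m Q) - {int i, - int i}"
| "op_dom m Jop = univ (sort_alg m Q) - {1, - 1}"
| "op_dom m IdPM = univ (sort_alg m Pp)"

primrec op_fun :: "nat \<Rightarrow> opsym \<Rightarrow> int \<Rightarrow> int" where
  "op_fun m (Fop i) = (if i = 1 then (\<lambda>a. a) else raise i)"
| "op_fun m Gop = shrink"
| "op_fun m Vop = the_inv_into (univ (sort_alg m Q) - {1, - 1}) shrink"
| "op_fun m IdMP = (\<lambda>a. a)"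
| "op_fun m Uop = shrink"
| "op_fun m (Hop i) = raise i"
| "op_fun m Jop = shrink"
| "op_fun m IdPM = (\<lambda>a. a)"

definition sug_alter_ego :: "nat \<Rightarrow> (sort, int, opsym, constsym) mstruct" where
  "sug_alter_ego m =
     \<lparr>stop = (\<lambda>i. discrete_topology (univ (sort_alg m i))),
      odom = op_dom m,
      oapp = op_fun m,
      cval = (\<lambda>_. 0)\<rparr>"

end

theory Submission
  imports Defs
begin

text \<open>The carrier map of each sort turns a homomorphism \<open>x\<close> from an algebra \<open>A\<close> of the
  variety into a prime filter of \<open>A\<close>. Conversely every prime filter arises in this way, and the kernel of \<open>x\<close> is the largest
  congruence saturating its prime filter, so two homomorphisms with the same prime filter differ by
  an isomorphism between subchains. The operations generate all these isomorphisms, and moreover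
  transform \<open>x\<close> into \<open>y\<close> whenever \<open>0 \<le> x a\<close> implies \<open>0 \<le> y a\<close> for all \<open>a\<close>. This has three consequences.
  Homomorphisms into the two chains separate the points of every algebra in the variety. A closed
  substructure of the dual of \<open>A\<close> that separates the points of \<open>A\<close> is the whole dual, which gives
  fullness and injectivity. If the prime filter of \<open>x\<close> is contained in that of \<open>y\<close>, then for every
  morphism \<open>\<phi>\<close> from the dual the carrier value of \<open>\<phi> x\<close> is at most that of \<open>\<phi> y\<close>, so that by
  compactness evaluation at some element of \<open>A\<close> has the same carrier values as \<open>\<phi>\<close>; since the
  carrier maps composed with the total operations detect the order, \<open>\<phi>\<close> is evaluation at that
  element.\<close>

section \<open>Partial isomorphisms between finite Sugihara chains\<close>

text \<open>The odd chain occurs twice because its homomorphisms can take the value 0: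
  \<open>{a. 0 \<le> x a}\<close> and \<open>{a. 1 \<le> x a}\<close> are then different filters
  belonging to the same \<open>x\<close>, cut out by the carriers of \<open>Pm\<close> and
  \<open>Pp\<close>. On \<open>Q\<close> the value 0 is missing and one filter remains. The obstacle
  to generation is that the maps which shift values are partial: \<open>raise i\<close> applies only
  where the level \<open>i\<close> of absolute values is unoccupied. Generation thus becomes a
  matter of moving unoccupied levels, settled for integer-valued maps on an arbitrary set before any
  algebra appears. The condition \<open>0 \<le> x a \<longrightarrow> 0 \<le> y a\<close> is not the
  inclusion of the two prime filters. If \<open>x\<close> has sort \<open>Pp\<close>, inclusion may
  give it only from \<open>y\<close> to \<open>x\<close>. This suffices, as every operation
  preserves both weak signs, so that signs of the values of a morphism can be followed in either
  direction. The nullary operation reaches the homomorphisms with constant carrier, which give no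
  proper prime filter. Its copies in \<open>Pm\<close> and \<open>Pp\<close>, with carrier values 1
  and 0, also keep the finite joins and meets non-empty in algebras without bounds.\<close>

definition bound :: "nat \<Rightarrow> sort \<Rightarrow> int" where
  "bound m s = (if s = Q then int m else int m - 1)"

lemma mem_sort_alg:
  assumes "m \<ge> 2"
  shows "p \<in> univ (sort_alg m s) \<longleftrightarrow> \<bar>p\<bar> \<le> bound m s \<and> (s = Q \<longrightarrow> p \<noteq> 0)"
proof -
  have "(2 * m - 1) div 2 = m - 1" "odd (2 * m - 1)" using assms by presburger+
  then show ?thesis using assms by (cases s) (auto simp: Z_alg_def bound_def of_nat_diff)
qed

lemma sort_alg_ops:
  "meet (sort_alg m s) = min" "join (sort_alg m s) = max" "neg (sort_alg m s) = uminus"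
  "imp (sort_alg m s) = (\<lambda>a b. if a \<le> b then max (- a) b else min (- a) b)"
  by (cases s; simp add: Z_alg_def)+

lemma sug_sig_simps [simp]:
  "src (sug_sig m) = op_src" "tgt (sug_sig m) = op_tgt" "csort (sug_sig m) k = Pm"
  "kops (sug_sig m) = {Zero_Pm}" "gops (sug_sig m) = {Gop, IdMP, Uop, IdPM}"
  "hops (sug_sig m) = Fop ` {1..m - 1} \<union> Hop ` {2..m} \<union> {Vop, Jop}"
  by (simp_all add: sug_sig_def)

lemma sug_alter_ego_simps [simp]:
  "stop (sug_alter_ego m) i = discrete_topology (univ (sort_alg m i))"
  "odom (sug_alter_ego m) = op_dom m" "oapp (sug_alter_ego m) = op_fun m"
  "cval (sug_alter_ego m) k = 0"
  by (simp_all add: sug_alter_ego_def)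

lemma Vop_fun:
  assumes "m \<ge> 2" "p \<in> op_dom m Vop"
  shows "op_fun m Vop p = (if p > 0 then p + 1 else p - 1)"
proof -
  have "inj_on shrink (univ (sort_alg m Q) - {1, - 1})"
    by (rule inj_onI) (auto simp: mem_sort_alg[OF assms(1)] shrink_def split: if_splits)
  moreover have "(if p > 0 then p + 1 else p - 1) \<in> univ (sort_alg m Q) - {1, - 1}"
    using assms(2) unfolding op_dom.simps Diff_iff mem_sort_alg[OF assms(1)] by (auto simp: bound_def)
  moreover have "shrink (if p > 0 then p + 1 else p - 1) = p"
    using assms(2) by (auto simp: shrink_def)
  ultimately show ?thesis by (simp only: op_fun.simps the_inv_into_f_eq)
qed

text \<open>The members of \<open>R s\<close> are tuples indexed by \<open>U\<close>, and
  \<open>R\<close> is closed as a substructure of a power is: a partial operation acts only where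
  all coordinates lie in its domain. \<open>U\<close> is a bare set, so no homomorphism property
  enters.\<close>

definition op_closed :: "nat \<Rightarrow> 'a set \<Rightarrow> (sort \<Rightarrow> ('a \<Rightarrow> int) set) \<Rightarrow> bool" where
  "op_closed m U R \<longleftrightarrow> (\<forall>r \<in> gops (sug_sig m) \<union> hops (sug_sig m). \<forall>x \<in> R (op_src r).
     (\<forall>a\<in>U. x a \<in> op_dom m r) \<longrightarrow> (\<lambda>a\<in>U. op_fun m r (x a)) \<in> R (op_tgt r))"

lemma op_closedD:
  assumes "op_closed m U R" "r \<in> gops (sug_sig m) \<union> hops (sug_sig m)" "x \<in> R (op_src r)"
    "\<And>a. a \<in> U \<Longrightarrow> x a \<in> op_dom m r"
  shows "(\<lambda>a\<in>U. op_fun m r (x a)) \<in> R (op_tgt r)"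
  using assms unfolding op_closed_def by blast

text \<open>Membership in the power of the sort \<open>s\<close>, spelled out with
  \<open>bound\<close> so that linear arithmetic applies.\<close>

definition fits :: "nat \<Rightarrow> 'a set \<Rightarrow> sort \<Rightarrow> ('a \<Rightarrow> int) \<Rightarrow> bool" where
  "fits m U s x \<longleftrightarrow> x \<in> extensional U \<and> (\<forall>a\<in>U. \<bar>x a\<bar> \<le> bound m s \<and> (s = Q \<longrightarrow> x a \<noteq> 0))"

text \<open>Equivalently, \<open>x\<close> and \<open>y\<close> differ by an isomorphism between
  subchains that commutes with negation; such a map is determined by signs and by the order of the
  absolute values.\<close>

definition similar :: "'a set \<Rightarrow> ('a \<Rightarrow> int) \<Rightarrow> ('a \<Rightarrow> int) \<Rightarrow> bool" where
  "similar U x y \<longleftrightarrow> (\<forall>a\<in>U. (0 < x a \<longleftrightarrow> 0 < y a) \<and> (x a < 0 \<longleftrightarrow> y a < 0)) \<and>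
     (\<forall>a\<in>U. \<forall>b\<in>U. \<bar>x a\<bar> < \<bar>x b\<bar> \<longleftrightarrow> \<bar>y a\<bar> < \<bar>y b\<bar>)"

lemma similar_sgn: "similar U x y \<Longrightarrow> a \<in> U \<Longrightarrow> (0 < x a \<longleftrightarrow> 0 < y a) \<and> (x a < 0 \<longleftrightarrow> y a < 0)"
  and similar_less: "similar U x y \<Longrightarrow> a \<in> U \<Longrightarrow> b \<in> U \<Longrightarrow> \<bar>x a\<bar> < \<bar>x b\<bar> \<longleftrightarrow> \<bar>y a\<bar> < \<bar>y b\<bar>"
  and similar_eq: "similar U x y \<Longrightarrow> a \<in> U \<Longrightarrow> b \<in> U \<Longrightarrow> \<bar>x a\<bar> = \<bar>x b\<bar> \<longleftrightarrow> \<bar>y a\<bar> = \<bar>y b\<bar>"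
  unfolding similar_def by (blast, blast) (metis linorder_neq_iff)

lemma similar_sym: "similar U x y \<Longrightarrow> similar U y x"
  unfolding similar_def by blast

text \<open>The assumption on \<open>z\<close> excludes \<open>y a = 0\<close>, where
  \<open>z a\<close> would have absolute value 1 but no sign. Hence all levels move up by one and
  their order is kept.\<close>

lemma similar_shift:
  assumes "similar U x y"
    and "\<And>a. a \<in> U \<Longrightarrow> \<bar>z a\<bar> = \<bar>y a\<bar> + 1 \<and> (0 < z a \<longleftrightarrow> 0 < y a) \<and> (z a < 0 \<longleftrightarrow> y a < 0)"
  shows "similar U x z"
  using assms unfolding similar_def by (smt (verit, ccfv_SIG))

text \<open>Closes a gap at level \<open>k\<close>: everything beyond it moves one step towards 0.
  For \<open>k \<ge> 1\<close> the map is injective on the integers other than \<open>k\<close> and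
  \<open>- k\<close>.\<close>

definition lower :: "nat \<Rightarrow> int \<Rightarrow> int" where
  "lower k a = (if a > int k then a - 1 else if a < - int k then a + 1 else a)"

lemma fits_comp:
  assumes "fits m U s x" "\<And>a. a \<in> U \<Longrightarrow> \<bar>f (x a)\<bar> \<le> bound m t \<and> (t = Q \<longrightarrow> f (x a) \<noteq> 0)"
  shows "fits m U t (\<lambda>a\<in>U. f (x a))"
  using assms by (auto simp: fits_def)

text \<open>Equivalently, \<open>y\<close> is \<open>x\<close> followed by an odd monotone map that
  sends an initial segment of levels to 0 and is injective on the rest. Quotients of Sugihara chains
  have this shape.\<close>

definition refines :: "'a set \<Rightarrow> ('a \<Rightarrow> int) \<Rightarrow> ('a \<Rightarrow> int) \<Rightarrow> bool" where
  "refines U x y \<longleftrightarrow>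
     (\<forall>a\<in>U. (x a = 0 \<longrightarrow> y a = 0) \<and> (0 < y a \<longrightarrow> 0 < x a) \<and> (y a < 0 \<longrightarrow> x a < 0)) \<and>
     (\<forall>a\<in>U. \<forall>b\<in>U. (\<bar>x a\<bar> \<le> \<bar>x b\<bar> \<longrightarrow> \<bar>y a\<bar> \<le> \<bar>y b\<bar>) \<and>
        (\<bar>x a\<bar> < \<bar>x b\<bar> \<and> y b \<noteq> 0 \<longrightarrow> \<bar>y a\<bar> < \<bar>y b\<bar>))"

lemma refines_similar:
  assumes "refines U x y" and z: "\<And>a. a \<in> U \<Longrightarrow> y a = 0 \<Longrightarrow> x a = 0"
  shows "similar U x y"
proof -
  have 1: "(x a = 0 \<longrightarrow> y a = 0) \<and> (0 < y a \<longrightarrow> 0 < x a) \<and> (y a < 0 \<longrightarrow> x a < 0)" if "a \<in> U" for a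
    using assms(1) that unfolding refines_def by blast
  have 2: "(\<bar>x a\<bar> \<le> \<bar>x b\<bar> \<longrightarrow> \<bar>y a\<bar> \<le> \<bar>y b\<bar>) \<and> (\<bar>x a\<bar> < \<bar>x b\<bar> \<and> y b \<noteq> 0 \<longrightarrow> \<bar>y a\<bar> < \<bar>y b\<bar>)"
    if "a \<in> U" "b \<in> U" for a b
    using assms(1) that unfolding refines_def by blast
  show ?thesis
    unfolding similar_def
  proof (intro conjI ballI)
    fix a assume a: "a \<in> U"
    show "(0 < x a) = (0 < y a)" "(x a < 0) = (y a < 0)" using 1[OF a] z[OF a] by linarith+
  next
    fix a b assume ab: "a \<in> U" "b \<in> U"
    show "(\<bar>x a\<bar> < \<bar>x b\<bar>) = (\<bar>y a\<bar> < \<bar>y b\<bar>)"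
      using 2[OF ab] 2[OF ab(2,1)] z[OF ab(2)] by fastforce
  qed
qed

section \<open>Generating similar and coarser maps from one member of a closed family\<close>

context
  fixes m :: nat and U :: "'a set" and R :: "sort \<Rightarrow> ('a \<Rightarrow> int) set"
  assumes m: "m \<ge> 2" and R: "op_closed m U R"
begin

lemma raise_closed:
  assumes s: "s = Pm \<or> s = Q" and i: "2 \<le> i" "int i \<le> bound m s"
    and x: "x \<in> R s" "fits m U s x" "\<And>a. a \<in> U \<Longrightarrow> \<bar>x a\<bar> \<noteq> int i"
  shows "(\<lambda>a\<in>U. raise i (x a)) \<in> R s"
proof (cases "s = Q")
  case True
  have "x a \<in> op_dom m (Hop i)" if "a \<in> U" for a
    unfolding op_dom.simps Diff_iff mem_sort_alg[OF m] using x(2) x(3)[OF that] that True by (auto simp: fits_def)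
  then show ?thesis using op_closedD[OF R, of "Hop i" x] x i True by (simp add: bound_def)
next
  case False
  with s have "s = Pm" by simp
  have "x a \<in> op_dom m (Fop i)" if "a \<in> U" for a
    unfolding op_dom.simps Diff_iff mem_sort_alg[OF m]
    using x(2) x(3)[OF that] that \<open>s = Pm\<close> by (auto simp: fits_def)
  moreover have "i \<in> {1..m - 1}" using i False by (auto simp: bound_def)
  ultimately show ?thesis using op_closedD[OF R, of "Fop i" x] x i \<open>s = Pm\<close> by simp
qed

lemma shrink_closed:
  assumes s: "s = Pm \<or> s = Q" and x: "x \<in> R s" "fits m U s x" "\<And>a. a \<in> U \<Longrightarrow> \<bar>x a\<bar> \<noteq> 1"
  shows "(\<lambda>a\<in>U. shrink (x a)) \<in> R s"
proof (cases "s = Q")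
  case True
  have "x a \<in> op_dom m Jop" if "a \<in> U" for a
    unfolding op_dom.simps Diff_iff mem_sort_alg[OF m] using x(2) x(3)[OF that] that True by (auto simp: fits_def)
  then show ?thesis using op_closedD[OF R, of Jop x] x True by simp
next
  case False
  with s have "s = Pm" by simp
  have "x a \<in> op_dom m Gop" if "a \<in> U" for a
    unfolding op_dom.simps mem_sort_alg[OF m] using x(2) that \<open>s = Pm\<close> by (auto simp: fits_def)
  then show ?thesis using op_closedD[OF R, of Gop x] x \<open>s = Pm\<close> by simp
qed

text \<open>Raising \<open>k\<close> into the gap at \<open>k + 1\<close> moves that gap down to \<open>k\<close>; once it has reached \<open>1\<close>, the
  map \<open>shrink\<close> is injective.\<close>

lemma lower_closed:
  assumes s: "s = Pm \<or> s = Q" and "1 \<le> k"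
  shows "int k \<le> bound m s \<Longrightarrow> x \<in> R s \<Longrightarrow> fits m U s x \<Longrightarrow> (\<And>a. a \<in> U \<Longrightarrow> \<bar>x a\<bar> \<noteq> int k) \<Longrightarrow>
    (\<lambda>a\<in>U. lower k (x a)) \<in> R s"
  using \<open>1 \<le> k\<close>
proof (induction k arbitrary: x rule: nat_induct_at_least)
  case base
  then have "(\<lambda>a\<in>U. shrink (x a)) \<in> R s" using shrink_closed[OF s] by simp
  moreover have "(\<lambda>a\<in>U. lower 1 (x a)) = (\<lambda>a\<in>U. shrink (x a))"
    using base(4) by (fastforce simp: fun_eq_iff shrink_def lower_def)
  ultimately show ?case by (simp only:)
next
  case (Suc k)
  let ?x = "\<lambda>a\<in>U. raise (Suc k) (x a)"
  have fx: "\<bar>x a\<bar> \<le> bound m s" "s = Q \<longrightarrow> x a \<noteq> 0" if "a \<in> U" for a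
    using Suc.prems(3) that by (auto simp: fits_def)
  have 1: "?x \<in> R s" using raise_closed[OF s, of "Suc k" x] Suc by simp
  have 2: "fits m U s ?x"
  proof (rule fits_comp[OF Suc.prems(3)])
    fix a assume "a \<in> U"
    then show "\<bar>raise (Suc k) (x a)\<bar> \<le> bound m s \<and> (s = Q \<longrightarrow> raise (Suc k) (x a) \<noteq> 0)"
      using fx Suc(1) Suc.prems(1) by (auto simp: raise_def)
  qed
  have 3: "\<bar>?x a\<bar> \<noteq> int k" if "a \<in> U" for a
    using that Suc(1) by (auto simp: raise_def)
  have "(\<lambda>a\<in>U. lower k (?x a)) \<in> R s"
    using Suc.IH[OF _ 1 2 3] Suc.prems(1) by linarith
  moreover have "(\<lambda>a\<in>U. lower k (?x a)) = (\<lambda>a\<in>U. lower (Suc k) (x a))"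
    using Suc.prems(4) by (fastforce simp: fun_eq_iff raise_def lower_def)
  ultimately show ?case by (simp only:)
qed

text \<open>Only finitely many levels occur, even if \<open>U\<close> is infinite. Sums over
  \<open>V\<close> can therefore serve as termination measures, and \<open>V\<close> represents the
  levels of every map similar to \<open>y\<close> as well.\<close>

lemma similar_representatives:
  assumes "fits m U s y"
  obtains V where "finite V" "V \<subseteq> U" "\<And>a. a \<in> U \<Longrightarrow> \<exists>b\<in>V. \<bar>y b\<bar> = \<bar>y a\<bar>"
proof -
  have "(\<lambda>a. \<bar>y a\<bar>) ` U \<subseteq> {0..bound m s}" using assms by (auto simp: fits_def)
  then have "finite ((\<lambda>a. \<bar>y a\<bar>) ` U)" by (rule finite_subset) simp
  then obtain V where "V \<subseteq> U" "finite V" "(\<lambda>a. \<bar>y a\<bar>) ` U = (\<lambda>a. \<bar>y a\<bar>) ` V"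
    using finite_subset_image[of "(\<lambda>a. \<bar>y a\<bar>) ` U" "\<lambda>a. \<bar>y a\<bar>" U] by auto
  then show ?thesis using that[of V] by (metis (no_types, lifting) image_iff)
qed

text \<open>The levels of \<open>x\<close> are raised one step at a time, the highest unfinished one
  first, because the level above that one is free. Each step shortens the total distance to
  \<open>y\<close> over the representatives.\<close>

lemma similar_closed_up:
  assumes s: "s = Pm \<or> s = Q" and y: "fits m U s y"
    and x: "x \<in> R s" "fits m U s x" "similar U x y" "\<And>a. a \<in> U \<Longrightarrow> \<bar>x a\<bar> \<le> \<bar>y a\<bar>"
  shows "y \<in> R s"
proof -
  obtain V where V: "finite V" "V \<subseteq> U" "\<And>a. a \<in> U \<Longrightarrow> \<exists>b\<in>V. \<bar>y b\<bar> = \<bar>y a\<bar>"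
    using similar_representatives[OF y] by blast
  show ?thesis
    using x
  proof (induction "nat (\<Sum>a\<in>V. \<bar>y a\<bar> - \<bar>x a\<bar>)" arbitrary: x rule: less_induct)
    case less
    note sgn = similar_sgn[OF less.prems(3)] and lt = similar_less[OF less.prems(3)]
      and eq = similar_eq[OF less.prems(3)]
    show ?case
    proof (cases "\<forall>a\<in>U. \<bar>x a\<bar> = \<bar>y a\<bar>")
      case True
      have "x a = y a" for a
      proof (cases "a \<in> U")
        case True
        then show ?thesis using sgn[OF True] \<open>\<forall>a\<in>U. _\<close> by (smt (verit))
      next
        case False
        then show ?thesis using less.prems(2) y by (auto simp: fits_def extensional_def)
      qed
      then have "x = y" by blast
      then show ?thesis using less.prems by simp
    next
      case False
      define S where "S = {a \<in> V. \<bar>x a\<bar> < \<bar>y a\<bar>}"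
      have rep: "\<exists>b\<in>V. \<bar>y b\<bar> = \<bar>y a\<bar> \<and> \<bar>x b\<bar> = \<bar>x a\<bar>" if "a \<in> U" for a
        using V(2,3) eq that by (meson subset_iff)
      have "finite S" using V by (simp add: S_def)
      moreover have "S \<noteq> {}"
      proof -
        obtain a where "a \<in> U" "\<bar>x a\<bar> \<noteq> \<bar>y a\<bar>" using False by blast
        then have "\<bar>x a\<bar> < \<bar>y a\<bar>" using less.prems(4) by fastforce
        then show ?thesis using rep[OF \<open>a \<in> U\<close>] by (auto simp: S_def)
      qed
      ultimately have "Max ((\<lambda>a. \<bar>x a\<bar>) ` S) \<in> (\<lambda>a. \<bar>x a\<bar>) ` S" by (intro Max_in) auto
      \<comment> \<open>A representative on the highest level of \<open>x\<close> that still lies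
        below its target.\<close>
      then obtain a where a: "a \<in> S" "\<And>b. b \<in> S \<Longrightarrow> \<bar>x b\<bar> \<le> \<bar>x a\<bar>"
        using \<open>finite S\<close> by (smt (verit) Max_ge finite_imageI imageE imageI)
      have aU: "a \<in> U" "a \<in> V" "\<bar>x a\<bar> < \<bar>y a\<bar>" using a V by (auto simp: S_def)
      define i where "i = nat (\<bar>x a\<bar> + 1)"
      have ii: "int i = \<bar>x a\<bar> + 1" by (simp add: i_def)
      have i2: "2 \<le> i" using sgn[OF aU(1)] aU(3) unfolding i_def by linarith
      have ib: "int i \<le> bound m s" using y aU unfolding ii fits_def by fastforce
      \<comment> \<open>An occupant of the next level would have a target strictly above that of
        \<open>a\<close>, hence above its own level; it would be unfinished and higher than
        \<open>a\<close>.\<close>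
      have gap: "\<bar>x b\<bar> \<noteq> int i" if "b \<in> U" for b
      proof
        assume *: "\<bar>x b\<bar> = int i"
        obtain c where c: "c \<in> V" "\<bar>x c\<bar> = \<bar>x b\<bar>" using rep[OF \<open>b \<in> U\<close>] by blast
        then have "\<bar>y a\<bar> < \<bar>y c\<bar>" using lt[OF aU(1), of c] V(2) * by (auto simp: ii)
        then have "c \<in> S" using c * aU(3) by (auto simp: S_def ii)
        then show False using a(2)[of c] c * by (simp add: ii)
      qed
      let ?x = "\<lambda>a\<in>U. raise i (x a)"
      have ab: "\<bar>?x b\<bar> = (if \<bar>x b\<bar> = \<bar>x a\<bar> then \<bar>x a\<bar> + 1 else \<bar>x b\<bar>)" if "b \<in> U" for b
        using that i2 ii by (auto simp: raise_def)
      have sg: "(0 < ?x b \<longleftrightarrow> 0 < x b) \<and> (?x b < 0 \<longleftrightarrow> x b < 0)" if "b \<in> U" for b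
        using that i2 ii by (auto simp: raise_def)
      have le: "\<bar>?x b\<bar> \<le> \<bar>y b\<bar>" if "b \<in> U" for b
        using ab[OF that] less.prems(4)[OF that] eq[OF that aU(1)] aU(3) by auto
      have "nat (\<Sum>a\<in>V. \<bar>y a\<bar> - \<bar>?x a\<bar>) < nat (\<Sum>a\<in>V. \<bar>y a\<bar> - \<bar>x a\<bar>)"
      proof -
        have "(\<Sum>a\<in>V. \<bar>y a\<bar> - \<bar>?x a\<bar>) < (\<Sum>a\<in>V. \<bar>y a\<bar> - \<bar>x a\<bar>)"
        proof (rule sum_strict_mono_ex1[OF V(1)])
          show "\<forall>b\<in>V. \<bar>y b\<bar> - \<bar>?x b\<bar> \<le> \<bar>y b\<bar> - \<bar>x b\<bar>" using ab V(2) by fastforce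
          show "\<exists>b\<in>V. \<bar>y b\<bar> - \<bar>?x b\<bar> < \<bar>y b\<bar> - \<bar>x b\<bar>"
            by (rule bexI[OF _ aU(2)]) (simp add: ab[OF aU(1)] del: restrict_apply)
        qed
        moreover have "0 \<le> (\<Sum>a\<in>V. \<bar>y a\<bar> - \<bar>?x a\<bar>)"
          by (rule sum_nonneg) (use le V(2) in fastforce)
        ultimately show ?thesis by linarith
      qed
      moreover have "?x \<in> R s" by (rule raise_closed[OF s i2 ib less.prems(1,2) gap])
      moreover have "fits m U s ?x"
      proof (rule fits_comp[OF less.prems(2)])
        fix b assume b: "b \<in> U"
        then have "\<bar>raise i (x b)\<bar> \<le> \<bar>y b\<bar>" using le[OF b] by simp
        then show "\<bar>raise i (x b)\<bar> \<le> bound m s \<and> (s = Q \<longrightarrow> raise i (x b) \<noteq> 0)"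
          using y b sg[OF b] less.prems(2) by (fastforce simp: fits_def)
      qed
      moreover have "similar U ?x y"
        unfolding similar_def
      proof (intro conjI ballI)
        fix b c assume bc: "b \<in> U" "c \<in> U"
        show "\<bar>?x b\<bar> < \<bar>?x c\<bar> \<longleftrightarrow> \<bar>y b\<bar> < \<bar>y c\<bar>"
          unfolding lt[OF bc, symmetric] ab[OF bc(1)] ab[OF bc(2)]
          using gap[OF bc(1)] gap[OF bc(2)] unfolding ii by auto
      qed (use sgn sg in auto)
      ultimately show ?thesis using less.hyps[of ?x] le by blast
    qed
  qed
qed

text \<open>First \<open>x\<close> is pressed down until its levels lie below those of
  \<open>y\<close>, by closing gaps; then \<open>similar_closed_up\<close> lifts it.\<close>

lemma similar_closed:
  assumes s: "s = Pm \<or> s = Q" and y: "fits m U s y"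
    and x: "x \<in> R s" "fits m U s x" "similar U x y"
  shows "y \<in> R s"
proof -
  obtain V where V: "finite V" "V \<subseteq> U" "\<And>a. a \<in> U \<Longrightarrow> \<exists>b\<in>V. \<bar>y b\<bar> = \<bar>y a\<bar>"
    using similar_representatives[OF y] by blast
  show ?thesis
    using x
  proof (induction "nat (\<Sum>a\<in>V. \<bar>x a\<bar>)" arbitrary: x rule: less_induct)
    case less
    note sgn = similar_sgn[OF less.prems(3)] and lt = similar_less[OF less.prems(3)]
      and eq = similar_eq[OF less.prems(3)]
    show ?case
    proof (cases "\<forall>a\<in>U. \<bar>x a\<bar> \<le> \<bar>y a\<bar>")
      case True
      then show ?thesis using similar_closed_up[OF s y less.prems] by blast
    next
      case False
      then obtain a0 where a0: "a0 \<in> U" "\<bar>y a0\<bar> < \<bar>x a0\<bar>" by force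
      then obtain a where aV: "a \<in> V" "\<bar>y a\<bar> = \<bar>y a0\<bar>" using V(3) by blast
      then have a: "a \<in> U" "\<bar>y a\<bar> < \<bar>x a\<bar>" using V(2) eq[of a a0] a0 by auto
      \<comment> \<open>If \<open>x\<close> occupied every level from 1 to its level at
        \<open>a\<close>, then \<open>y\<close>, having the same order of levels, would need at
        least as many positive levels up to its own at \<open>a\<close>, against the choice of
        \<open>a\<close>.\<close>
      have "\<exists>k\<ge>1. int k < \<bar>x a\<bar> \<and> (\<forall>b\<in>U. \<bar>x b\<bar> \<noteq> int k)"
      proof (rule ccontr)
        assume no_gap: "\<not> ?thesis"
        have "int v \<le> \<bar>y c\<bar>" if "c \<in> U" "\<bar>x c\<bar> = int v" "int v \<le> \<bar>x a\<bar>" for v c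
          using that
        proof (induction v arbitrary: c)
          case (Suc v)
          show ?case
          proof (cases "v = 0")
            case True
            then show ?thesis using sgn[OF Suc.prems(1)] Suc.prems(2) by linarith
          next
            case False
            then have "1 \<le> v" "int v < \<bar>x a\<bar>" using Suc.prems by auto
            then obtain b where "b \<in> U" "\<bar>x b\<bar> = int v" using no_gap by blast
            moreover from this have "int v \<le> \<bar>y b\<bar>" using Suc by simp
            ultimately show ?thesis using lt[of b c] Suc.prems by auto
          qed
        qed simp
        from this[OF a(1), of "nat \<bar>x a\<bar>"] show False using a(2) by simp
      qed
      then obtain k where k: "1 \<le> k" "int k < \<bar>x a\<bar>" "\<And>b. b \<in> U \<Longrightarrow> \<bar>x b\<bar> \<noteq> int k" by blast
      have kb: "int k \<le> bound m s" using less.prems(2) a k(2) by (fastforce simp: fits_def)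
      let ?x = "\<lambda>a\<in>U. lower k (x a)"
      have ab: "\<bar>?x b\<bar> = (if \<bar>x b\<bar> > int k then \<bar>x b\<bar> - 1 else \<bar>x b\<bar>)" if "b \<in> U" for b
        using that k(1) by (auto simp: lower_def)
      have sg: "(0 < ?x b \<longleftrightarrow> 0 < x b) \<and> (?x b < 0 \<longleftrightarrow> x b < 0)" if "b \<in> U" for b
        using that k(1) by (auto simp: lower_def)
      have "nat (\<Sum>a\<in>V. \<bar>?x a\<bar>) < nat (\<Sum>a\<in>V. \<bar>x a\<bar>)"
      proof -
        have "(\<Sum>a\<in>V. \<bar>?x a\<bar>) < (\<Sum>a\<in>V. \<bar>x a\<bar>)"
        proof (rule sum_strict_mono_ex1[OF V(1)])
          show "\<forall>b\<in>V. \<bar>?x b\<bar> \<le> \<bar>x b\<bar>" using ab V(2) by fastforce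
          show "\<exists>b\<in>V. \<bar>?x b\<bar> < \<bar>x b\<bar>"
            by (rule bexI[OF _ aV(1)]) (simp add: ab[OF a(1)] k(2) del: restrict_apply)
        qed
        moreover have "0 \<le> (\<Sum>a\<in>V. \<bar>?x a\<bar>)" by (rule sum_nonneg) simp
        ultimately show ?thesis by linarith
      qed
      moreover have "?x \<in> R s" by (rule lower_closed[OF s k(1) kb less.prems(1,2) k(3)])
      moreover have "fits m U s ?x"
      proof (rule fits_comp[OF less.prems(2)])
        fix b assume b: "b \<in> U"
        show "\<bar>lower k (x b)\<bar> \<le> bound m s \<and> (s = Q \<longrightarrow> lower k (x b) \<noteq> 0)"
          using ab[OF b] b sg[OF b] less.prems(2) by (fastforce simp: fits_def split: if_splits)
      qed
      moreover have "similar U ?x y"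
        unfolding similar_def
      proof (intro conjI ballI)
        fix b c assume bc: "b \<in> U" "c \<in> U"
        show "\<bar>?x b\<bar> < \<bar>?x c\<bar> \<longleftrightarrow> \<bar>y b\<bar> < \<bar>y c\<bar>"
          unfolding lt[OF bc, symmetric] ab[OF bc(1)] ab[OF bc(2)]
          using k(3)[OF bc(1)] k(3)[OF bc(2)] by auto
      qed (use sgn sg in auto)
      ultimately show ?thesis using less.hyps[of ?x] by blast
    qed
  qed
qed

text \<open>Crossing between the sorts uses \<open>Uop\<close> or \<open>Vop\<close>. Both are
  injective and shift levels by one as long as no value 0 is involved, which is what
  \<open>nz\<close> secures.\<close>

lemma similar_trans_closed:
  assumes i: "i = Pm \<or> i = Q" and j: "j = Pm \<or> j = Q" and x: "x \<in> R i" "fits m U i x"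
    and y: "fits m U j y" and sim: "similar U x y" and nz: "i \<noteq> j \<Longrightarrow> \<forall>a\<in>U. y a \<noteq> 0"
  shows "y \<in> R j"
proof -
  consider "i = j" | "i = Q" "j = Pm" | "i = Pm" "j = Q" using i j by blast
  then show ?thesis
  proof cases
    case 1
    then show ?thesis using similar_closed[OF i] assms by blast
  next
    case 2
    \<comment> \<open>Moving \<open>y\<close> one level away from 0 stays inside \<open>Q\<close>,
      whose bound exceeds that of \<open>Pm\<close> by one. As \<open>?z\<close> avoids 1 and -1,
      \<open>shrink\<close> takes it back to \<open>y\<close> without collapsing anything.\<close>
    let ?z = "\<lambda>a\<in>U. if y a > 0 then y a + 1 else y a - 1"
    have nz: "y a \<noteq> 0" "\<bar>y a\<bar> \<le> int m - 1" if "a \<in> U" for a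
      using nz 2 that y by (auto simp: fits_def bound_def)
    have fz: "fits m U Q ?z" using nz by (force simp: fits_def bound_def)
    have "similar U x ?z"
      by (rule similar_shift[OF sim]) (use nz in \<open>force split: if_splits\<close>)
    then have "?z \<in> R Q" using similar_closed[OF _ fz, of x] x 2 by simp
    then have "(\<lambda>a\<in>U. op_fun m Uop (?z a)) \<in> R Pm"
      using op_closedD[OF R, of Uop ?z] fz mem_sort_alg[OF m, of _ Q] by (simp add: fits_def)
    moreover have "(\<lambda>a\<in>U. op_fun m Uop (?z a)) = y"
      using y nz by (fastforce simp: fun_eq_iff shrink_def fits_def extensional_def)
    ultimately show ?thesis using 2 by simp
  next
    case 3
    have nz: "x a \<noteq> 0" "\<bar>x a\<bar> \<le> int m - 1" if "a \<in> U" for a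
      using nz 3 that x similar_sgn[OF sim that] by (auto simp: fits_def bound_def)
    let ?z = "\<lambda>a\<in>U. if x a > 0 then x a + 1 else x a - 1"
    have dom: "x a \<in> op_dom m Vop" if "a \<in> U" for a
      unfolding op_dom.simps Diff_iff mem_sort_alg[OF m] using nz[OF that] by (simp add: bound_def)
    have "(\<lambda>a\<in>U. op_fun m Vop (x a)) \<in> R Q"
      using op_closedD[OF R, of Vop x] dom x 3 by simp
    moreover have "(\<lambda>a\<in>U. op_fun m Vop (x a)) = ?z" using Vop_fun[OF m dom] by auto
    ultimately have "?z \<in> R Q" by simp
    moreover have "fits m U Q ?z" using nz by (force simp: fits_def bound_def)
    moreover have "similar U ?z y"
      by (rule similar_sym, rule similar_shift[OF similar_sym[OF sim]]) (use nz in \<open>force split: if_splits\<close>)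
    ultimately show ?thesis using similar_closed[of Q y ?z] y 3 by simp
  qed
qed

text \<open>The number \<open>t\<close> bounds the levels of \<open>x\<close> that \<open>y\<close>
  sends to 0. Each application of \<open>shrink\<close> collapses one of them and lands in
  \<open>Pm\<close>; when none is left, the maps are similar. A change of sort at that stage
  excludes common zeros, since \<open>Q\<close> has no 0.\<close>

lemma refines_closed:
  assumes j: "j = Pm \<or> j = Q" and y: "fits m U j y"
  shows "i = Pm \<or> i = Q \<Longrightarrow> x \<in> R i \<Longrightarrow> fits m U i x \<Longrightarrow> refines U x y \<Longrightarrow>
    (\<And>a. a \<in> U \<Longrightarrow> y a = 0 \<Longrightarrow> \<bar>x a\<bar> \<le> int t) \<Longrightarrow> y \<in> R j"
proof (induction t arbitrary: i x)
  case (0 i x)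
  then have z: "x a = 0" if "a \<in> U" "y a = 0" for a using that by fastforce
  have "\<forall>a\<in>U. y a \<noteq> 0" if "i \<noteq> j"
  proof (rule ccontr)
    assume "\<not> ?thesis"
    then obtain a where a: "a \<in> U" "y a = 0" "x a = 0" using z by blast
    then show False using y "0.prems"(1,3) that j by (auto simp: fits_def)
  qed
  then show ?case using similar_trans_closed[OF "0.prems"(1) j "0.prems"(2,3) y] refines_similar[OF "0.prems"(4) z] by blast
next
  case (Suc t i x)
  have 1: "(x a = 0 \<longrightarrow> y a = 0) \<and> (0 < y a \<longrightarrow> 0 < x a) \<and> (y a < 0 \<longrightarrow> x a < 0)" if "a \<in> U" for a
    using Suc.prems(4) that unfolding refines_def by blast
  have 2: "(\<bar>x a\<bar> \<le> \<bar>x b\<bar> \<longrightarrow> \<bar>y a\<bar> \<le> \<bar>y b\<bar>) \<and> (\<bar>x a\<bar> < \<bar>x b\<bar> \<and> y b \<noteq> 0 \<longrightarrow> \<bar>y a\<bar> < \<bar>y b\<bar>)"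
    if "a \<in> U" "b \<in> U" for a b
    using Suc.prems(4) that unfolding refines_def by blast
  have fx: "\<bar>x a\<bar> \<le> bound m i" "i = Q \<longrightarrow> x a \<noteq> 0" if "a \<in> U" for a
    using Suc.prems(3) that by (auto simp: fits_def)
  show ?case
  proof (cases "\<exists>a\<in>U. y a = 0 \<and> x a \<noteq> 0")
    case False
    then show ?thesis using Suc.IH[OF Suc.prems(1-4)] by force
  next
    case True
    then obtain a where a: "a \<in> U" "y a = 0" "x a \<noteq> 0" by blast
    \<comment> \<open>As soon as \<open>y\<close> kills one nonzero value of \<open>x\<close>, it
      kills the levels 0 and 1, and these are all that \<open>shrink\<close> identifies.\<close>
    have small: "y b = 0" if "b \<in> U" "\<bar>x b\<bar> \<le> 1" for b
      using 2[OF that(1) a(1)] a that(2) by linarith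
    let ?x = "\<lambda>a\<in>U. shrink (x a)"
    have ab: "\<bar>?x b\<bar> = (if x b = 0 then 0 else \<bar>x b\<bar> - 1)" if "b \<in> U" for b
      using that by (auto simp: shrink_def)
    have "?x \<in> R Pm"
    proof (cases "i = Pm")
      case True
      then show ?thesis using op_closedD[OF R, of Gop x] Suc.prems fx mem_sort_alg[OF m, of _ Pm] by simp
    next
      case False
      then show ?thesis using op_closedD[OF R, of Uop x] Suc.prems fx mem_sort_alg[OF m, of _ Q] by simp
    qed
    moreover have "fits m U Pm ?x"
      by (rule fits_comp[OF Suc.prems(3)]) (use fx Suc.prems(1) in \<open>force simp: shrink_def bound_def split: if_splits\<close>)
    moreover have "refines U ?x y"
      unfolding refines_def
    proof (intro conjI ballI)
      fix b assume b: "b \<in> U"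
      show "?x b = 0 \<longrightarrow> y b = 0" using ab[OF b] small[OF b] by (auto split: if_splits)
      show "0 < y b \<longrightarrow> 0 < ?x b" "y b < 0 \<longrightarrow> ?x b < 0"
        using 1[OF b] small[OF b] b by (smt (verit) restrict_apply' shrink_def)+
      fix c assume c: "c \<in> U"
      show "\<bar>?x b\<bar> \<le> \<bar>?x c\<bar> \<longrightarrow> \<bar>y b\<bar> \<le> \<bar>y c\<bar>"
        using ab[OF b] ab[OF c] 2[OF b c] small[OF b] by (smt (verit))
      show "\<bar>?x b\<bar> < \<bar>?x c\<bar> \<and> y c \<noteq> 0 \<longrightarrow> \<bar>y b\<bar> < \<bar>y c\<bar>"
        using ab[OF b] ab[OF c] 2[OF b c] by (smt (verit))
    qed
    moreover have "\<bar>?x b\<bar> \<le> int t" if "b \<in> U" "y b = 0" for b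
      using ab[OF that(1)] Suc.prems(5)[OF that] by auto
    ultimately show ?thesis using Suc.IH[of Pm ?x] by blast
  qed
qed

end


section \<open>Homomorphisms into the Sugihara chains\<close>

lemma hom_mem: "x \<in> alg_hom A N \<Longrightarrow> a \<in> univ A \<Longrightarrow> x a \<in> univ N"
  and hom_ext: "x \<in> alg_hom A N \<Longrightarrow> x \<in> extensional (univ A)"
  by (auto simp: alg_hom_def PiE_def)

lemma hom_ops:
  assumes "x \<in> alg_hom A (sort_alg m s)" "a \<in> univ A" "b \<in> univ A"
  shows "x (neg A a) = - x a" "x (meet A a b) = min (x a) (x b)" "x (join A a b) = max (x a) (x b)"
    "x (imp A a b) = (if x a \<le> x b then max (- x a) (x b) else min (- x a) (x b))"
  using assms by (auto simp: alg_hom_def sort_alg_ops)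

lemma hom_fits: "m \<ge> 2 \<Longrightarrow> x \<in> alg_hom A (sort_alg m s) \<Longrightarrow> fits m (univ A) s x"
  unfolding fits_def using hom_mem[of x A "sort_alg m s"] hom_ext[of x A "sort_alg m s"]
  by (auto simp: mem_sort_alg)

text \<open>The order of absolute values can be read off from the sign of a term: in a chain the
  implication from \<open>|c|\<close> to \<open>|d|\<close> is non-negative exactly if
  \<open>|c| \<le> |d|\<close>. The sign hypothesis, applied to such terms and to negations,
  therefore controls levels as well.\<close>

lemma hom_refines:
  assumes A: "salgebra A" and x: "x \<in> alg_hom A (sort_alg m i)" and y: "y \<in> alg_hom A (sort_alg m j)"
    and xy: "\<And>a. a \<in> univ A \<Longrightarrow> 0 \<le> x a \<Longrightarrow> 0 \<le> y a"
  shows "refines (univ A) x y"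
proof -
  note ops = hom_ops[OF x] hom_ops[OF y]
  note cl = salgebra_closed[OF A]
  have sgn: "(x a = 0 \<longrightarrow> y a = 0) \<and> (0 < y a \<longrightarrow> 0 < x a) \<and> (y a < 0 \<longrightarrow> x a < 0)" if a: "a \<in> univ A" for a
    using xy[OF a] xy[OF cl(1)[OF a a]] ops[OF a a] by linarith
  \<comment> \<open>The term for the absolute value.\<close>
  let ?n = "\<lambda>a. join A a (neg A a)"
  have n: "?n a \<in> univ A" "x (?n a) = \<bar>x a\<bar>" "y (?n a) = \<bar>y a\<bar>" if a: "a \<in> univ A" for a
    using cl(3)[OF a cl(1)[OF a a]] ops(1,3,5,7)[OF a cl(1)[OF a a]] ops(1,5)[OF a a]
    by (simp_all add: max_def abs_if)
  show ?thesis
    unfolding refines_def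
  proof (intro conjI ballI)
    fix a b assume ab: "a \<in> univ A" "b \<in> univ A"
    have c: "imp A (?n c) (?n d) \<in> univ A"
      "x (imp A (?n c) (?n d)) = (if \<bar>x c\<bar> \<le> \<bar>x d\<bar> then max (- \<bar>x c\<bar>) \<bar>x d\<bar> else min (- \<bar>x c\<bar>) \<bar>x d\<bar>)"
      "y (imp A (?n c) (?n d)) = (if \<bar>y c\<bar> \<le> \<bar>y d\<bar> then max (- \<bar>y c\<bar>) \<bar>y d\<bar> else min (- \<bar>y c\<bar>) \<bar>y d\<bar>)"
      if "c \<in> univ A" "d \<in> univ A" for c d
      using cl(4)[OF n(1)[OF that(1)] n(1)[OF that(2)]] ops(4,8)[OF n(1)[OF that(1)] n(1)[OF that(2)]]
      unfolding n(2,3)[OF that(1)] n(2,3)[OF that(2)] by blast+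
    show le: "\<bar>x a\<bar> \<le> \<bar>x b\<bar> \<longrightarrow> \<bar>y a\<bar> \<le> \<bar>y b\<bar>"
      using xy[OF c(1)[OF ab]] unfolding c(2,3)[OF ab] by (smt (verit))
    show "\<bar>x a\<bar> < \<bar>x b\<bar> \<and> y b \<noteq> 0 \<longrightarrow> \<bar>y a\<bar> < \<bar>y b\<bar>"
      using le sgn[OF c(1)[OF ab(2,1)]] unfolding c(2,3)[OF ab(2,1)] by (smt (verit))
  qed (use sgn in blast)+
qed

text \<open>\<open>hom_refines\<close> turns the sign condition into the combinatorial one. The
  generation lemmas deal with \<open>Pm\<close> and \<open>Q\<close> only, so \<open>Pp\<close> is
  left through \<open>IdPM\<close> and entered through \<open>IdMP\<close>.\<close>

lemma hom_closed:
  assumes m: "m \<ge> 2" and A: "salgebra A" and R: "op_closed m (univ A) R"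
    and x: "x \<in> R i" "x \<in> alg_hom A (sort_alg m i)" and y: "y \<in> alg_hom A (sort_alg m j)"
    and xy: "\<And>a. a \<in> univ A \<Longrightarrow> 0 \<le> x a \<Longrightarrow> 0 \<le> y a"
  shows "y \<in> R j"
proof -
  define i' where "i' = (if i = Q then Q else Pm)"
  define j' where "j' = (if j = Q then Q else Pm)"
  have xf: "fits m (univ A) i x" and yf: "fits m (univ A) j y" using hom_fits[OF m] x y by auto
  have re: "restrict x (univ A) = x" "restrict y (univ A) = y"
    using hom_ext x(2) y by (auto intro: extensional_restrict)
  have "x \<in> R i'"
  proof (cases "i = Pp")
    case True
    then have "x a \<in> op_dom m IdPM" if "a \<in> univ A" for a using hom_mem[OF x(2) that] by simp
    then show ?thesis using op_closedD[OF R, of IdPM x] x(1) re(1) True by (simp add: i'_def)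
  qed (use x(1) in \<open>cases i; simp add: i'_def\<close>)
  moreover have "fits m (univ A) i' x" using xf by (auto simp: fits_def i'_def bound_def)
  moreover have yf': "fits m (univ A) j' y" using yf by (auto simp: fits_def j'_def bound_def)
  moreover have "\<bar>x a\<bar> \<le> int (nat (bound m i))" if "a \<in> univ A" for a
    using xf that by (fastforce simp: fits_def)
  ultimately have yR: "y \<in> R j'"
    using refines_closed[OF m R, of j' y i' x "nat (bound m i)"] hom_refines[OF A x(2) y xy]
    by (simp add: i'_def j'_def)
  show ?thesis
  proof (cases "j = Pp")
    case True
    then have "y a \<in> op_dom m IdMP" if "a \<in> univ A" for a using hom_mem[OF y that] by simp
    then show ?thesis using op_closedD[OF R, of IdMP y] yR re(2) True by (simp add: j'_def)
  qed (use yR in \<open>cases j; simp add: j'_def\<close>)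
qed

section \<open>The operations as homomorphisms between subchains\<close>

lemma chain_subuniverse:
  assumes "D \<subseteq> univ (sort_alg m s)" "D \<noteq> {}" "\<And>a. a \<in> D \<Longrightarrow> - a \<in> D"
  shows "subuniverse D (sort_alg m s)"
  using assms by (auto simp: subuniverse_def sort_alg_ops min_def max_def)

text \<open>The delicate operation is \<open>imp\<close>, which branches on the order of its
  arguments. By \<open>mono\<close>, \<open>f\<close> can blur a strict order only where both values
  are 0, and there both branches give 0.\<close>

lemma chain_hom:
  assumes f: "\<And>a. a \<in> D \<Longrightarrow> f a \<in> univ (sort_alg m t)"
    and D: "\<And>a. a \<in> D \<Longrightarrow> - a \<in> D" "\<And>a. a \<in> D \<Longrightarrow> f (- a) = - f a"
    and mono: "\<And>a b. a \<in> D \<Longrightarrow> b \<in> D \<Longrightarrow> b < a \<Longrightarrow> f b < f a \<or> f a = 0 \<and> f b = 0"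
  shows "restrict f D \<in> alg_hom (subalg (sort_alg m s) D) (sort_alg m t)"
proof -
  have le: "f a \<le> f b" if "a \<le> b" "a \<in> D" "b \<in> D" for a b
    using mono[of b a] that by (cases "a = b") auto
  have mm: "f (min a b) = min (f a) (f b)" "f (max a b) = max (f a) (f b)" if "a \<in> D" "b \<in> D" for a b
    using le[of a b] le[of b a] that by (auto simp: min_def max_def)
  have cl: "min a b \<in> D" "max a b \<in> D" if "a \<in> D" "b \<in> D" for a b
    using that by (auto simp: min_def max_def)
  have "f (if a \<le> b then max (- a) b else min (- a) b) =
      (if f a \<le> f b then max (- f a) (f b) else min (- f a) (f b))" if ab: "a \<in> D" "b \<in> D" for a b
    using mono[OF ab] le[of a b] mm[OF D(1)[OF ab(1)] ab(2)] D(2)[OF ab(1)] ab by auto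
  then show ?thesis
    using f D mm cl by (simp add: alg_hom_def subalg_def sort_alg_ops)
qed

lemma op_dom_subuniverse:
  assumes m: "m \<ge> 2" and r: "r \<in> gops (sug_sig m) \<union> hops (sug_sig m)"
  shows "subuniverse (op_dom m r) (sort_alg m (op_src r))"
proof (rule chain_subuniverse)
  show "op_dom m r \<subseteq> univ (sort_alg m (op_src r))" by (cases r) auto
  show "- a \<in> op_dom m r" if "a \<in> op_dom m r" for a
    using that by (cases r) (simp_all add: mem_sort_alg[OF m] del: sort_alg.simps)
  \<comment> \<open>The element 2 serves \<open>Jop\<close>, whose domain omits 1 and -1; it belongs
    to \<open>Q\<close> because \<open>m \<ge> 2\<close>.\<close>
  have "0 \<in> op_dom m r \<or> 1 \<in> op_dom m r \<or> 2 \<in> op_dom m r"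
    using m r by (cases r) (auto simp: mem_sort_alg[OF m] bound_def simp del: sort_alg.simps)
  then show "op_dom m r \<noteq> {}" by blast
qed

lemma op_fun_hom:
  assumes m: "m \<ge> 2" and r: "r \<in> gops (sug_sig m) \<union> hops (sug_sig m)"
  shows "restrict (op_fun m r) (op_dom m r) \<in>
    alg_hom (subalg (sort_alg m (op_src r)) (op_dom m r)) (sort_alg m (op_tgt r))"
proof (rule chain_hom)
  note [simp] = mem_sort_alg[OF m] bound_def and [simp del] = sort_alg.simps
  show neg: "- a \<in> op_dom m r" if "a \<in> op_dom m r" for a
    using that by (cases r) simp_all
  fix a assume a: "a \<in> op_dom m r"
  show "op_fun m r a \<in> univ (sort_alg m (op_tgt r))"
  proof (cases "r = Vop")
    case True
    then show ?thesis using Vop_fun[OF m, of a] a by auto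
  next
    case False
    then show ?thesis using r a by (cases r) (auto simp: shrink_def raise_def)
  qed
  show "op_fun m r (- a) = - op_fun m r a"
  proof (cases "r = Vop")
    case True
    then show ?thesis using Vop_fun[OF m, of a] Vop_fun[OF m, of "- a"] a neg[OF a] by auto
  next
    case False
    then show ?thesis using r a by (cases r) (auto simp: shrink_def raise_def)
  qed
  fix b assume b: "b \<in> op_dom m r" "b < a"
  show "op_fun m r b < op_fun m r a \<or> op_fun m r a = 0 \<and> op_fun m r b = 0"
  proof (cases "r = Vop")
    case True
    then show ?thesis using Vop_fun[OF m, of a] Vop_fun[OF m, of b] a b by auto
  next
    case False
    then show ?thesis using r a b by (cases r) (auto simp: shrink_def raise_def)
  qed
qed

lemma hom_comp:
  assumes A: "salgebra A" and x: "x \<in> alg_hom A M" "\<And>a. a \<in> univ A \<Longrightarrow> x a \<in> D"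
    and f: "restrict f D \<in> alg_hom (subalg M D) N"
  shows "(\<lambda>a\<in>univ A. f (x a)) \<in> alg_hom A N"
proof -
  have f': "restrict f D p \<in> univ N" "restrict f D (neg M p) = neg N (restrict f D p)"
    "restrict f D (meet M p q) = meet N (restrict f D p) (restrict f D q)"
    "restrict f D (join M p q) = join N (restrict f D p) (restrict f D q)"
    "restrict f D (imp M p q) = imp N (restrict f D p) (restrict f D q)" if "p \<in> D" "q \<in> D" for p q
    using f that unfolding alg_hom_def subalg_def by auto
  have x': "x (neg A a) = neg M (x a)" "x (meet A a b) = meet M (x a) (x b)"
    "x (join A a b) = join M (x a) (x b)" "x (imp A a b) = imp M (x a) (x b)"
    if "a \<in> univ A" "b \<in> univ A" for a b
    using x(1) that unfolding alg_hom_def by auto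
  have "f (x a) \<in> univ N" "f (x (neg A a)) = neg N (f (x a))"
    "f (x (meet A a b)) = meet N (f (x a)) (f (x b))" "f (x (join A a b)) = join N (f (x a)) (f (x b))"
    "f (x (imp A a b)) = imp N (f (x a)) (f (x b))"
    if ab: "a \<in> univ A" "b \<in> univ A" for a b
    using f'[OF x(2)[OF ab(1)] x(2)[OF ab(2)]] x(2) ab x'[OF ab] salgebra_closed[OF A ab]
    by (metis restrict_apply')+
  then show ?thesis using salgebra_closed[OF A] by (auto simp: alg_hom_def)
qed

lemma alg_hom_op_closed:
  assumes "m \<ge> 2" "salgebra A"
  shows "op_closed m (univ A) (\<lambda>s. alg_hom A (sort_alg m s))"
  unfolding op_closed_def
proof (intro ballI impI)
  fix r x assume r: "r \<in> gops (sug_sig m) \<union> hops (sug_sig m)"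
    and x: "x \<in> alg_hom A (sort_alg m (op_src r))" "\<forall>a\<in>univ A. x a \<in> op_dom m r"
  show "(\<lambda>a\<in>univ A. op_fun m r (x a)) \<in> alg_hom A (sort_alg m (op_tgt r))"
    by (rule hom_comp[OF assms(2) x(1) _ op_fun_hom[OF assms(1) r]]) (use x(2) in blast)
qed

lemma zero_hom: "m \<ge> 2 \<Longrightarrow> salgebra A \<Longrightarrow> (\<lambda>a\<in>univ A. 0) \<in> alg_hom A (sort_alg m Pm)"
  using salgebra_closed[of A] mem_sort_alg[of m 0 Pm]
  by (auto simp: alg_hom_def sort_alg_ops bound_def simp del: sort_alg.simps)


section \<open>Lattice homomorphisms onto the two-element chain\<close>

definition lat_hom :: "'a salg \<Rightarrow> ('a \<Rightarrow> bool) \<Rightarrow> bool" where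
  "lat_hom A f \<longleftrightarrow> (\<forall>a\<in>univ A. \<forall>b\<in>univ A.
     f (meet A a b) = (f a \<and> f b) \<and> f (join A a b) = (f a \<or> f b))"

lemma carrier_lat_hom:
  "x \<in> alg_hom A (sort_alg m s) \<Longrightarrow> lat_hom A (\<lambda>a. carrier_map s (x a))"
  unfolding lat_hom_def by (cases s) (auto simp: hom_ops simp del: sort_alg.simps)

text \<open>No lattice law is assumed of \<open>A\<close>. The meet is therefore described by its
  effect on every \<open>lat_hom\<close>, including those not yet known to come from a homomorphism
  into a chain.\<close>

lemma finite_meet:
  assumes A: "salgebra A" and "finite S" "S \<noteq> {}" "S \<subseteq> univ A"
  shows "\<exists>b\<in>univ A. \<forall>f. lat_hom A f \<longrightarrow> f b = (\<forall>s\<in>S. f s)"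
  using assms(2-4)
proof (induction S rule: finite_ne_induct)
  case (insert s S)
  then obtain b where b: "b \<in> univ A" "\<And>f. lat_hom A f \<Longrightarrow> f b = (\<forall>s\<in>S. f s)" by auto
  show ?case
    by (rule bexI[of _ "meet A s b"])
      (use b insert.prems salgebra_closed[OF A] in \<open>auto simp: lat_hom_def\<close>)
qed auto

lemma finite_join:
  assumes A: "salgebra A" and "finite S" "S \<noteq> {}" "S \<subseteq> univ A"
  shows "\<exists>b\<in>univ A. \<forall>f. lat_hom A f \<longrightarrow> f b = (\<exists>s\<in>S. f s)"
  using assms(2-4)
proof (induction S rule: finite_ne_induct)
  case (insert s S)
  then obtain b where b: "b \<in> univ A" "\<And>f. lat_hom A f \<Longrightarrow> f b = (\<exists>s\<in>S. f s)" by auto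
  show ?case
    by (rule bexI[of _ "join A s b"])
      (use b insert.prems salgebra_closed[OF A] in \<open>auto simp: lat_hom_def\<close>)
qed auto

lemma funpow_shrink:
  "(shrink ^^ k) p = (if p > int k then p - int k else if p < - int k then p + int k else 0)"
  by (induction k) (auto simp: shrink_def)

text \<open>The carrier maps composed with the total operations cut every sort at each of its elements.\<close>

lemma carriers_detect_order:
  assumes m: "m \<ge> 2"
    and T: "\<And>r p q. r \<in> gops (sug_sig m) \<Longrightarrow> T (op_src r) p q \<Longrightarrow>
        T (op_tgt r) (op_fun m r p) (op_fun m r q)"
    and c: "\<And>s p q. T s p q \<Longrightarrow> carrier_map s p \<Longrightarrow> carrier_map s q"
    and nz: "\<And>p q. T Q p q \<Longrightarrow> p \<noteq> 0 \<and> q \<noteq> 0"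
    and pq: "T s p q"
  shows "p \<le> q"
proof -
  have g: "T Pm ((shrink ^^ k) p) ((shrink ^^ k) q)" if "T Pm p q" for k p q
    by (induction k) (use that T[of Gop] in auto)
  have Pm: "p \<le> q" if "T Pm p q" for p q
  proof (rule ccontr)
    assume "\<not> p \<le> q"
    show False
    \<comment> \<open>Shrinking is used to move \<open>p\<close> exactly onto the cut. A
      \<open>p \<le> 0\<close> is brought to 0, where the carrier of \<open>Pm\<close> still accepts
      it while a smaller \<open>q\<close> stays negative; a positive \<open>p\<close> is brought to
      1, and \<open>IdMP\<close> changes to the carrier of \<open>Pp\<close>, which cuts
      there.\<close>
    proof (cases "p \<le> 0")
      case True
      then show False
        using c[OF g[OF that, of "nat (- p)"]] \<open>\<not> p \<le> q\<close> by (simp add: funpow_shrink split: if_splits)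
    next
      case False
      then show False
        using c[OF T[of IdMP, simplified, OF g[OF that, of "nat (p - 1)"]]] \<open>\<not> p \<le> q\<close>
        by (simp add: funpow_shrink split: if_splits)
    qed
  qed
  show ?thesis
  proof (cases s)
    case Pp
    then show ?thesis using pq T[of IdPM p q] Pm by simp
  next
    \<comment> \<open>After \<open>Uop\<close> the only undecided pair is 1 and -1, both sent to 0;
      the carrier of \<open>Q\<close> separates it.\<close>
    case Q
    then show ?thesis
      using pq T[of Uop p q] Pm[of "shrink p" "shrink q"] c[of Q p q] nz[of p q]
      by (auto simp: shrink_def split: if_splits)
  qed (use pq Pm in auto)
qed


section \<open>Compactness\<close>

abbreviation hom_topology :: "'a salg \<Rightarrow> 'b salg \<Rightarrow> ('a \<Rightarrow> 'b) topology" where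
  "hom_topology A N \<equiv> product_topology (\<lambda>_. discrete_topology (univ N)) (univ A)"

lemma openin_UN: "(\<And>k. k \<in> K \<Longrightarrow> openin T (W k)) \<Longrightarrow> openin T (\<Union>k\<in>K. W k)"
  by (rule openin_Union) blast

text \<open>An instance of a homomorphism equation involves the values of \<open>x\<close> at no
  more than three elements, so these sets suffice to describe the complement of
  \<open>alg_hom\<close>. Any \<open>P\<close> is allowed because the factors are discrete.\<close>

lemma openin_three_coordinates:
  assumes "a \<in> univ A" "b \<in> univ A" "c \<in> univ A"
  shows "openin (hom_topology A N) {x \<in> univ A \<rightarrow>\<^sub>E univ N. P (x a) (x b) (x c)}"
proof -
  let ?E = "univ A \<rightarrow>\<^sub>E univ N"
  have 1: "openin (hom_topology A N) {x \<in> ?E. x d = p}" if "d \<in> univ A" for d p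
  proof (cases "p \<in> univ N")
    case True
    have "continuous_map (hom_topology A N) (discrete_topology (univ N)) (\<lambda>x. x d)"
      by (rule continuous_map_product_projection[OF that])
    then have "openin (hom_topology A N) {x \<in> topspace (hom_topology A N). x d \<in> {p}}"
      by (rule openin_continuous_map_preimage) (use True in simp)
    then show ?thesis by simp
  next
    case False
    then have "{x \<in> ?E. x d = p} = {}" using that by auto
    then show ?thesis by (simp only: openin_empty)
  qed
  have "openin (hom_topology A N) ({x \<in> ?E. x a = p} \<inter> ({x \<in> ?E. x b = q} \<inter> {x \<in> ?E. x c = r}))" for p q r
    by (intro openin_Int 1 assms)
  then have "openin (hom_topology A N) (\<Union>k \<in> {(p, q, r). P p q r}.
      {x \<in> ?E. x a = fst k} \<inter> ({x \<in> ?E. x b = fst (snd k)} \<inter> {x \<in> ?E. x c = snd (snd k)}))"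
    by (intro openin_UN)
  moreover have "(\<Union>k \<in> {(p, q, r). P p q r}.
      {x \<in> ?E. x a = fst k} \<inter> ({x \<in> ?E. x b = fst (snd k)} \<inter> {x \<in> ?E. x c = snd (snd k)})) =
      {x \<in> ?E. P (x a) (x b) (x c)}"
    by force
  ultimately show ?thesis by (simp only:)
qed

lemma openin_coordinate:
  "a \<in> univ A \<Longrightarrow> openin (hom_topology A N) {x \<in> univ A \<rightarrow>\<^sub>E univ N. P (x a)}"
  by (rule openin_three_coordinates[of a A a a N "\<lambda>p _ _. P p"])

lemma closedin_alg_hom:
  assumes A: "salgebra A"
  shows "closedin (hom_topology A N) (alg_hom A N)"
proof -
  let ?E = "univ A \<rightarrow>\<^sub>E univ N"
  let ?W = "\<lambda>a b. {x \<in> ?E. x (neg A a) \<noteq> neg N (x a)} \<union> {x \<in> ?E. x (meet A a b) \<noteq> meet N (x a) (x b)} \<union>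
        {x \<in> ?E. x (join A a b) \<noteq> join N (x a) (x b)} \<union> {x \<in> ?E. x (imp A a b) \<noteq> imp N (x a) (x b)}"
  have "openin (hom_topology A N) (?W a b)" if ab: "a \<in> univ A" "b \<in> univ A" for a b
    using salgebra_closed[OF A ab]
      openin_three_coordinates[of "neg A a" A a b N "\<lambda>p q r. p \<noteq> neg N q"]
      openin_three_coordinates[of "meet A a b" A a b N "\<lambda>p q r. p \<noteq> meet N q r"]
      openin_three_coordinates[of "join A a b" A a b N "\<lambda>p q r. p \<noteq> join N q r"]
      openin_three_coordinates[of "imp A a b" A a b N "\<lambda>p q r. p \<noteq> imp N q r"]
      ab by (intro openin_Un)
  then have "openin (hom_topology A N) (\<Union>a\<in>univ A. \<Union>b\<in>univ A. ?W a b)"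
    by (intro openin_UN)
  moreover have "(\<Union>a\<in>univ A. \<Union>b\<in>univ A. ?W a b) = ?E - alg_hom A N"
    unfolding alg_hom_def by auto
  moreover have "alg_hom A N \<subseteq> ?E" by (auto simp: alg_hom_def)
  ultimately show ?thesis by (simp only: closedin_def topspace_product_topology topspace_discrete_topology)
qed

lemma compactin_alg_hom:
  assumes "salgebra A" "finite (univ N)"
  shows "compactin (hom_topology A N) (alg_hom A N)"
proof (rule closedin_compact_space)
  show "compact_space (hom_topology A N)"
    using assms(2) by (simp add: compact_space_product_topology compact_space_discrete_topology)
qed (rule closedin_alg_hom[OF assms(1)])

lemma finite_univ_sort_alg: "finite (univ (sort_alg m s))"
  by (cases s) (auto simp: Z_alg_def)

section \<open>Finite subcovers common to all sorts, and prime filters\<close>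

lemma compactin_finite_cover:
  assumes "compactin T S" "\<And>k. k \<in> K \<Longrightarrow> openin T (W k)" "S \<subseteq> (\<Union>k\<in>K. W k)"
  obtains K0 where "finite K0" "K0 \<subseteq> K" "S \<subseteq> (\<Union>k\<in>K0. W k)"
proof -
  obtain \<F> where "finite \<F>" "\<F> \<subseteq> W ` K" "S \<subseteq> \<Union>\<F>"
    using compactinD[OF assms(1), of "W ` K"] assms(2,3) by auto
  then obtain K0 where "K0 \<subseteq> K" "finite K0" "\<F> = W ` K0" 
    using finite_subset_image[OF \<open>finite \<F>\<close> \<open>\<F> \<subseteq> W ` K\<close>] by blast
  then show ?thesis using that \<open>S \<subseteq> \<Union>\<F>\<close> by blast
qed

lemma UNIV_sort: "(UNIV :: sort set) = {Pm, Pp, Q}"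
proof (rule set_eqI)
  show "s \<in> UNIV \<longleftrightarrow> s \<in> {Pm, Pp, Q}" for s by (cases s) simp_all
qed

text \<open>The index set \<open>K\<close> is shared by the sorts. In the applications it consists
  of elements of the algebra, so one finite set of elements has to serve all sorts at once.\<close>

lemma finite_cover_sorts:
  fixes S :: "sort \<Rightarrow> 'x set"
  assumes "\<And>s. compactin (T s) (S s)" "\<And>s k. k \<in> K \<Longrightarrow> openin (T s) (W s k)"
    "\<And>s x. x \<in> S s \<Longrightarrow> \<exists>k\<in>K. x \<in> W s k"
  obtains K0 where "finite K0" "K0 \<subseteq> K" "\<And>s x. x \<in> S s \<Longrightarrow> \<exists>k\<in>K0. x \<in> W s k"
proof -
  have "\<exists>K0. finite K0 \<and> K0 \<subseteq> K \<and> S s \<subseteq> (\<Union>k\<in>K0. W s k)" for s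
    by (rule compactin_finite_cover[OF assms(1)[of s], of K "W s"]) (use assms(2,3) in blast)+
  then obtain K0 where K0: "\<And>s. finite (K0 s) \<and> K0 s \<subseteq> K \<and> S s \<subseteq> (\<Union>k\<in>K0 s. W s k)" by metis
  have "\<exists>k\<in>(\<Union>s. K0 s). x \<in> W s k" if "x \<in> S s" for s x using K0[of s] that by blast
  then show ?thesis using that[of "\<Union>s. K0 s"] K0 by (auto simp: UNIV_sort)
qed

text \<open>A prime filter that is not of the form \<open>carrier_map i \<circ> x\<close> differs from each of these at some
  element. By compactness finitely many elements suffice for all \<open>x\<close>; the meet \<open>b\<close> of those in the
  filter and the join \<open>c\<close> of the others then satisfy \<open>b \<le> c\<close>.\<close>

lemma prime_filter_from_hom:
  fixes R :: "sort \<Rightarrow> ('a \<Rightarrow> int) set"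
  assumes m: "m \<ge> 2" and A: "salgebra A"
    and Rh: "\<And>s. R s \<subseteq> alg_hom A (sort_alg m s)"
    and Rc: "\<And>s. compactin (hom_topology A (sort_alg m s)) (R s)"
    and R: "op_closed m (univ A) R"
    and sep: "\<And>a b. a \<in> univ A \<Longrightarrow> b \<in> univ A \<Longrightarrow> (\<And>s x. x \<in> R s \<Longrightarrow> x a = x b) \<Longrightarrow> a = b"
    and f: "lat_hom A f" "p \<in> univ A" "f p" "q \<in> univ A" "\<not> f q"
  shows "\<exists>s. \<exists>x \<in> R s. \<forall>a\<in>univ A. carrier_map s (x a) = f a"
proof (rule ccontr)
  assume none: "\<not> ?thesis"
  let ?W = "\<lambda>s a. {x \<in> univ A \<rightarrow>\<^sub>E univ (sort_alg m s). carrier_map s (x a) \<noteq> f a}"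
  have mem: "x \<in> univ A \<rightarrow>\<^sub>E univ (sort_alg m s)" if "x \<in> R s" for x s
    using Rh[of s] that by (auto simp: alg_hom_def)
  have ex: "\<exists>a\<in>univ A. x \<in> ?W s a" if "x \<in> R s" for s x
    using none that mem[OF that] by blast
  have op: "openin (hom_topology A (sort_alg m s)) (?W s a)" if "a \<in> univ A" for s a
    by (rule openin_coordinate[OF that, of "sort_alg m s" "\<lambda>p. carrier_map s p \<noteq> f a"])
  obtain K where K: "finite K" "K \<subseteq> univ A" "\<And>s x. x \<in> R s \<Longrightarrow> \<exists>a\<in>K. x \<in> ?W s a"
    using finite_cover_sorts[of "\<lambda>s. hom_topology A (sort_alg m s)" R "univ A" ?W, OF Rc op ex] by blast
  \<comment> \<open>Adding \<open>p\<close> here, and \<open>q\<close> below, keeps both index sets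
    non-empty without changing that \<open>f\<close> accepts \<open>b\<close> and rejects
    \<open>c\<close>.\<close>
  obtain b where b: "b \<in> univ A" "\<And>g. lat_hom A g \<Longrightarrow> g b = (\<forall>a \<in> insert p {a \<in> K. f a}. g a)"
    using finite_meet[OF A, of "insert p {a \<in> K. f a}"] K f by auto
  obtain c where c: "c \<in> univ A" "\<And>g. lat_hom A g \<Longrightarrow> g c = (\<exists>a \<in> insert q {a \<in> K. \<not> f a}. g a)"
    using finite_join[OF A, of "insert q {a \<in> K. \<not> f a}"] K f by auto
  have bc: "carrier_map s (x c)" if x: "x \<in> R s" "carrier_map s (x b)" for s x
  proof -
    have xh: "x \<in> alg_hom A (sort_alg m s)" using Rh x by blast
    obtain a where "a \<in> K" "carrier_map s (x a) \<noteq> f a" using K(3)[OF x(1)] by blast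
    then show ?thesis using b(2)[OF carrier_lat_hom[OF xh]] c(2)[OF carrier_lat_hom[OF xh]] x(2) by auto
  qed
  \<comment> \<open>So far only carriers are compared, but for all members of \<open>R\<close> at
    once. As \<open>R\<close> is closed under the total operations, this comparison upgrades to the
    order itself.\<close>
  have le: "x b \<le> x c" if "x \<in> R s" for s x
  proof (rule carriers_detect_order[OF m, of "\<lambda>s p q. \<exists>x\<in>R s. p = x b \<and> q = x c"])
    fix r p q assume r: "r \<in> gops (sug_sig m)" and "\<exists>x\<in>R (op_src r). p = x b \<and> q = x c"
    then obtain x where x: "x \<in> R (op_src r)" "p = x b" "q = x c" by blast
    have "x a \<in> op_dom m r" if "a \<in> univ A" for a
      using r PiE_mem[OF mem[OF x(1)] that] by auto
    then have "(\<lambda>a\<in>univ A. op_fun m r (x a)) \<in> R (op_tgt r)"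
      using op_closedD[OF R, of r x] r x(1) by blast
    then show "\<exists>x\<in>R (op_tgt r). op_fun m r p = x b \<and> op_fun m r q = x c"
      by (rule bexI[rotated]) (simp add: x b(1) c(1))
  next
    fix p q assume "\<exists>x\<in>R Q. p = x b \<and> q = x c"
    then obtain x where x: "x \<in> R Q" "p = x b" "q = x c" by blast
    show "p \<noteq> 0 \<and> q \<noteq> 0"
      using PiE_mem[OF mem[OF x(1)] b(1)] PiE_mem[OF mem[OF x(1)] c(1)]
      unfolding mem_sort_alg[OF m] x(2,3) by simp
  qed (use bc that in auto)
  have "meet A b c = b"
    using salgebra_closed(2)[OF A b(1) c(1)] b(1)
  proof (rule sep)
    fix s x assume x: "x \<in> R s"
    then show "x (meet A b c) = x b" using hom_ops(2)[of x A m s b c] Rh[of s] b(1) c(1) le[OF x] by auto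
  qed
  moreover have "f (meet A b c) = (f b \<and> f c)" using f(1) b(1) c(1) by (simp add: lat_hom_def)
  moreover have "f b" using b(2)[OF f(1)] f(3) by simp
  ultimately have "f c" by simp
  then show False using c(2)[OF f(1)] f(5) by auto
qed

text \<open>If the carrier of \<open>y\<close> is not constant, \<open>prime_filter_from_hom\<close>
  finds a member of \<open>R\<close> with the same carrier, and equal carriers imply the sign
  condition of \<open>hom_closed\<close> for every pair of sorts. If it is constant, then
  \<open>y\<close> vanishes, and \<open>zero\<close> supplies the starting point.\<close>

lemma closed_separating_all:
  fixes R :: "sort \<Rightarrow> ('a \<Rightarrow> int) set"
  assumes m: "m \<ge> 2" and A: "salgebra A"
    and Rh: "\<And>s. R s \<subseteq> alg_hom A (sort_alg m s)"
    and Rc: "\<And>s. compactin (hom_topology A (sort_alg m s)) (R s)"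
    and R: "op_closed m (univ A) R" and zero: "(\<lambda>a\<in>univ A. 0) \<in> R Pm"
    and sep: "\<And>a b. a \<in> univ A \<Longrightarrow> b \<in> univ A \<Longrightarrow> (\<And>s x. x \<in> R s \<Longrightarrow> x a = x b) \<Longrightarrow> a = b"
    and y: "y \<in> alg_hom A (sort_alg m j)"
  shows "y \<in> R j"
proof (cases "(\<forall>a\<in>univ A. carrier_map j (y a)) \<or> (\<forall>a\<in>univ A. \<not> carrier_map j (y a))")
  case True
  \<comment> \<open>For a nonzero value, the carrier tells an element from its negation.\<close>
  have "y a = 0" if a: "a \<in> univ A" for a
  proof -
    have "carrier_map j (y a) = carrier_map j (y (neg A a))"
      using True a salgebra_closed(1)[OF A a a] by blast
    then show ?thesis
      using hom_ops(1)[OF y a a] hom_mem[OF y a] unfolding mem_sort_alg[OF m] by (cases j) auto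
  qed
  then show ?thesis using hom_closed[OF m A R zero zero_hom[OF m A] y] by simp
next
  case False
  then obtain p q where pq: "p \<in> univ A" "q \<in> univ A" "carrier_map j (y p)" "\<not> carrier_map j (y q)" by blast
  then obtain i x where x: "x \<in> R i" "\<And>a. a \<in> univ A \<Longrightarrow> carrier_map i (x a) = carrier_map j (y a)"
    using prime_filter_from_hom[OF m A Rh Rc R sep carrier_lat_hom[OF y], of p q] by blast
  have xh: "x \<in> alg_hom A (sort_alg m i)" using x(1) Rh by blast
  show ?thesis
  proof (rule hom_closed[OF m A R x(1) xh y])
    fix a assume a: "a \<in> univ A" "0 \<le> x a"
    have na: "neg A a \<in> univ A" by (rule salgebra_closed(1)[OF A a(1) a(1)])
    show "0 \<le> y a"
      using x(2)[OF a(1)] x(2)[OF na] a(2) hom_mem[OF xh a(1)] hom_mem[OF y a(1)]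
      unfolding mem_sort_alg[OF m] hom_ops(1)[OF xh a(1) a(1)] hom_ops(1)[OF y a(1) a(1)]
      by (cases i; cases j) auto
  qed
qed


section \<open>The variety generated by the even Sugihara chain\<close>

lemma prod_alg_simps [simp]:
  "univ (prod_alg I N) = (\<Pi>\<^sub>E i\<in>I. univ (N i))"
  "meet (prod_alg I N) f g = (\<lambda>i\<in>I. meet (N i) (f i) (g i))"
  "join (prod_alg I N) f g = (\<lambda>i\<in>I. join (N i) (f i) (g i))"
  "imp (prod_alg I N) f g = (\<lambda>i\<in>I. imp (N i) (f i) (g i))"
  "neg (prod_alg I N) f = (\<lambda>i\<in>I. neg (N i) (f i))"
  by (simp_all add: prod_alg_def)

lemma subalg_simps [simp]:
  "univ (subalg A B) = B" "meet (subalg A B) = meet A" "join (subalg A B) = join A"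
  "imp (subalg A B) = imp A" "neg (subalg A B) = neg A"
  by (simp_all add: subalg_def)

lemma subalg_univ: "subalg A (univ A) = (A :: 'a salg)"
  by (simp add: subalg_def)

lemma salgebra_subalg: "subuniverse B A \<Longrightarrow> salgebra (subalg A B)"
  by (auto simp: salgebra_def subuniverse_def)

lemma alg_homD:
  assumes "x \<in> alg_hom A N" "a \<in> univ A" "b \<in> univ A"
  shows "x (neg A a) = neg N (x a)" "x (meet A a b) = meet N (x a) (x b)"
    "x (join A a b) = join N (x a) (x b)" "x (imp A a b) = imp N (x a) (x b)"
  using assms by (auto simp: alg_hom_def)

lemma alg_homI:
  assumes "\<And>a. a \<in> univ A \<Longrightarrow> x a \<in> univ N" "x \<in> extensional (univ A)"
    "\<And>a. a \<in> univ A \<Longrightarrow> x (neg A a) = neg N (x a)"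
    "\<And>a b. a \<in> univ A \<Longrightarrow> b \<in> univ A \<Longrightarrow> x (meet A a b) = meet N (x a) (x b)"
    "\<And>a b. a \<in> univ A \<Longrightarrow> b \<in> univ A \<Longrightarrow> x (join A a b) = join N (x a) (x b)"
    "\<And>a b. a \<in> univ A \<Longrightarrow> b \<in> univ A \<Longrightarrow> x (imp A a b) = imp N (x a) (x b)"
  shows "x \<in> alg_hom A N"
  using assms by (auto simp: alg_hom_def PiE_def)

lemma ISP_separated:
  assumes A: "salgebra A"
    and sep: "\<And>a b. a \<in> univ A \<Longrightarrow> b \<in> univ A \<Longrightarrow> a \<noteq> b \<Longrightarrow> \<exists>N\<in>\<K>. \<exists>x\<in>alg_hom A N. x a \<noteq> x b"
  shows "A \<in> ISP \<K>"
proof -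
  define I where "I = {(N, x). N \<in> \<K> \<and> x \<in> alg_hom A N}"
  define k where "k = (\<lambda>a\<in>univ A. \<lambda>i\<in>I. snd i a)"
  let ?P = "prod_alg I fst"
  have I: "snd i \<in> alg_hom A (fst i)" if "i \<in> I" for i using that by (auto simp: I_def)
  have kP: "k a \<in> univ ?P" if "a \<in> univ A" for a
    using hom_mem[OF I that] that by (simp add: k_def)
  have ops: "k (neg A a) = neg ?P (k a)" "k (meet A a b) = meet ?P (k a) (k b)"
    "k (join A a b) = join ?P (k a) (k b)" "k (imp A a b) = imp ?P (k a) (k b)"
    if "a \<in> univ A" "b \<in> univ A" for a b
    using salgebra_closed[OF A that] alg_homD[OF I that] that by (auto simp: k_def intro!: restrict_ext)
  have sub: "subuniverse (k ` univ A) ?P"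
  proof -
    have "univ A \<noteq> {}" using A by (auto simp: salgebra_def subuniverse_def)
    moreover have "neg ?P (k a) \<in> k ` univ A" "meet ?P (k a) (k b) \<in> k ` univ A"
      "join ?P (k a) (k b) \<in> k ` univ A" "imp ?P (k a) (k b) \<in> k ` univ A"
      if "a \<in> univ A" "b \<in> univ A" for a b
      using salgebra_closed[OF A that] unfolding ops[OF that, symmetric] by (auto intro: imageI)
    ultimately show ?thesis using kP unfolding subuniverse_def by (auto simp del: prod_alg_simps)
  qed
  have "inj_on k (univ A)"
  proof (rule inj_onI, rule ccontr)
    fix a b assume ab: "a \<in> univ A" "b \<in> univ A" "k a = k b" "a \<noteq> b"
    then obtain N x where i: "(N, x) \<in> I" "x a \<noteq> x b" using sep by (force simp: I_def)
    then show False using fun_cong[OF ab(3), of "(N, x)"] ab by (simp add: k_def)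
  qed
  moreover have "k \<in> alg_hom A (subalg ?P (k ` univ A))"
    by (rule alg_homI) (use ops in \<open>auto simp: k_def\<close>)
  ultimately have "k \<in> alg_iso A (subalg ?P (k ` univ A))" by (simp add: alg_iso_def bij_betw_def)
  then show ?thesis using ISP_I[OF A _ sub] by (force simp: I_def)
qed

text \<open>The prime filter theorem for distributive lattices: a filter maximal among those
  containing one element and omitting the other is prime. The laws appear as hypotheses because the
  algebra in question is known only as a homomorphic image, from whose source it inherits
  them.\<close>

lemma lat_hom_separates:
  assumes A: "salgebra A" and ab: "a \<in> univ A" "b \<in> univ A" "a \<noteq> b"
    and idem: "\<And>x. x \<in> univ A \<Longrightarrow> meet A x x = x"
    and comm: "\<And>x y. x \<in> univ A \<Longrightarrow> y \<in> univ A \<Longrightarrow> meet A x y = meet A y x"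
    and assoc: "\<And>x y z. x \<in> univ A \<Longrightarrow> y \<in> univ A \<Longrightarrow> z \<in> univ A \<Longrightarrow>
       meet A (meet A x y) z = meet A x (meet A y z)"
    and absorb: "\<And>x y. x \<in> univ A \<Longrightarrow> y \<in> univ A \<Longrightarrow> meet A x (join A x y) = x"
      "\<And>x y. x \<in> univ A \<Longrightarrow> y \<in> univ A \<Longrightarrow> meet A y (join A x y) = y"
    and distrib: "\<And>x y z. x \<in> univ A \<Longrightarrow> y \<in> univ A \<Longrightarrow> z \<in> univ A \<Longrightarrow>
       meet A x (join A y z) = join A (meet A x y) (meet A x z)"
  shows "\<exists>f. lat_hom A f \<and> f a \<noteq> f b"
proof -
  let ?U = "univ A"
  note cl = salgebra_closed[OF A]
  define le where "le x y \<longleftrightarrow> meet A x y = x" for x y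
  have trans: "le x z" if "le x y" "le y z" "x \<in> ?U" "y \<in> ?U" "z \<in> ?U" for x y z
    using that assoc[of x y z] by (simp add: le_def)
  have mono: "le (meet A x y) (meet A x' y')"
    if "le x x'" "le y y'" "x \<in> ?U" "y \<in> ?U" "x' \<in> ?U" "y' \<in> ?U" for x y x' y'
  proof -
    have "meet A (meet A x y) (meet A x' y') = meet A (meet A x x') (meet A y y')"
      using that comm assoc cl by metis
    then show ?thesis using that by (simp add: le_def)
  qed
  have lower: "le (meet A x y) x" "le (meet A x y) y" if "x \<in> ?U" "y \<in> ?U" for x y
    using that comm assoc idem cl unfolding le_def by metis+
  have lub: "le (join A x y) z" if "le x z" "le y z" "x \<in> ?U" "y \<in> ?U" "z \<in> ?U" for x y z
    using that distrib[of z x y] comm cl unfolding le_def by metis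
  have main: "\<exists>f. lat_hom A f \<and> f a \<and> \<not> f b" if ab: "a \<in> ?U" "b \<in> ?U" "\<not> le a b" for a b
  proof -
    define fil where "fil F \<longleftrightarrow> F \<subseteq> ?U \<and> (\<forall>x\<in>F. \<forall>y\<in>F. meet A x y \<in> F) \<and> (\<forall>x\<in>F. \<forall>y\<in>?U. le x y \<longrightarrow> y \<in> F)" for F
    define \<F> where "\<F> = {F. fil F \<and> a \<in> F \<and> b \<notin> F}"
    have "{y \<in> ?U. le a y} \<in> \<F>"
      using ab trans mono[of a _ a] idem cl unfolding \<F>_def fil_def by (auto simp: le_def)
    then have ne: "\<F> \<noteq> {}" by blast
    have "\<exists>F\<in>\<F>. \<forall>X\<in>\<F>. F \<subseteq> X \<longrightarrow> X = F"
    proof (rule subset_Zorn_nonempty[OF ne])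
      fix \<C> assume C: "\<C> \<noteq> {}" "subset.chain \<F> \<C>"
      then have CF: "\<C> \<subseteq> \<F>" by (simp add: subset.chain_def)
      have "meet A x y \<in> \<Union>\<C>" if "x \<in> \<Union>\<C>" "y \<in> \<Union>\<C>" for x y
      proof -
        obtain X Y where "X \<in> \<C>" "Y \<in> \<C>" "x \<in> X" "y \<in> Y" using \<open>x \<in> \<Union>\<C>\<close> \<open>y \<in> \<Union>\<C>\<close> by blast
        moreover from this have "X \<subseteq> Y \<or> Y \<subseteq> X" using C(2) by (auto simp: subset.chain_def)
        moreover have "meet A x y \<in> Z" if "Z \<in> \<C>" "x \<in> Z" "y \<in> Z" for Z
          using that CF unfolding \<F>_def fil_def by blast
        ultimately show ?thesis by blast
      qed
      moreover have "y \<in> \<Union>\<C>" if "x \<in> \<Union>\<C>" "y \<in> ?U" "le x y" for x y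
        using that CF unfolding \<F>_def fil_def by blast
      moreover have "\<Union>\<C> \<subseteq> ?U" "a \<in> \<Union>\<C>" "b \<notin> \<Union>\<C>"
        using C(1) CF unfolding \<F>_def fil_def by auto
      ultimately show "\<Union>\<C> \<in> \<F>" unfolding \<F>_def fil_def by blast
    qed
    then obtain F where F: "F \<in> \<F>" "\<And>X. X \<in> \<F> \<Longrightarrow> F \<subseteq> X \<Longrightarrow> X = F" by blast
    have FU: "F \<subseteq> ?U" and Fm: "\<And>x y. x \<in> F \<Longrightarrow> y \<in> F \<Longrightarrow> meet A x y \<in> F"
      and Fu: "\<And>x y. x \<in> F \<Longrightarrow> y \<in> ?U \<Longrightarrow> le x y \<Longrightarrow> y \<in> F" and aF: "a \<in> F" "b \<notin> F"
      using F(1) by (auto simp: \<F>_def fil_def)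
    \<comment> \<open>Otherwise the filter generated by \<open>F\<close> and \<open>c\<close> would
      still omit \<open>b\<close>, against maximality.\<close>
    have ext: "\<exists>f\<in>F. le (meet A f c) b" if c: "c \<in> ?U" "c \<notin> F" for c
    proof (rule ccontr)
      assume none: "\<not> ?thesis"
      define X where "X = {z \<in> ?U. \<exists>f\<in>F. le (meet A f c) z}"
      have "F \<subseteq> X" using FU lower(1) c(1) by (auto simp: X_def)
      moreover have "c \<in> X" using FU aF(1) lower(2)[of a c] c(1) by (auto simp: X_def)
      moreover have "X \<in> \<F>"
      proof -
        have "meet A x y \<in> X" if xy: "x \<in> X" "y \<in> X" for x y
        proof -
          obtain f g where fg: "f \<in> F" "g \<in> F" "le (meet A f c) x" "le (meet A g c) y"
            using xy by (auto simp: X_def)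
          have U: "x \<in> ?U" "y \<in> ?U" "f \<in> ?U" "g \<in> ?U" using xy fg FU by (auto simp: X_def)
          have "le (meet A (meet A f c) (meet A g c)) (meet A x y)"
            using mono[OF fg(3,4)] U c(1) cl by blast
          moreover have "meet A (meet A f c) (meet A g c) = meet A (meet A f g) (meet A c c)"
            using U c(1) comm assoc cl by metis
          ultimately show ?thesis using Fm[OF fg(1,2)] U c(1) cl idem[OF c(1)] by (auto simp: X_def)
        qed
        moreover have "y \<in> X" if xy: "x \<in> X" "y \<in> ?U" "le x y" for x y
        proof -
          obtain f where f: "f \<in> F" "le (meet A f c) x" "x \<in> ?U" using xy by (auto simp: X_def)
          then show ?thesis using trans[OF f(2) xy(3)] cl(2)[of f c] FU c(1) xy(2) by (auto simp: X_def)
        qed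
        moreover have "b \<notin> X" using none by (auto simp: X_def)
        moreover have "X \<subseteq> ?U" by (auto simp: X_def)
        ultimately show ?thesis using \<open>F \<subseteq> X\<close> aF(1) unfolding \<F>_def fil_def by blast
      qed
      ultimately show False using F(2)[of X] c(2) by blast
    qed
    have "lat_hom A (\<lambda>x. x \<in> F)"
      unfolding lat_hom_def
    proof (intro ballI conjI)
      fix x y assume xy: "x \<in> ?U" "y \<in> ?U"
      show "(meet A x y \<in> F) = (x \<in> F \<and> y \<in> F)"
        using Fm Fu lower[OF xy] cl(2)[OF xy] xy by blast
      show "(join A x y \<in> F) = (x \<in> F \<or> y \<in> F)"
      proof
        assume j: "join A x y \<in> F"
        show "x \<in> F \<or> y \<in> F"
        proof (rule ccontr)
          assume "\<not> (x \<in> F \<or> y \<in> F)"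
          then obtain f g where fg: "f \<in> F" "le (meet A f x) b" "g \<in> F" "le (meet A g y) b"
            using ext xy by blast
          have U: "f \<in> ?U" "g \<in> ?U" using fg FU by auto
          \<comment> \<open>A common witness for \<open>x\<close> and \<open>y\<close>;
            distributivity then puts the meet of \<open>?h\<close> and \<open>join A x y\<close>
            below \<open>b\<close>.\<close>
          let ?h = "meet A f g"
          have h: "?h \<in> F" "?h \<in> ?U" using Fm fg U cl(2) by auto
          have "le (meet A ?h x) b" "le (meet A ?h y) b"
            using trans[OF mono[OF lower(1)[OF U], of x x] fg(2)] trans[OF mono[OF lower(2)[OF U], of y y] fg(4)]
              U h xy cl ab idem unfolding le_def by auto
          then have "le (meet A ?h (join A x y)) b"
            using lub[of "meet A ?h x" b "meet A ?h y"] distrib[OF h(2) xy] h xy cl(2) ab by auto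
          then show False using Fu[OF Fm[OF h(1) j] ab(2)] aF(2) by blast
        qed
      next
        assume "x \<in> F \<or> y \<in> F"
        then show "join A x y \<in> F" using Fu[of _ "join A x y"] absorb[OF xy] cl(3)[OF xy] by (auto simp: le_def)
      qed
    qed
    then show ?thesis using aF by blast
  qed
  have "\<not> le a b \<or> \<not> le b a" using ab comm[OF ab(1,2)] by (auto simp: le_def)
  then show ?thesis using main ab by blast
qed

text \<open>If \<open>0 \<le> x a < x b\<close> and the carrier map does not separate \<open>x a\<close> from \<open>x b\<close>, then it separates
  \<open>x (imp A a a) = x a\<close> from \<open>x (imp A b a) = - x b\<close>; hence the kernel of \<open>x\<close> is the largest congruence
  saturating the prime filter of \<open>x\<close>.\<close>

lemma carrier_determines_kernel:
  assumes A: "salgebra A" and x: "x \<in> alg_hom A (sort_alg m s)" and h: "h \<in> alg_hom A A'"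
    and f: "\<And>a. a \<in> univ A \<Longrightarrow> carrier_map s (x a) = f (h a)"
    and ab: "a \<in> univ A" "b \<in> univ A" "h a = h b"
  shows "x a = x b"
proof -
  have pos: "x b \<le> x a" if ab: "a \<in> univ A" "b \<in> univ A" "h a = h b" "0 \<le> x a" for a b
  proof (rule ccontr)
    assume lt: "\<not> x b \<le> x a"
    have c: "imp A a a \<in> univ A" "imp A b a \<in> univ A" using salgebra_closed(4)[OF A] ab by auto
    have "h (imp A a a) = h (imp A b a)"
      using alg_homD(4)[OF h] ab by simp
    then show False
      using f[OF c(1)] f[OF c(2)] f[OF ab(1)] f[OF ab(2)] ab(3,4) lt
        hom_ops(4)[OF x ab(1) ab(1)] hom_ops(4)[OF x ab(2) ab(1)]
      by (cases s) (auto split: if_splits)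
  qed
  have "x b \<le> x a" if ab: "a \<in> univ A" "b \<in> univ A" "h a = h b" for a b
  proof (rule ccontr)
    assume lt: "\<not> x b \<le> x a"
    have n: "neg A a \<in> univ A" "neg A b \<in> univ A" "h (neg A b) = h (neg A a)"
      "x (neg A a) = - x a" "x (neg A b) = - x b"
      using salgebra_closed(1)[OF A] alg_homD(1)[OF h] hom_ops(1)[OF x] ab by auto
    \<comment> \<open>The non-negative case, applied also to the negations, leaves only values of
      strictly opposite sign, and every carrier separates those.\<close>
    have "\<not> 0 \<le> x a" using pos[OF ab] lt by blast
    moreover have "\<not> 0 \<le> - x b" using pos[OF n(2,1,3)] lt n(4,5) by auto
    ultimately show False using f[OF ab(1)] f[OF ab(2)] ab(3) by (cases s) auto
  qed
  from this[OF ab(1,2)] this[OF ab(2,1)] show ?thesis using ab(3) by simp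
qed

text \<open>Let \<open>A\<close> be the image under \<open>h\<close> of a subalgebra
  \<open>C\<close> of a power. A prime filter separating two elements of \<open>A\<close> pulls back
  to \<open>C\<close> and is there the carrier of a homomorphism \<open>x\<close>. The kernel of
  \<open>x\<close> contains that of \<open>h\<close>, so \<open>x\<close> factors through
  \<open>h\<close>; the factor has the original filter as its carrier and separates the two
  elements.\<close>

lemma HSP_subset_ISP:
  assumes m: "m \<ge> 2"
  shows "HSP {Z_alg (2 * m)} \<subseteq> (ISP {Z_alg (2 * m), Z_alg (2 * m - 1)} :: 'a salg set)"
proof
  fix A :: "'a salg" assume "A \<in> HSP {Z_alg (2 * m)}"
  then obtain I :: "(int salg \<times> ('a \<Rightarrow> int)) set" and N B h where A: "salgebra A"
    and N: "N ` I \<subseteq> {Z_alg (2 * m)}" and B: "subuniverse B (prod_alg I N)"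
    and h: "h \<in> alg_hom (subalg (prod_alg I N) B) A" "h ` B = univ A"
    unfolding HSP_def by blast
  define C where "C = subalg (prod_alg I N) B"
  have C: "salgebra C" "univ C = B" using salgebra_subalg[OF B] by (auto simp: C_def)
  have hC: "h \<in> alg_hom C A" using h(1) by (simp add: C_def)
  have N': "N i = sort_alg m Q" if "i \<in> I" for i using N that by auto
  have BP: "b \<in> (\<Pi>\<^sub>E i\<in>I. univ (sort_alg m Q))" if "b \<in> B" for b
    using B N' that unfolding subuniverse_def by (auto simp: PiE_iff subset_iff simp del: sort_alg.simps)
  have opsC: "meet C b c = (\<lambda>i\<in>I. min (b i) (c i))" "join C b c = (\<lambda>i\<in>I. max (b i) (c i))"
    "neg C b = (\<lambda>i\<in>I. - b i)" "imp C b c = (\<lambda>i\<in>I. imp (sort_alg m Q) (b i) (c i))" for b c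
    using N' by (auto simp: C_def sort_alg_ops intro!: restrict_ext simp del: sort_alg.simps)
  have proj: "(\<lambda>b\<in>B. b i) \<in> alg_hom C (sort_alg m Q)" if "i \<in> I" for i
    by (rule alg_homI)
      (use BP that salgebra_closed[OF C(1)] in \<open>auto simp: C(2) opsC sort_alg_ops simp del: sort_alg.simps\<close>)
  have sepC: "b = c" if bc: "b \<in> univ C" "c \<in> univ C"
    and eq: "\<And>s x. x \<in> alg_hom C (sort_alg m s) \<Longrightarrow> x b = x c" for b c
  proof (rule PiE_ext[OF BP BP])
    show "b i = c i" if "i \<in> I" for i using eq[OF proj[OF that]] bc C(2) by simp
  qed (use bc C(2) in auto)
  show "A \<in> ISP {Z_alg (2 * m), Z_alg (2 * m - 1)}"
  proof (rule ISP_separated[OF A])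
    fix a b assume ab: "a \<in> univ A" "b \<in> univ A" "a \<noteq> b"
    have surj: "\<exists>c\<in>univ C. x = h c" if "x \<in> univ A" for x using that h(2) C(2) by blast
    note cl = salgebra_closed[OF C(1)]
    note hh = alg_homD(2,3)[OF hC, symmetric]
    have laws: "meet C x x = x" "meet C x y = meet C y x" "meet C (meet C x y) z = meet C x (meet C y z)"
      "meet C x (join C x y) = x" "meet C y (join C x y) = y"
      "meet C x (join C y z) = join C (meet C x y) (meet C x z)"
      if "x \<in> univ C" "y \<in> univ C" "z \<in> univ C" for x y z
      using BP[of x] BP[of y] that C(2) unfolding PiE_def extensional_def
      by (auto simp: opsC fun_eq_iff min_max_distrib2 min.commute min.left_commute simp del: sort_alg.simps)
    have "\<exists>f. lat_hom A f \<and> f a \<noteq> f b"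
    proof (rule lat_hom_separates[OF A ab])
      fix x y z assume "x \<in> univ A" "y \<in> univ A" "z \<in> univ A"
      then obtain u v w where *: "u \<in> univ C" "x = h u" "v \<in> univ C" "y = h v" "w \<in> univ C" "z = h w"
        using surj by meson
      show "meet A (meet A x y) z = meet A x (meet A y z)"
        "meet A x (join A y z) = join A (meet A x y) (meet A x z)"
        using * laws(3,6)[OF *(1,3,5)] by (simp_all add: hh cl)
    next
      fix x y assume "x \<in> univ A" "y \<in> univ A"
      then obtain u v where *: "u \<in> univ C" "x = h u" "v \<in> univ C" "y = h v"
        using surj by meson
      show "meet A x x = x" "meet A x (join A x y) = x" "meet A y (join A x y) = y" "meet A x y = meet A y x"
        using * laws(1,2,4,5)[OF *(1,3,3)] by (simp_all add: hh cl)
    qed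
    then obtain f where f: "lat_hom A f" "f a \<noteq> f b" by blast
    have fh: "lat_hom C (f \<circ> h)"
      using f(1) alg_homD(2,3)[OF hC] hom_mem[OF hC] by (simp add: lat_hom_def)
    obtain c d where cd: "c \<in> univ C" "d \<in> univ C" "f (h c)" "\<not> f (h d)"
      using f(2) surj[OF ab(1)] surj[OF ab(2)] by blast
    have "\<exists>s. \<exists>x\<in>alg_hom C (sort_alg m s). \<forall>c\<in>univ C. carrier_map s (x c) = (f \<circ> h) c"
    proof (rule prime_filter_from_hom[OF m C(1) order_refl compactin_alg_hom[OF C(1) finite_univ_sort_alg]
          alg_hom_op_closed[OF m C(1)] _ fh])
      show "a = b" if "a \<in> univ C" "b \<in> univ C" "\<And>s x. x \<in> alg_hom C (sort_alg m s) \<Longrightarrow> x a = x b" for a b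
        using that by (rule sepC)
    qed (use cd in simp_all)
    then obtain s x where x: "x \<in> alg_hom C (sort_alg m s)"
      "\<And>c. c \<in> univ C \<Longrightarrow> carrier_map s (x c) = f (h c)"
      by auto
    \<comment> \<open>Applicable because the carrier of \<open>x\<close> at \<open>c\<close> depends
      on \<open>h c\<close> alone.\<close>
    have ker: "x c = x d" if "c \<in> univ C" "d \<in> univ C" "h c = h d" for c d
      using carrier_determines_kernel[of C x m s h A f, OF C(1) x(1) hC] x(2) that by blast
    obtain t where t: "\<And>a. a \<in> univ A \<Longrightarrow> t a \<in> univ C \<and> a = h (t a)"
      using bchoice[of "univ A" "\<lambda>a c. c \<in> univ C \<and> a = h c"] surj by blast
    define y where "y = (\<lambda>a\<in>univ A. x (t a))"
    have yh: "y (h c) = x c" if "c \<in> univ C" for c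
      using t[OF hom_mem[OF hC that]] ker[of "t (h c)" c] hom_mem[OF hC that] that by (simp add: y_def)
    have "y \<in> alg_hom A (sort_alg m s)"
    proof (rule alg_homI)
      show "y a \<in> univ (sort_alg m s)" if "a \<in> univ A" for a
        using t[OF that] hom_mem[OF x(1)] that by (simp add: y_def)
      show "y \<in> extensional (univ A)" by (simp add: y_def)
      show "y (neg A a) = neg (sort_alg m s) (y a)" if "a \<in> univ A" for a
      proof -
        obtain c where c: "c \<in> univ C" "a = h c" using surj[OF \<open>a \<in> univ A\<close>] by blast
        show ?thesis unfolding c(2) alg_homD(1)[OF hC c(1) c(1), symmetric]
          by (simp add: yh c cl(1)[OF c(1) c(1)] alg_homD(1)[OF x(1) c(1) c(1)])
      qed
      fix a b assume "a \<in> univ A" "b \<in> univ A"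
      then obtain c d where cd: "c \<in> univ C" "a = h c" "d \<in> univ C" "b = h d" using surj by meson
      show "y (meet A a b) = meet (sort_alg m s) (y a) (y b)" "y (join A a b) = join (sort_alg m s) (y a) (y b)"
        "y (imp A a b) = imp (sort_alg m s) (y a) (y b)"
        unfolding cd(2,4) alg_homD(2-4)[OF hC cd(1,3), symmetric]
        by (simp_all add: yh cd cl alg_homD(2-4)[OF x(1) cd(1,3)])
    qed
    moreover have "y a \<noteq> y b"
    proof -
      have "carrier_map s (y c) = f c" if "c \<in> univ A" for c
        using t[OF that] x(2)[of "t c"] that by (simp add: y_def)
      from this[OF ab(1)] this[OF ab(2)] show ?thesis using f(2) by auto
    qed
    moreover have "sort_alg m s \<in> {Z_alg (2 * m), Z_alg (2 * m - 1)}" by (cases s) auto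
    ultimately show "\<exists>N\<in>{Z_alg (2 * m), Z_alg (2 * m - 1)}. \<exists>x\<in>alg_hom A N. x a \<noteq> x b" by blast
  qed
qed

text \<open>A product of images of \<open>Z\<close> is an image of a power of \<open>Z\<close>, by
  the coordinatewise map \<open>T\<close>. The preimage of \<open>B\<close> under \<open>T\<close>
  maps onto \<open>B\<close>, and the inverse of \<open>k\<close> leads on to
  \<open>A\<close>.\<close>

lemma ISP_subset_HSP:
  fixes Z :: "'b salg"
  assumes Z: "salgebra Z" and im: "\<And>N. N \<in> \<K> \<Longrightarrow> \<exists>g\<in>alg_hom Z N. g ` univ Z = univ N"
  shows "ISP \<K> \<subseteq> (HSP {Z} :: 'a salg set)"
proof
  fix A :: "'a salg" assume "A \<in> ISP \<K>"
  then obtain I :: "('a \<times> 'a) set" and N B k where A: "salgebra A" and N: "N ` I \<subseteq> \<K>"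
    and B: "subuniverse B (prod_alg I N)" and k: "k \<in> alg_iso A (subalg (prod_alg I N) B)"
    by (auto simp: ISP_def)
  let ?P = "prod_alg I N" and ?P' = "prod_alg I (\<lambda>_. Z)"
  have kh: "k \<in> alg_hom A (subalg ?P B)" and kb: "bij_betw k (univ A) B" using k by (auto simp: alg_iso_def)
  have "\<forall>i\<in>I. \<exists>g. g \<in> alg_hom Z (N i) \<and> g ` univ Z = univ (N i)" using im N by blast
  then obtain g where g: "\<And>i. i \<in> I \<Longrightarrow> g i \<in> alg_hom Z (N i)" "\<And>i. i \<in> I \<Longrightarrow> g i ` univ Z = univ (N i)"
    by metis
  define T where "T f = (\<lambda>i\<in>I. g i (f i))" for f :: "('a \<times> 'a) \<Rightarrow> 'b"
  have T: "T (neg ?P' f) = neg ?P (T f)" "T (meet ?P' f f') = meet ?P (T f) (T f')"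
    "T (join ?P' f f') = join ?P (T f) (T f')" "T (imp ?P' f f') = imp ?P (T f) (T f')"
    if "f \<in> univ ?P'" "f' \<in> univ ?P'" for f f'
  proof -
    have "f i \<in> univ Z" "f' i \<in> univ Z" if "i \<in> I" for i
      using PiE_mem[of f I "\<lambda>_. univ Z" i] PiE_mem[of f' I "\<lambda>_. univ Z" i] that
        \<open>f \<in> univ ?P'\<close> \<open>f' \<in> univ ?P'\<close> by auto
    note homs = alg_homD[OF g(1) this]
    show "T (neg ?P' f) = neg ?P (T f)" "T (meet ?P' f f') = meet ?P (T f) (T f')"
      "T (join ?P' f f') = join ?P (T f) (T f')" "T (imp ?P' f f') = imp ?P (T f) (T f')"
      using homs by (auto simp: T_def intro!: restrict_ext)
  qed
  define B' where "B' = {f \<in> univ ?P'. T f \<in> B}"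
  have "\<exists>f\<in>B'. T f = b" if b: "b \<in> B" for b
  proof -
    have bP: "b \<in> univ ?P" using b B by (auto simp: subuniverse_def)
    then have "\<forall>i\<in>I. \<exists>z. z \<in> univ Z \<and> g i z = b i" using g(2) by (auto simp: PiE_iff) (metis imageE)
    then obtain f where f: "\<And>i. i \<in> I \<Longrightarrow> f i \<in> univ Z \<and> g i (f i) = b i" by metis
    have "T (restrict f I) = b" using f bP by (auto simp: T_def PiE_def extensional_def fun_eq_iff)
    moreover have "restrict f I \<in> univ ?P'" using f by simp
    ultimately show ?thesis using b unfolding B'_def by blast
  qed
  then have TB: "T ` B' = B" by (auto simp: B'_def)
  have "salgebra ?P'"
  proof -
    obtain z where "z \<in> univ Z" using Z by (auto simp: salgebra_def subuniverse_def)
    then have "(\<lambda>i\<in>I. z) \<in> univ ?P'" by simp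
    then have "univ ?P' \<noteq> {}" by blast
    moreover have "neg Z a \<in> univ Z" if "a \<in> univ Z" for a by (rule salgebra_closed(1)[OF Z that that])
    ultimately show ?thesis
      using salgebra_closed(2-4)[OF Z] by (auto simp: salgebra_def subuniverse_def PiE_iff)
  qed
  note cl = salgebra_closed[OF this]
  have B': "subuniverse B' ?P'"
    unfolding subuniverse_def
  proof (intro conjI ballI)
    show "B' \<noteq> {}" using TB B by (auto simp: subuniverse_def)
    fix f f' assume ff: "f \<in> B'" "f' \<in> B'"
    then have U: "f \<in> univ ?P'" "f' \<in> univ ?P'" "T f \<in> B" "T f' \<in> B" by (auto simp: B'_def)
    show "meet ?P' f f' \<in> B'" "join ?P' f f' \<in> B'" "imp ?P' f f' \<in> B'"
      using U B cl[OF U(1,2)] T[OF U(1,2)] unfolding B'_def subuniverse_def by auto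
  next
    fix f assume "f \<in> B'"
    then have U: "f \<in> univ ?P'" "T f \<in> B" by (auto simp: B'_def)
    show "neg ?P' f \<in> B'" using U B cl[OF U(1,1)] T[OF U(1,1)] unfolding B'_def subuniverse_def by auto
  qed (auto simp: B'_def)
  define h where "h = (\<lambda>f\<in>B'. the_inv_into (univ A) k (T f))"
  have hk: "h f = a" if "f \<in> B'" "a \<in> univ A" "k a = T f" for f a
    using kb that the_inv_into_f_f[of k "univ A" a] by (simp add: h_def bij_betw_def)
  have ex: "\<exists>a\<in>univ A. k a = T f \<and> h f = a" if "f \<in> B'" for f
  proof -
    have "T f \<in> k ` univ A" using kb TB that by (auto simp: bij_betw_def)
    then show ?thesis using hk[OF that] by (metis imageE)
  qed
  have "h \<in> alg_hom (subalg ?P' B') A"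
  proof (rule alg_homI)
    show "h f \<in> univ A" if "f \<in> univ (subalg ?P' B')" for f using ex[of f] that by auto
    show "h \<in> extensional (univ (subalg ?P' B'))" by (simp add: h_def)
    show "h (neg (subalg ?P' B') f) = neg A (h f)" if "f \<in> univ (subalg ?P' B')" for f
    proof -
      have f: "f \<in> B'" "f \<in> univ ?P'" using that by (auto simp: B'_def)
      obtain a where a: "a \<in> univ A" "k a = T f" "h f = a" using ex[OF f(1)] by blast
      have "neg ?P' f \<in> B'" using B' f(1) by (simp add: subuniverse_def)
      then show ?thesis
        using hk[of "neg ?P' f" "neg A a"] salgebra_closed(1)[OF A a(1,1)] alg_homD(1)[OF kh a(1,1)]
          T(1)[OF f(2,2)] a by (simp del: prod_alg_simps)
    qed
    fix f f' assume "f \<in> univ (subalg ?P' B')" "f' \<in> univ (subalg ?P' B')"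
    then have f: "f \<in> B'" "f \<in> univ ?P'" "f' \<in> B'" "f' \<in> univ ?P'" by (auto simp: B'_def)
    obtain a where a: "a \<in> univ A" "k a = T f" "h f = a" using ex[OF f(1)] by blast
    obtain a' where a': "a' \<in> univ A" "k a' = T f'" "h f' = a'" using ex[OF f(3)] by blast
    have "meet ?P' f f' \<in> B'" "join ?P' f f' \<in> B'" "imp ?P' f f' \<in> B'"
      using B' f by (simp_all add: subuniverse_def)
    then show "h (meet (subalg ?P' B') f f') = meet A (h f) (h f')"
      "h (join (subalg ?P' B') f f') = join A (h f) (h f')"
      "h (imp (subalg ?P' B') f f') = imp A (h f) (h f')"
      using hk[of "meet ?P' f f'" "meet A a a'"] hk[of "join ?P' f f'" "join A a a'"]
        hk[of "imp ?P' f f'" "imp A a a'"] salgebra_closed[OF A a(1) a'(1)] alg_homD[OF kh a(1) a'(1)]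
        T[OF f(2,4)] a a' by (simp_all del: prod_alg_simps)
  qed
  moreover have "h ` B' = univ A"
  proof
    show "h ` B' \<subseteq> univ A" using ex by blast
    show "univ A \<subseteq> h ` B'"
    proof
      fix a assume a: "a \<in> univ A"
      then have "k a \<in> T ` B'" using kb TB by (auto simp: bij_betw_def)
      then obtain f where "f \<in> B'" "k a = T f" by blast
      then show "a \<in> h ` B'" using hk[OF _ a] by blast
    qed
  qed
  moreover have "(\<lambda>_. Z) ` I \<subseteq> {Z}" by auto
  ultimately show "A \<in> HSP {Z}" using HSP_I[OF A _ _ B'] Z by blast
qed

lemma salgebra_sort_alg: "m \<ge> 2 \<Longrightarrow> salgebra (sort_alg m s)"
  unfolding salgebra_def
proof (rule chain_subuniverse)
  assume m: "m \<ge> 2"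
  then have "1 \<in> univ (sort_alg m s)" unfolding mem_sort_alg[OF m] by (simp add: bound_def)
  then show "univ (sort_alg m s) \<noteq> {}" by blast
qed (simp_all add: mem_sort_alg)

lemma HSP_eq_ISP:
  assumes m: "m \<ge> 2"
  shows "(HSP {Z_alg (2 * m)} :: 'a salg set) = ISP {Z_alg (2 * m), Z_alg (2 * m - 1)}"
proof
  show "ISP {Z_alg (2 * m), Z_alg (2 * m - 1)} \<subseteq> (HSP {Z_alg (2 * m)} :: 'a salg set)"
  proof (rule ISP_subset_HSP)
    show "salgebra (Z_alg (2 * m))" using salgebra_sort_alg[OF m, of Q] by simp
    fix N assume "N \<in> {Z_alg (2 * m), Z_alg (2 * m - 1)}"
    then consider "N = Z_alg (2 * m)" | "N = Z_alg (2 * m - 1)" by blast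
    then show "\<exists>g\<in>alg_hom (Z_alg (2 * m)) N. g ` univ (Z_alg (2 * m)) = univ N"
    proof cases
      case 1
      have "(\<lambda>a\<in>univ (Z_alg (2 * m)). a) \<in> alg_hom (Z_alg (2 * m)) N"
        using salgebra_closed[OF salgebra_sort_alg[OF m, of Q]] 1 by (intro alg_homI) auto
      then show ?thesis using 1 by (intro bexI[of _ "\<lambda>a\<in>univ (Z_alg (2 * m)). a"]) auto
    next
      case 2
      \<comment> \<open>Identifying 1 with -1 maps the even chain onto the odd chain with one
        element fewer.\<close>
      let ?g = "restrict shrink (univ (sort_alg m Q))"
      have "?g \<in> alg_hom (subalg (sort_alg m Q) (univ (sort_alg m Q))) (sort_alg m Pm)"
        using op_fun_hom[OF m, of Uop] by (simp del: sort_alg.simps)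
      then have "?g \<in> alg_hom (sort_alg m Q) (sort_alg m Pm)"
        unfolding subalg_univ .
      moreover from this have "?g ` univ (sort_alg m Q) \<subseteq> univ (sort_alg m Pm)"
        by (intro image_subsetI hom_mem[of ?g "sort_alg m Q" "sort_alg m Pm"])
      moreover have "univ (sort_alg m Pm) \<subseteq> ?g ` univ (sort_alg m Q)"
      proof
        fix p assume "p \<in> univ (sort_alg m Pm)"
        then have "(if 0 \<le> p then p + 1 else p - 1) \<in> univ (sort_alg m Q)"
          unfolding mem_sort_alg[OF m] by (auto simp: bound_def)
        moreover have "shrink (if 0 \<le> p then p + 1 else p - 1) = p" by (simp add: shrink_def)
        ultimately show "p \<in> ?g ` univ (sort_alg m Q)"
          by (intro image_eqI[of _ _ "if 0 \<le> p then p + 1 else p - 1"]) (simp_all del: sort_alg.simps)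
      qed
      ultimately have "\<exists>g\<in>alg_hom (sort_alg m Q) (sort_alg m Pm). g ` univ (sort_alg m Q) = univ (sort_alg m Pm)"
        by blast
      then show ?thesis unfolding sort_alg.simps 2 .
    qed
  qed
qed (rule HSP_subset_ISP[OF m])


section \<open>Morphisms and embeddings\<close>

lemma mor_iff:
  "\<phi> \<in> mor \<Sigma> X Y \<longleftrightarrow> (\<forall>s. \<phi> s \<in> extensional (pts X s)) \<and>
     (\<forall>s. continuous_map (stop X s) (stop Y s) (\<phi> s)) \<and>
     (\<forall>r\<in>gops \<Sigma> \<union> hops \<Sigma>. \<forall>x\<in>odom X r.
        \<phi> (src \<Sigma> r) x \<in> odom Y r \<and> \<phi> (tgt \<Sigma> r) (oapp X r x) = oapp Y r (\<phi> (src \<Sigma> r) x)) \<and>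
     (\<forall>k\<in>kops \<Sigma>. \<phi> (csort \<Sigma> k) (cval X k) = cval Y k)"
proof -
  have "(\<forall>s. \<phi> s \<in> pts X s \<rightarrow>\<^sub>E pts Y s) \<and>
      continuous_map (total_space X) (total_space Y) (\<lambda>(i, x). (i, \<phi> i x)) \<longleftrightarrow>
    (\<forall>s. \<phi> s \<in> extensional (pts X s)) \<and> (\<forall>s. continuous_map (stop X s) (stop Y s) (\<phi> s))"
    (is "?L1 \<and> ?L2 \<longleftrightarrow> ?R1 \<and> ?R2")
  proof (intro iffI conjI)
    assume L: "?L1 \<and> ?L2"
    then show ?R1 by (auto simp: PiE_def)
    have "\<phi> i \<in> pts X i \<rightarrow> pts Y i" for i using L by (auto simp: PiE_def)
    from continuous_map_total_space[of \<phi> X Y, OF this] L show ?R2 by simp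
  next
    assume R: "?R1 \<and> ?R2"
    then have *: "\<phi> i \<in> pts X i \<rightarrow> pts Y i" for i by (simp add: continuous_map_def)
    then show ?L1 using R by (simp add: PiE_def)
    from continuous_map_total_space[of \<phi> X Y, OF *] R show ?L2 by simp
  qed
  then show ?thesis unfolding mor_def by blast
qed

lemma mor_pts: "\<phi> \<in> mor \<Sigma> X Y \<Longrightarrow> x \<in> pts X s \<Longrightarrow> \<phi> s x \<in> pts Y s"
  by (auto simp: mor_def)

lemma mor_cont: "\<phi> \<in> mor \<Sigma> X Y \<Longrightarrow> continuous_map (stop X s) (stop Y s) (\<phi> s)"
  by (simp add: mor_iff)

lemma mor_op:
  assumes "\<phi> \<in> mor \<Sigma> X Y" "r \<in> gops \<Sigma> \<union> hops \<Sigma>" "x \<in> odom X r"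
  shows "\<phi> (src \<Sigma> r) x \<in> odom Y r" "\<phi> (tgt \<Sigma> r) (oapp X r x) = oapp Y r (\<phi> (src \<Sigma> r) x)"
  using assms unfolding mor_def by blast+

lemma mor_const: "\<phi> \<in> mor \<Sigma> X Y \<Longrightarrow> k \<in> kops \<Sigma> \<Longrightarrow> \<phi> (csort \<Sigma> k) (cval X k) = cval Y k"
  by (simp add: mor_iff)

lemma mstructure_pts:
  assumes "mstructure \<Sigma> X" "r \<in> gops \<Sigma> \<union> hops \<Sigma>" "x \<in> odom X r"
  shows "x \<in> pts X (src \<Sigma> r)" "oapp X r x \<in> pts X (tgt \<Sigma> r)"
  using assms by (auto simp: mstructure_def)

lemma mor_comp:
  assumes X: "mstructure \<Sigma> X" and \<phi>: "\<phi> \<in> mor \<Sigma> X Y" and \<psi>: "\<psi> \<in> mor \<Sigma> Y Z"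
  shows "(\<lambda>s. \<lambda>x\<in>pts X s. \<psi> s (\<phi> s x)) \<in> mor \<Sigma> X Z"
  unfolding mor_iff
proof (intro conjI allI ballI)
  show "continuous_map (stop X s) (stop Z s) (\<lambda>x\<in>pts X s. \<psi> s (\<phi> s x))" for s
    using continuous_map_compose[OF mor_cont[OF \<phi>] mor_cont[OF \<psi>], of s]
    by (rule continuous_map_eq) simp
next
  fix r x assume r: "r \<in> gops \<Sigma> \<union> hops \<Sigma>" and x: "x \<in> odom X r"
  note * = mor_op[OF \<phi> r x] and p = mstructure_pts[OF X r x]
  show "(\<lambda>x\<in>pts X (src \<Sigma> r). \<psi> (src \<Sigma> r) (\<phi> (src \<Sigma> r) x)) x \<in> odom Z r"
    "(\<lambda>x\<in>pts X (tgt \<Sigma> r). \<psi> (tgt \<Sigma> r) (\<phi> (tgt \<Sigma> r) x)) (oapp X r x) =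
       oapp Z r ((\<lambda>x\<in>pts X (src \<Sigma> r). \<psi> (src \<Sigma> r) (\<phi> (src \<Sigma> r) x)) x)"
    using mor_op[OF \<psi> r *(1)] *(2) p by simp_all
next
  fix k assume "k \<in> kops \<Sigma>"
  then show "(\<lambda>x\<in>pts X (csort \<Sigma> k). \<psi> (csort \<Sigma> k) (\<phi> (csort \<Sigma> k) x)) (cval X k) = cval Z k"
    using mor_const[OF \<phi>] mor_const[OF \<psi>] X by (simp add: mstructure_def)
qed simp

text \<open>The third conclusion is where partial operations matter: a morphism preserves domains,
  while an embedding also reflects them, because its inverse on the image is a morphism.\<close>

lemma embeddingD:
  assumes X: "mstructure \<Sigma> X" and "\<epsilon> \<in> embedding \<Sigma> X Y"
  shows embedding_mor: "\<epsilon> \<in> mor \<Sigma> X Y"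
    and embedding_inj: "\<And>s x y. x \<in> pts X s \<Longrightarrow> y \<in> pts X s \<Longrightarrow> \<epsilon> s x = \<epsilon> s y \<Longrightarrow> x = y"
    and embedding_odom: "\<And>r x. r \<in> gops \<Sigma> \<union> hops \<Sigma> \<Longrightarrow> x \<in> pts X (src \<Sigma> r) \<Longrightarrow>
      \<epsilon> (src \<Sigma> r) x \<in> odom Y r \<Longrightarrow> x \<in> odom X r"
proof -
  obtain C where e: "\<epsilon> \<in> mor_iso \<Sigma> X (substruct \<Sigma> Y C)" using assms(2) by (auto simp: embedding_def)
  then have em: "\<epsilon> \<in> mor \<Sigma> X (substruct \<Sigma> Y C)" by (simp add: mor_iso_def)
  obtain d where d: "d \<in> mor \<Sigma> (substruct \<Sigma> Y C) X" "\<And>s x. x \<in> pts X s \<Longrightarrow> d s (\<epsilon> s x) = x"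
    using e by (auto simp: mor_iso_def)
  have *: "odom (substruct \<Sigma> Y C) r = odom Y r \<inter> C (src \<Sigma> r)" "oapp (substruct \<Sigma> Y C) = oapp Y"
    "cval (substruct \<Sigma> Y C) = cval Y" "stop (substruct \<Sigma> Y C) s = subtopology (stop Y s) (C s)" for r s
    by (simp_all add: substruct_def)
  show "\<epsilon> \<in> mor \<Sigma> X Y"
    unfolding mor_iff
  proof (intro conjI allI ballI)
    show "\<epsilon> s \<in> extensional (pts X s)" for s using em unfolding mor_iff by blast
    show "continuous_map (stop X s) (stop Y s) (\<epsilon> s)" for s
      using mor_cont[OF em, of s] unfolding * by (simp add: continuous_map_in_subtopology)
  next
    fix r x assume rx: "r \<in> gops \<Sigma> \<union> hops \<Sigma>" "x \<in> odom X r"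
    show "\<epsilon> (src \<Sigma> r) x \<in> odom Y r" "\<epsilon> (tgt \<Sigma> r) (oapp X r x) = oapp Y r (\<epsilon> (src \<Sigma> r) x)"
      using mor_op[OF em rx] unfolding * by blast+
  next
    fix k assume "k \<in> kops \<Sigma>"
    then show "\<epsilon> (csort \<Sigma> k) (cval X k) = cval Y k" using mor_const[OF em, of k] unfolding * by blast
  qed
  show "x = y" if "x \<in> pts X s" "y \<in> pts X s" "\<epsilon> s x = \<epsilon> s y" for s x y
    using d(2)[OF that(1)] unfolding that(3) d(2)[OF that(2)] by (rule sym)
  show "x \<in> odom X r"
    if r: "r \<in> gops \<Sigma> \<union> hops \<Sigma>" and x: "x \<in> pts X (src \<Sigma> r)" "\<epsilon> (src \<Sigma> r) x \<in> odom Y r" for r x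
  proof -
    have "\<epsilon> (src \<Sigma> r) x \<in> C (src \<Sigma> r)" using mor_pts[OF em x(1)] by (simp add: *)
    then have "\<epsilon> (src \<Sigma> r) x \<in> odom (substruct \<Sigma> Y C) r" using x(2) by (simp add: *)
    from mor_op(1)[OF d(1) r this] show ?thesis using d(2)[OF x(1)] by simp
  qed
qed

text \<open>The nullary symbol \<open>k\<close> excludes the structure with all sorts empty, so
  \<open>X\<close> embeds into a power with non-empty index set. The coordinates of this embedding
  are morphisms into \<open>M\<close>; they separate points and detect domains because the power is
  defined pointwise.\<close>

lemma IScPD:
  fixes X :: "('s, 'x, 'r, 'k) mstruct" and M :: "('s, 'm, 'r, 'k) mstruct"
  assumes X: "X \<in> IScP \<Sigma> M" and k: "k \<in> kops \<Sigma>"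
  shows IScP_mstructure: "mstructure \<Sigma> X"
    and IScP_mor: "mor \<Sigma> X M \<noteq> {}"
    and IScP_separated: "\<And>s x y. x \<in> pts X s \<Longrightarrow> y \<in> pts X s \<Longrightarrow>
      (\<And>\<phi>. \<phi> \<in> mor \<Sigma> X M \<Longrightarrow> \<phi> s x = \<phi> s y) \<Longrightarrow> x = y"
    and IScP_odom: "\<And>r x. r \<in> gops \<Sigma> \<union> hops \<Sigma> \<Longrightarrow> x \<in> pts X (src \<Sigma> r) \<Longrightarrow>
      (\<And>\<phi>. \<phi> \<in> mor \<Sigma> X M \<Longrightarrow> \<phi> (src \<Sigma> r) x \<in> odom M r) \<Longrightarrow> x \<in> odom X r"
proof -
  show Xm: "mstructure \<Sigma> X" using X by (simp add: IScP_def)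
  then have "cval X k \<in> pts X (csort \<Sigma> k)" using k by (simp add: mstructure_def)
  then have ne: "\<not> (\<forall>i. pts X i = {})" by blast
  have "(\<forall>i. pts X i = {}) \<or>
      (\<exists>S :: ('s \<Rightarrow> 'x \<Rightarrow> 'm) set. S \<noteq> {} \<and> embedding \<Sigma> X (power_struct \<Sigma> M S) \<noteq> {})"
    using X unfolding IScP_def mem_Collect_eq by (rule conjunct2)
  then obtain S :: "('s \<Rightarrow> 'x \<Rightarrow> 'm) set" where S: "S \<noteq> {}" and "embedding \<Sigma> X (power_struct \<Sigma> M S) \<noteq> {}"
    unfolding eq_False[THEN iffD2, OF ne] simp_thms by (elim exE conjE)
  then obtain e where e: "e \<in> embedding \<Sigma> X (power_struct \<Sigma> M S)" unfolding ex_in_conv[symmetric] by (elim exE)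
  note em = embedding_mor[OF Xm e]
  have P: "stop (power_struct \<Sigma> M S) s = product_topology (\<lambda>_. stop M s) S"
    "odom (power_struct \<Sigma> M S) r = {x \<in> S \<rightarrow>\<^sub>E pts M (src \<Sigma> r). \<forall>s\<in>S. x s \<in> odom M r}"
    "oapp (power_struct \<Sigma> M S) r y = (\<lambda>s\<in>S. oapp M r (y s))"
    "cval (power_struct \<Sigma> M S) k = (\<lambda>s\<in>S. cval M k)" for s r y k
    by (simp_all add: power_struct_def)
  define p where "p t = (\<lambda>s. \<lambda>x\<in>pts X s. e s x t)" for t
  have p: "p t \<in> mor \<Sigma> X M" if t: "t \<in> S" for t
    unfolding mor_iff
  proof (intro conjI allI ballI)
    show "p t s \<in> extensional (pts X s)" for s by (simp add: p_def)
    show "continuous_map (stop X s) (stop M s) (p t s)" for s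
    proof -
      have "continuous_map (stop X s) (stop M s) (\<lambda>x. e s x t)"
        using mor_cont[OF em, of s] t unfolding P by (simp add: continuous_map_componentwise)
      then show ?thesis by (rule continuous_map_eq) (simp add: p_def)
    qed
  next
    fix r x assume r: "r \<in> gops \<Sigma> \<union> hops \<Sigma>" and x: "x \<in> odom X r"
    show "p t (src \<Sigma> r) x \<in> odom M r" "p t (tgt \<Sigma> r) (oapp X r x) = oapp M r (p t (src \<Sigma> r) x)"
      using mor_op[OF em r x] mstructure_pts[OF Xm r x] t unfolding P by (simp_all add: p_def)
  next
    fix k assume k: "k \<in> kops \<Sigma>"
    then show "p t (csort \<Sigma> k) (cval X k) = cval M k"
      using mor_const[OF em k] Xm t unfolding P by (simp add: p_def mstructure_def)
  qed
  then show "mor \<Sigma> X M \<noteq> {}" using S by blast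
  have eS: "e s x \<in> S \<rightarrow>\<^sub>E pts M s" if "x \<in> pts X s" for s x
    using mor_pts[OF em that] unfolding P by simp
  show "x = y" if xy: "x \<in> pts X s" "y \<in> pts X s" "\<And>\<phi>. \<phi> \<in> mor \<Sigma> X M \<Longrightarrow> \<phi> s x = \<phi> s y" for s x y
  proof (rule embedding_inj[OF Xm e xy(1,2)])
    show "e s x = e s y"
    proof (rule PiE_ext[OF eS[OF xy(1)] eS[OF xy(2)]])
      show "e s x t = e s y t" if "t \<in> S" for t using xy(3)[OF p[OF that]] xy(1,2) by (simp add: p_def)
    qed
  qed
  show "x \<in> odom X r"
    if r: "r \<in> gops \<Sigma> \<union> hops \<Sigma>" and x: "x \<in> pts X (src \<Sigma> r)"
      and \<phi>: "\<And>\<phi>. \<phi> \<in> mor \<Sigma> X M \<Longrightarrow> \<phi> (src \<Sigma> r) x \<in> odom M r" for r x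
  proof (rule embedding_odom[OF Xm e r x])
    have "e (src \<Sigma> r) x t \<in> odom M r" if "t \<in> S" for t using \<phi>[OF p[OF that]] x by (simp add: p_def)
    then show "e (src \<Sigma> r) x \<in> odom (power_struct \<Sigma> M S) r" using eS[OF x] unfolding P by simp
  qed
qed


section \<open>The alter ego\<close>

lemma sug_alter_ego: "m \<ge> 2 \<Longrightarrow> alter_ego (sug_sig m) (sort_alg m) (sug_alter_ego m)"
  unfolding alter_ego_def
proof (intro conjI allI ballI)
  assume m: "m \<ge> 2"
  show "finite (UNIV :: sort set)" by (simp add: UNIV_sort)
  show "salgebra (sort_alg m s)" for s by (rule salgebra_sort_alg[OF m])
  show "finite (univ (sort_alg m s))" for s by (rule finite_univ_sort_alg)
  show "odom (sug_alter_ego m) r = univ (sort_alg m (src (sug_sig m) r))" if "r \<in> gops (sug_sig m)" for r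
    using that by auto
  show "subuniverse (odom (sug_alter_ego m) r) (sort_alg m (src (sug_sig m) r))"
    "restrict (oapp (sug_alter_ego m) r) (odom (sug_alter_ego m) r) \<in>
      alg_hom (subalg (sort_alg m (src (sug_sig m) r)) (odom (sug_alter_ego m) r)) (sort_alg m (tgt (sug_sig m) r))"
    if "r \<in> gops (sug_sig m) \<union> hops (sug_sig m)" for r
    using op_dom_subuniverse[OF m that] op_fun_hom[OF m that]
    by (simp_all only: sug_alter_ego_simps sug_sig_simps)
  show "subuniverse {cval (sug_alter_ego m) k} (sort_alg m (csort (sug_sig m) k))" for k
    by (rule chain_subuniverse) (use mem_sort_alg[OF m, of 0 Pm] m in \<open>auto simp: bound_def\<close>)
qed simp_all

section \<open>The dual of an algebra and the morphisms from it into the alter ego\<close>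

abbreviation sdual :: "nat \<Rightarrow> 'a salg \<Rightarrow> (sort, 'a \<Rightarrow> int, opsym, constsym) mstruct" where
  "sdual m A \<equiv> Dual (sug_sig m) (sort_alg m) (sug_alter_ego m) A"

abbreviation sedual :: "nat \<Rightarrow> (sort, 'x, opsym, constsym) mstruct \<Rightarrow> (sort \<Rightarrow> 'x \<Rightarrow> int) salg" where
  "sedual m X \<equiv> Edual (sug_sig m) (sort_alg m) (sug_alter_ego m) X"

lemma sdual_simps:
  "stop (sdual m A) s = subtopology (hom_topology A (sort_alg m s)) (alg_hom A (sort_alg m s))"
  "odom (sdual m A) r = {x \<in> alg_hom A (sort_alg m (op_src r)). \<forall>a\<in>univ A. x a \<in> op_dom m r}"
  "oapp (sdual m A) r x = (\<lambda>a\<in>univ A. op_fun m r (x a))"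
  "cval (sdual m A) k = (\<lambda>a\<in>univ A. 0)"
  by (auto simp: Dual_def substruct_def power_struct_def alg_hom_def simp del: sort_alg.simps)

lemma sdual_pts: "pts (sdual m A) s = alg_hom A (sort_alg m s)"
  unfolding sdual_simps by (auto simp: alg_hom_def)

text \<open>Strict signs may be lost under \<open>shrink\<close>, but both weak ones survive. This
  is the invariant that a morphism carries along a generation.\<close>

lemma op_fun_sgn:
  assumes m: "m \<ge> 2" and r: "r \<in> gops (sug_sig m) \<union> hops (sug_sig m)" and p: "p \<in> op_dom m r"
  shows "(0 \<le> p \<longrightarrow> 0 \<le> op_fun m r p) \<and> (p \<le> 0 \<longrightarrow> op_fun m r p \<le> 0)"
proof (cases "r = Vop")
  case True
  then show ?thesis using Vop_fun[OF m, of p] p by auto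
next
  case False
  then show ?thesis using r by (cases r) (auto simp: shrink_def raise_def)
qed

context
  fixes m :: nat and A :: "'a salg" and \<phi> :: "sort \<Rightarrow> ('a \<Rightarrow> int) \<Rightarrow> int"
  assumes m: "m \<ge> 2" and A: "salgebra A"
    and \<phi>: "\<phi> \<in> mor (sug_sig m) (sdual m A) (sug_alter_ego m)"
begin

lemma dual_mor_mem: "x \<in> alg_hom A (sort_alg m s) \<Longrightarrow> \<phi> s x \<in> univ (sort_alg m s)"
  using mor_pts[OF \<phi>, of x s] by (simp add: sdual_pts)

lemma dual_mor_op:
  assumes "r \<in> gops (sug_sig m) \<union> hops (sug_sig m)" "x \<in> alg_hom A (sort_alg m (op_src r))"
    "\<And>a. a \<in> univ A \<Longrightarrow> x a \<in> op_dom m r"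
  shows "\<phi> (op_src r) x \<in> op_dom m r"
    "\<phi> (op_tgt r) (\<lambda>a\<in>univ A. op_fun m r (x a)) = op_fun m r (\<phi> (op_src r) x)"
  using mor_op[OF \<phi> assms(1), of x] assms(2,3) by (simp_all add: sdual_simps)

lemma dual_mor_zero: "\<phi> Pm (\<lambda>a\<in>univ A. 0) = 0"
  using mor_const[OF \<phi>, of Zero_Pm] by (simp add: sdual_simps)

lemma dual_mor_zero': "(\<lambda>a\<in>univ A. 0) \<in> alg_hom A (sort_alg m Pp)" "\<phi> Pp (\<lambda>a\<in>univ A. 0) = 0"
proof -
  have z: "(\<lambda>a\<in>univ A. 0) \<in> alg_hom A (sort_alg m Pm)" by (rule zero_hom[OF m A])
  then show "(\<lambda>a\<in>univ A. 0) \<in> alg_hom A (sort_alg m Pp)" by simp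
  have "(0::int) \<in> op_dom m IdMP"
    using mem_sort_alg[OF m, of 0 Pm] m by (simp add: bound_def)
  then show "\<phi> Pp (\<lambda>a\<in>univ A. 0) = 0"
    using dual_mor_op(2)[of IdMP "\<lambda>a\<in>univ A. 0"] z dual_mor_zero by (simp cong: restrict_cong)
qed

text \<open>The homomorphisms to which the signs of \<open>\<phi> i x\<close> pass form a family
  closed under the operations, since \<open>\<phi>\<close> commutes with these and they keep weak
  signs. The family contains \<open>x\<close>, hence by generation also \<open>y\<close>.\<close>

lemma dual_mor_sgn:
  assumes x: "x \<in> alg_hom A (sort_alg m i)" and y: "y \<in> alg_hom A (sort_alg m j)"
    and xy: "\<And>a. a \<in> univ A \<Longrightarrow> 0 \<le> x a \<Longrightarrow> 0 \<le> y a"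
  shows "(0 \<le> \<phi> i x \<longrightarrow> 0 \<le> \<phi> j y) \<and> (\<phi> i x \<le> 0 \<longrightarrow> \<phi> j y \<le> 0)"
proof -
  define R where "R s = {y \<in> alg_hom A (sort_alg m s).
    (0 \<le> \<phi> i x \<longrightarrow> 0 \<le> \<phi> s y) \<and> (\<phi> i x \<le> 0 \<longrightarrow> \<phi> s y \<le> 0)}" for s
  have "op_closed m (univ A) R"
    unfolding op_closed_def
  proof (intro ballI impI)
    fix r z assume r: "r \<in> gops (sug_sig m) \<union> hops (sug_sig m)" and z: "z \<in> R (op_src r)"
      "\<forall>a\<in>univ A. z a \<in> op_dom m r"
    have zh: "z \<in> alg_hom A (sort_alg m (op_src r))" using z(1) by (simp add: R_def)
    have "(\<lambda>a\<in>univ A. op_fun m r (z a)) \<in> alg_hom A (sort_alg m (op_tgt r))"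
      using op_closedD[OF alg_hom_op_closed[OF m A] r zh] z(2) by blast
    moreover have "\<phi> (op_src r) z \<in> op_dom m r"
      "\<phi> (op_tgt r) (\<lambda>a\<in>univ A. op_fun m r (z a)) = op_fun m r (\<phi> (op_src r) z)"
      using dual_mor_op[OF r zh] z(2) by blast+
    ultimately show "(\<lambda>a\<in>univ A. op_fun m r (z a)) \<in> R (op_tgt r)"
      using op_fun_sgn[OF m r, of "\<phi> (op_src r) z"] z(1) by (auto simp: R_def simp del: restrict_apply)
  qed
  moreover have "x \<in> R i" using x by (simp add: R_def)
  ultimately have "y \<in> R j" using hom_closed[OF m A _ _ x y xy] by blast
  then show ?thesis by (simp add: R_def)
qed

text \<open>Avoiding 0 is a domain condition: a homomorphism into \<open>Pm\<close> without the
  value 0 lies in the domain of \<open>Vop\<close>, and morphisms preserve domains.\<close>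

lemma dual_mor_nonzero:
  assumes x: "x \<in> alg_hom A (sort_alg m s)" and nz: "\<And>a. a \<in> univ A \<Longrightarrow> x a \<noteq> 0"
  shows "\<phi> s x \<noteq> 0"
proof -
  have Pm: "\<phi> Pm x \<noteq> 0" if x: "x \<in> alg_hom A (sort_alg m Pm)"
    using dual_mor_op(1)[of Vop x] x nz hom_mem[OF x] by auto
  show ?thesis
  proof (cases s)
    case Pp
    have "(\<lambda>a\<in>univ A. op_fun m IdPM (x a)) = x"
      using hom_ext[OF x] by (simp add: extensional_restrict)
    then have "\<phi> Pm x = \<phi> Pp x"
      using dual_mor_op(2)[of IdPM x] x hom_mem[OF x] Pp by simp
    then show ?thesis using Pm x Pp by simp
  next
    case Q
    then show ?thesis using dual_mor_mem[OF x] mem_sort_alg[OF m, of _ Q] by auto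
  qed (use Pm x in simp)
qed

text \<open>Inclusion of the prime filters gives the sign condition from \<open>x\<close> to
  \<open>y\<close> unless \<open>x\<close> has sort \<open>Pp\<close>. From \<open>Pp\<close> to
  \<open>Pp\<close> or \<open>Q\<close> it gives the reverse condition, which is used
  contrapositively; from \<open>Pp\<close> to \<open>Pm\<close> one of the two must hold.\<close>

lemma dual_mor_carrier_mono:
  assumes x: "x \<in> alg_hom A (sort_alg m i)" and y: "y \<in> alg_hom A (sort_alg m j)"
    and xy: "\<And>a. a \<in> univ A \<Longrightarrow> carrier_map i (x a) \<Longrightarrow> carrier_map j (y a)"
    and c: "carrier_map i (\<phi> i x)"
  shows "carrier_map j (\<phi> j y)"
proof -
  note cl = salgebra_closed[OF A] and ox = hom_ops[OF x] and oy = hom_ops[OF y]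
  have neg: "carrier_map i (- x a) \<Longrightarrow> carrier_map j (- y a)" if "a \<in> univ A" for a
    using xy[OF cl(1)[OF that that]] ox(1)[OF that that] oy(1)[OF that that] by simp
  have nzx: "i = Q \<Longrightarrow> x a \<noteq> 0" if "a \<in> univ A" for a
    using hom_mem[OF x that] unfolding mem_sort_alg[OF m] by simp
  have nzy: "j = Q \<Longrightarrow> y a \<noteq> 0" if "a \<in> univ A" for a
    using hom_mem[OF y that] unfolding mem_sort_alg[OF m] by simp
  have \<phi>Q: "i = Q \<Longrightarrow> \<phi> i x \<noteq> 0" "j = Q \<Longrightarrow> \<phi> j y \<noteq> 0"
    using dual_mor_nonzero[OF x] dual_mor_nonzero[OF y] nzx nzy by blast+
  consider "i \<noteq> Pp" | "i = Pp" "j \<noteq> Pm" | "i = Pp" "j = Pm" by blast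
  then show ?thesis
  proof cases
    case 1
    have "0 \<le> y a" if "a \<in> univ A" "0 \<le> x a" for a
      using xy[OF that(1)] nzx[OF that(1)] that(2) 1 by (cases i; cases j) auto
    then have ge: "0 \<le> \<phi> j y" using dual_mor_sgn[OF x y] c 1 by (cases i) auto
    show ?thesis
    proof (cases j)
      case Pp
      \<comment> \<open>For sorts other than \<open>Pp\<close>, the carrier accepts each value or
        its negative, so \<open>y\<close> takes a value of at least 1 at \<open>a\<close> or at its
        negation. This excludes 0 and sharpens \<open>ge\<close> to what the carrier of
        \<open>Pp\<close> asks for.\<close>
      have "y a \<noteq> 0" if "a \<in> univ A" for a
      proof -
        have "carrier_map i (x a) \<longrightarrow> carrier_map j (y a)" "carrier_map i (- x a) \<longrightarrow> carrier_map j (- y a)"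
          using xy[OF that] neg[OF that] by blast+
        then show ?thesis using nzx[OF that] 1 Pp by (cases i) auto
      qed
      then show ?thesis using dual_mor_nonzero[OF y] ge Pp by force
    qed (use ge \<phi>Q in auto)
  next
    case 2
    have "0 \<le> x a" if "a \<in> univ A" "0 \<le> y a" for a
      by (rule ccontr) (use neg[OF that(1)] that(2) 2 in \<open>cases j; auto\<close>)
    then show ?thesis using dual_mor_sgn[OF y x] c 2 by (cases j) auto
  next
    case 3
    have opp: "\<not> (0 < x a \<and> y a < 0)" if "a \<in> univ A" for a using xy[OF that] 3 by auto
    show ?thesis
    proof (cases "\<forall>a\<in>univ A. 0 \<le> x a \<longrightarrow> 0 \<le> y a")
      case True
      then show ?thesis using dual_mor_sgn[OF x y] c 3 by auto
    next
      case False
      then obtain a where a: "a \<in> univ A" "x a = 0" "y a < 0" using opp by force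
      have "0 \<le> x b" if b: "b \<in> univ A" "0 \<le> y b" for b
      proof (rule ccontr)
        assume "\<not> 0 \<le> x b"
        then have xb: "x b < 0" "y b = 0"
          using opp[OF cl(1)[OF b(1) b(1)]] ox(1)[OF b(1) b(1)] oy(1)[OF b(1) b(1)] b(2) by auto
        let ?b = "neg A b" and ?a = "neg A a"
        have ab: "?a \<in> univ A" "?b \<in> univ A" using cl(1) a(1) b(1) by blast+
        have v: "x ?b > 0" "y ?b = 0" "x ?a = 0" "y ?a > 0"
          using ox(1)[OF b(1) b(1)] oy(1)[OF b(1) b(1)] ox(1)[OF a(1) a(1)] oy(1)[OF a(1) a(1)] a xb by auto
        \<comment> \<open>\<open>?b\<close> and \<open>?a\<close> witness that both conditions fail.
          Each has one value 0 and one positive value, in different places; the implication makes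
          strictly opposite signs of them, and its negation contradicts \<open>opp\<close>.\<close>
        let ?c = "imp A ?b ?a"
        have "x ?c < 0" "y ?c > 0"
          using ox(4)[OF ab(2,1)] oy(4)[OF ab(2,1)] v by auto
        then show False
          using opp[OF cl(1)[OF cl(4)[OF ab(2,1)] a(1)]] ox(1)[OF cl(4)[OF ab(2,1)] a(1)]
            oy(1)[OF cl(4)[OF ab(2,1)] a(1)] by simp
      qed
      then show ?thesis using dual_mor_sgn[OF y x] c 3 by auto
    qed
  qed
qed

lemma compactin_dual_mor_preimage:
  "compactin (hom_topology A (sort_alg m s)) {x \<in> alg_hom A (sort_alg m s). P (\<phi> s x)}"
proof -
  let ?H = "alg_hom A (sort_alg m s)"
  have "compact_space (subtopology (hom_topology A (sort_alg m s)) ?H)"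
    using compactin_alg_hom[OF A finite_univ_sort_alg] by (rule compact_space_subtopology)
  moreover have "closedin (stop (sdual m A) s) {x \<in> pts (sdual m A) s. \<phi> s x \<in> {p \<in> univ (sort_alg m s). P p}}"
    by (rule closedin_continuous_map_preimage[OF mor_cont[OF \<phi>]]) (simp del: sort_alg.simps)
  moreover have "{x \<in> pts (sdual m A) s. \<phi> s x \<in> {p \<in> univ (sort_alg m s). P p}} = {x \<in> ?H. P (\<phi> s x)}"
    unfolding sdual_pts using dual_mor_mem by blast
  ultimately have "compactin (subtopology (hom_topology A (sort_alg m s)) ?H) {x \<in> ?H. P (\<phi> s x)}"
    unfolding sdual_simps by (simp only: closedin_compact_space)
  then show ?thesis by (simp add: compactin_subtopology)
qed

text \<open>Compactness is used twice. Monotonicity separates a fixed \<open>x\<close> in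
  \<open>S True\<close> from each single \<open>y\<close> in \<open>S False\<close>; a finite meet
  separates it from all of them, and a finite join of such meets does so for every \<open>x\<close>
  in \<open>S True\<close>.\<close>

lemma dual_mor_carrier_eval:
  obtains a where "a \<in> univ A"
    "\<And>s x. x \<in> alg_hom A (sort_alg m s) \<Longrightarrow> carrier_map s (x a) = carrier_map s (\<phi> s x)"
proof -
  define S where "S c s = {x \<in> alg_hom A (sort_alg m s). carrier_map s (\<phi> s x) = c}" for c s
  have Sh: "x \<in> alg_hom A (sort_alg m s)" "x \<in> univ A \<rightarrow>\<^sub>E univ (sort_alg m s)" if "x \<in> S c s" for c x s
    using that by (auto simp: S_def alg_hom_def)
  have Sc: "compactin (hom_topology A (sort_alg m s)) (S c s)" for c s
    unfolding S_def by (rule compactin_dual_mor_preimage)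
  let ?W = "\<lambda>c s a. {x \<in> univ A \<rightarrow>\<^sub>E univ (sort_alg m s). carrier_map s (x a) = c}"
  have W: "openin (hom_topology A (sort_alg m s)) (?W c s a)" if "a \<in> univ A" for c s a
    by (rule openin_coordinate[OF that, of "sort_alg m s" "\<lambda>p. carrier_map s p = c"])
  have 1: "\<exists>b\<in>univ A. carrier_map i (x b) \<and> (\<forall>j. \<forall>y\<in>S False j. \<not> carrier_map j (y b))"
    if x: "x \<in> S True i" for i x
  proof -
    define K where "K = {a \<in> univ A. carrier_map i (x a)}"
    have ex: "\<exists>a\<in>K. y \<in> ?W False j a" if y: "y \<in> S False j" for j y
    proof -
      have "\<exists>a\<in>univ A. carrier_map i (x a) \<and> \<not> carrier_map j (y a)"
        using dual_mor_carrier_mono[OF Sh(1)[OF x] Sh(1)[OF y]] x y by (auto simp: S_def)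
      then show ?thesis using Sh(2)[OF y] by (auto simp: K_def)
    qed
    have op: "openin (hom_topology A (sort_alg m s)) (?W False s a)" if "a \<in> K" for s a
      by (rule W) (use that in \<open>simp add: K_def\<close>)
    obtain K0 where K0: "finite K0" "K0 \<subseteq> K" "\<And>s y. y \<in> S False s \<Longrightarrow> \<exists>a\<in>K0. y \<in> ?W False s a"
      using finite_cover_sorts[of "\<lambda>s. hom_topology A (sort_alg m s)" "S False" K "?W False", OF Sc op ex] by blast
    \<comment> \<open>The zero homomorphism into \<open>Pp\<close> has carrier value 0 under
      \<open>\<phi>\<close>, so the subcover is non-empty and its meet exists even if
      \<open>A\<close> has no top element.\<close>
    have "(\<lambda>a\<in>univ A. 0) \<in> S False Pp" using dual_mor_zero' by (simp add: S_def)
    then have "K0 \<noteq> {}" using K0(3) by blast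
    then obtain b where b: "b \<in> univ A" "\<And>f. lat_hom A f \<Longrightarrow> f b = (\<forall>a\<in>K0. f a)"
      using finite_meet[OF A K0(1)] K0(2) by (auto simp: K_def)
    have "carrier_map i (x b)" using b(2)[OF carrier_lat_hom[OF Sh(1)[OF x]]] K0(2) by (auto simp: K_def)
    moreover have "\<not> carrier_map j (y b)" if "y \<in> S False j" for j y
      using b(2)[OF carrier_lat_hom[OF Sh(1)[OF that]]] K0(3)[OF that] by auto
    ultimately show ?thesis using b(1) by blast
  qed
  define K where "K = {b \<in> univ A. \<forall>j. \<forall>y\<in>S False j. \<not> carrier_map j (y b)}"
  have ex: "\<exists>b\<in>K. x \<in> ?W True i b" if x: "x \<in> S True i" for i x
    using 1[OF x] Sh(2)[OF x] by (auto simp: K_def)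
  have op: "openin (hom_topology A (sort_alg m s)) (?W True s a)" if "a \<in> K" for s a
    by (rule W) (use that in \<open>simp add: K_def\<close>)
  obtain K0 where K0: "finite K0" "K0 \<subseteq> K" "\<And>s y. y \<in> S True s \<Longrightarrow> \<exists>a\<in>K0. y \<in> ?W True s a"
    using finite_cover_sorts[of "\<lambda>s. hom_topology A (sort_alg m s)" "S True" K "?W True", OF Sc op ex] by blast
  \<comment> \<open>Dually, the zero homomorphism into \<open>Pm\<close> guarantees a non-empty
    join.\<close>
  have "(\<lambda>a\<in>univ A. 0) \<in> S True Pm" using dual_mor_zero zero_hom[OF m A] by (simp add: S_def)
  then have "K0 \<noteq> {}" using K0(3) by blast
  then obtain a where a: "a \<in> univ A" "\<And>f. lat_hom A f \<Longrightarrow> f a = (\<exists>b\<in>K0. f b)"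
    using finite_join[OF A K0(1)] K0(2) by (auto simp: K_def)
  have "carrier_map s (x a) = carrier_map s (\<phi> s x)" if x: "x \<in> alg_hom A (sort_alg m s)" for s x
  proof (cases "carrier_map s (\<phi> s x)")
    case True
    then have "x \<in> S True s" using x by (simp add: S_def)
    then show ?thesis using a(2)[OF carrier_lat_hom[OF x]] K0(3)[of x s] True by auto
  next
    case False
    then have "x \<in> S False s" using x by (simp add: S_def)
    then show ?thesis using a(2)[OF carrier_lat_hom[OF x]] K0(2) False by (auto simp: K_def)
  qed
  then show ?thesis using that a(1) by blast
qed

text \<open>The total operations preserve the relation between \<open>\<phi> s x\<close> and
  \<open>x a\<close>, so agreement of the carriers becomes equality by applying
  \<open>carriers_detect_order\<close> to this relation and to its converse.\<close>

lemma dual_mor_eval: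
  "\<exists>a\<in>univ A. \<forall>s. \<forall>x\<in>alg_hom A (sort_alg m s). \<phi> s x = x a"
proof -
  obtain a where a: "a \<in> univ A"
    "\<And>s x. x \<in> alg_hom A (sort_alg m s) \<Longrightarrow> carrier_map s (x a) = carrier_map s (\<phi> s x)"
    using dual_mor_carrier_eval by blast
  have op: "\<exists>y\<in>alg_hom A (sort_alg m (op_tgt r)). op_fun m r (\<phi> (op_src r) x) = \<phi> (op_tgt r) y \<and> op_fun m r (x a) = y a"
    if r: "r \<in> gops (sug_sig m)" and x: "x \<in> alg_hom A (sort_alg m (op_src r))" for r x
  proof -
    have d: "x b \<in> op_dom m r" if "b \<in> univ A" for b using r hom_mem[OF x that] by auto
    have r': "r \<in> gops (sug_sig m) \<union> hops (sug_sig m)" using r by blast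
    show ?thesis
      using dual_mor_op(2)[OF r' x d] op_closedD[OF alg_hom_op_closed[OF m A] r' x d] a(1)
      by (intro bexI[of _ "\<lambda>b\<in>univ A. op_fun m r (x b)"]) simp_all
  qed
  have nz: "\<phi> Q x \<noteq> 0 \<and> x a \<noteq> 0" if "x \<in> alg_hom A (sort_alg m Q)" for x
    using dual_mor_mem[OF that] hom_mem[OF that a(1)] unfolding mem_sort_alg[OF m] by simp
  have "\<phi> s x \<le> x a" if x: "x \<in> alg_hom A (sort_alg m s)" for s x
  proof (rule carriers_detect_order[OF m,
        where T = "\<lambda>s p q. \<exists>x\<in>alg_hom A (sort_alg m s). p = \<phi> s x \<and> q = x a" and s = s])
    show "\<exists>x\<in>alg_hom A (sort_alg m (op_tgt r)). op_fun m r p = \<phi> (op_tgt r) x \<and> op_fun m r q = x a"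
      if "r \<in> gops (sug_sig m)" "\<exists>x\<in>alg_hom A (sort_alg m (op_src r)). p = \<phi> (op_src r) x \<and> q = x a" for r p q
      using that(2) op[OF that(1)] by blast
  qed (use a(2) nz x in \<open>auto simp del: sort_alg.simps\<close>)
  moreover have "x a \<le> \<phi> s x" if x: "x \<in> alg_hom A (sort_alg m s)" for s x
  proof (rule carriers_detect_order[OF m,
        where T = "\<lambda>s p q. \<exists>x\<in>alg_hom A (sort_alg m s). q = \<phi> s x \<and> p = x a" and s = s])
    show "\<exists>x\<in>alg_hom A (sort_alg m (op_tgt r)). op_fun m r q = \<phi> (op_tgt r) x \<and> op_fun m r p = x a"
      if "r \<in> gops (sug_sig m)" "\<exists>x\<in>alg_hom A (sort_alg m (op_src r)). q = \<phi> (op_src r) x \<and> p = x a" for r p q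
      using that(2) op[OF that(1)] by blast
  qed (use a(2) nz x in \<open>auto simp del: sort_alg.simps\<close>)
  ultimately show ?thesis using a(1) by (meson order_antisym)
qed

end


section \<open>Separating families of homomorphisms\<close>

text \<open>The image of \<open>X\<close> is compact, closed under the operations, contains zero and
  separates \<open>A\<close>, so it is the whole dual by \<open>closed_separating_all\<close>. A
  continuous bijection from a compact onto a Hausdorff space is a homeomorphism, and since
  \<open>dom\<close> is an equivalence, the inverse respects domains as well.\<close>

lemma evaluation_iso:
  fixes X :: "(sort, 'x, opsym, constsym) mstruct" and A :: "'a salg"
  assumes m: "m \<ge> 2" and A: "salgebra A" and X: "mstructure (sug_sig m) X"
    and ext: "\<And>s. ev s \<in> extensional (pts X s)"
    and hom: "\<And>s x. x \<in> pts X s \<Longrightarrow> ev s x \<in> alg_hom A (sort_alg m s)"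
    and cont: "\<And>s a. a \<in> univ A \<Longrightarrow>
       continuous_map (stop X s) (discrete_topology (univ (sort_alg m s))) (\<lambda>x. ev s x a)"
    and dom: "\<And>r x. r \<in> gops (sug_sig m) \<union> hops (sug_sig m) \<Longrightarrow> x \<in> pts X (op_src r) \<Longrightarrow>
       (\<forall>a\<in>univ A. ev (op_src r) x a \<in> op_dom m r) \<longleftrightarrow> x \<in> odom X r"
    and app: "\<And>r x a. r \<in> gops (sug_sig m) \<union> hops (sug_sig m) \<Longrightarrow> x \<in> odom X r \<Longrightarrow> a \<in> univ A \<Longrightarrow>
       ev (op_tgt r) (oapp X r x) a = op_fun m r (ev (op_src r) x a)"
    and const: "\<And>a. a \<in> univ A \<Longrightarrow> ev Pm (cval X Zero_Pm) a = 0"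
    and sepA: "\<And>a b. a \<in> univ A \<Longrightarrow> b \<in> univ A \<Longrightarrow>
       (\<And>s x. x \<in> pts X s \<Longrightarrow> ev s x a = ev s x b) \<Longrightarrow> a = b"
    and sepX: "\<And>s x y. x \<in> pts X s \<Longrightarrow> y \<in> pts X s \<Longrightarrow>
       (\<And>a. a \<in> univ A \<Longrightarrow> ev s x a = ev s y a) \<Longrightarrow> x = y"
  shows "ev \<in> mor_iso (sug_sig m) X (sdual m A)"
proof -
  have Xr: "x \<in> pts X (op_src r)" "oapp X r x \<in> pts X (op_tgt r)"
    if "r \<in> gops (sug_sig m) \<union> hops (sug_sig m)" "x \<in> odom X r" for r x
    using mstructure_pts[OF X that] by simp_all
  have Xc: "cval X Zero_Pm \<in> pts X Pm" using X by (simp add: mstructure_def)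
  have app': "ev (op_tgt r) (oapp X r x) = (\<lambda>a\<in>univ A. op_fun m r (ev (op_src r) x a))"
    if "r \<in> gops (sug_sig m) \<union> hops (sug_sig m)" "x \<in> odom X r" for r x
  proof (rule extensionalityI[of _ "univ A"])
    show "ev (op_tgt r) (oapp X r x) \<in> extensional (univ A)" using hom_ext[OF hom[OF Xr(2)[OF that]]] .
  qed (use app[OF that] in simp_all)
  have const': "ev Pm (cval X Zero_Pm) = (\<lambda>a\<in>univ A. 0)"
  proof (rule extensionalityI[of _ "univ A"])
    show "ev Pm (cval X Zero_Pm) \<in> extensional (univ A)" using hom_ext[OF hom[OF Xc]] .
  qed (use const in simp_all)
  have cts: "continuous_map (stop X s) (hom_topology A (sort_alg m s)) (ev s)" for s
    unfolding continuous_map_componentwise using hom_ext[OF hom] cont by blast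
  have compX: "compact_space (stop X s)" for s using X by (simp add: mstructure_def boolean_space_def)
  define R where "R s = ev s ` pts X s" for s
  have "compactin (hom_topology A (sort_alg m s)) (R s)" for s
    unfolding R_def using image_compactin[OF _ cts] compX by (simp add: compact_space_def)
  moreover have "op_closed m (univ A) R"
    unfolding op_closed_def
  proof (intro ballI impI)
    fix r z assume r: "r \<in> gops (sug_sig m) \<union> hops (sug_sig m)" and z: "z \<in> R (op_src r)"
      "\<forall>a\<in>univ A. z a \<in> op_dom m r"
    then obtain x where x: "x \<in> pts X (op_src r)" "z = ev (op_src r) x" by (auto simp: R_def)
    then have "x \<in> odom X r" using dom[OF r x(1)] z(2) by simp
    then show "(\<lambda>a\<in>univ A. op_fun m r (z a)) \<in> R (op_tgt r)"
      unfolding x(2) app'[OF r \<open>x \<in> odom X r\<close>, symmetric] R_def using Xr(2)[OF r] by blast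
  qed
  moreover have "R s \<subseteq> alg_hom A (sort_alg m s)" for s using hom by (auto simp: R_def)
  moreover have "(\<lambda>a\<in>univ A. 0) \<in> R Pm" unfolding const'[symmetric] R_def using Xc by blast
  moreover have "a = b" if "a \<in> univ A" "b \<in> univ A" "\<And>s x. x \<in> R s \<Longrightarrow> x a = x b" for a b
    using that(1,2) by (rule sepA) (use that(3) in \<open>auto simp: R_def\<close>)
  ultimately have onto: "alg_hom A (sort_alg m s) \<subseteq> R s" for s
    using closed_separating_all[OF m A, of R] by (meson subsetI)
  have inj: "inj_on (ev s) (pts X s)" for s by (rule inj_onI) (metis sepX)
  have img: "ev s ` pts X s = alg_hom A (sort_alg m s)" for s using onto[of s] hom by (auto simp: R_def)
  have cts': "continuous_map (stop X s) (stop (sdual m A) s) (ev s)" for s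
    unfolding sdual_simps using cts hom by (auto simp: continuous_map_in_subtopology)
  have morev: "ev \<in> mor (sug_sig m) X (sdual m A)"
    unfolding mor_iff
  proof (intro conjI allI ballI)
    fix r x assume r: "r \<in> gops (sug_sig m) \<union> hops (sug_sig m)" and x: "x \<in> odom X r"
    show "ev (src (sug_sig m) r) x \<in> odom (sdual m A) r"
      using hom[OF Xr(1)[OF r x]] dom[OF r Xr(1)[OF r x]] x unfolding sdual_simps by simp
    show "ev (tgt (sug_sig m) r) (oapp X r x) = oapp (sdual m A) r (ev (src (sug_sig m) r) x)"
      using app'[OF r x] unfolding sdual_simps by simp
  next
    fix k show "ev (csort (sug_sig m) k) (cval X k) = cval (sdual m A) k"
      using const' unfolding sdual_simps by (cases k) simp
  qed (use ext cts' in auto)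
  have "\<exists>g. continuous_map (stop (sdual m A) s) (stop X s) g \<and> (\<forall>x\<in>pts X s. g (ev s x) = x)" for s
  proof -
    have "homeomorphic_map (stop X s) (stop (sdual m A) s) (ev s)"
    proof (rule continuous_imp_homeomorphic_map[OF cts' compX])
      show "Hausdorff_space (stop (sdual m A) s)"
        unfolding sdual_simps
        by (intro Hausdorff_space_subtopology)
          (simp add: Hausdorff_space_product_topology Hausdorff_space_discrete_topology del: sort_alg.simps)
      show "ev s ` pts X s = pts (sdual m A) s" unfolding sdual_pts by (rule img)
    qed (rule inj)
    then show ?thesis unfolding homeomorphic_map_maps homeomorphic_maps_def by blast
  qed
  then obtain g where g: "\<And>s. continuous_map (stop (sdual m A) s) (stop X s) (g s)"
    "\<And>s x. x \<in> pts X s \<Longrightarrow> g s (ev s x) = x"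
    by metis
  define d where "d s = restrict (g s) (pts (sdual m A) s)" for s
  have d: "d s (ev s x) = x" if "x \<in> pts X s" for s x
    using g(2)[OF that] hom[OF that] by (simp add: d_def sdual_pts)
  have "d \<in> mor (sug_sig m) (sdual m A) X"
    unfolding mor_iff
  proof (intro conjI allI ballI)
    show "continuous_map (stop (sdual m A) s) (stop X s) (d s)" for s
      by (rule continuous_map_eq[OF g(1)]) (simp add: d_def)
  next
    fix r y assume r: "r \<in> gops (sug_sig m) \<union> hops (sug_sig m)" and y: "y \<in> odom (sdual m A) r"
    have "y \<in> ev (op_src r) ` pts X (op_src r)" using y unfolding img sdual_simps by blast
    then obtain x where x: "x \<in> pts X (op_src r)" "y = ev (op_src r) x" by blast
    have xo: "x \<in> odom X r" using y dom[OF r x(1)] unfolding sdual_simps x(2) by blast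
    have "oapp (sdual m A) r y = ev (op_tgt r) (oapp X r x)"
      unfolding sdual_simps app'[OF r xo] x(2) ..
    then show "d (src (sug_sig m) r) y \<in> odom X r"
      "d (tgt (sug_sig m) r) (oapp (sdual m A) r y) = oapp X r (d (src (sug_sig m) r) y)"
      using d[OF x(1)] d[OF Xr(2)[OF r xo]] xo by (simp_all add: x(2))
  next
    fix k show "d (csort (sug_sig m) k) (cval (sdual m A) k) = cval X k"
      using d[OF Xc] const' unfolding sdual_simps by (cases k) simp
  qed (simp add: d_def)
  moreover have "ev s (d s y) = y" if "y \<in> pts (sdual m A) s" for s y
  proof -
    have "y \<in> ev s ` pts X s" using that unfolding img sdual_pts .
    then show ?thesis using d by auto
  qed
  ultimately show ?thesis unfolding mor_iso_def using morev d by blast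
qed


section \<open>The dual algebra of a structure\<close>

lemma continuous_map_binary_discrete:
  assumes "continuous_map T (discrete_topology U) f" "continuous_map T (discrete_topology V) g"
    "\<And>p q. p \<in> U \<Longrightarrow> q \<in> V \<Longrightarrow> F p q \<in> W"
  shows "continuous_map T (discrete_topology W) (\<lambda>x. F (f x) (g x))"
proof -
  have "continuous_map T (prod_topology (discrete_topology U) (discrete_topology V)) (\<lambda>x. (f x, g x))"
    by (intro continuous_map_pairedI assms)
  moreover have "continuous_map (discrete_topology (U \<times> V)) (discrete_topology W) (\<lambda>(p, q). F p q)"
    using assms(3) by auto
  ultimately have "continuous_map T (discrete_topology W) ((\<lambda>(p, q). F p q) \<circ> (\<lambda>x. (f x, g x)))"
    unfolding prod_topology_discrete_topology[symmetric] by (rule continuous_map_compose)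
  then show ?thesis by (simp add: comp_def)
qed

context
  fixes m :: nat and X :: "(sort, 'x, opsym, constsym) mstruct"
  assumes m: "m \<ge> 2" and X: "mstructure (sug_sig m) X"
begin

text \<open>A binary \<open>F\<close> for each sort covers \<open>meet\<close>, \<open>join\<close>
  and \<open>imp\<close>; negation is the case of an \<open>F\<close> that ignores its second
  argument.\<close>

lemma pointwise_mor:
  assumes \<phi>: "\<phi> \<in> mor (sug_sig m) X (sug_alter_ego m)" and \<psi>: "\<psi> \<in> mor (sug_sig m) X (sug_alter_ego m)"
    and F: "\<And>s p q. p \<in> univ (sort_alg m s) \<Longrightarrow> q \<in> univ (sort_alg m s) \<Longrightarrow> F s p q \<in> univ (sort_alg m s)"
    and Fr: "\<And>r p q. r \<in> gops (sug_sig m) \<union> hops (sug_sig m) \<Longrightarrow> p \<in> op_dom m r \<Longrightarrow> q \<in> op_dom m r \<Longrightarrow>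
       F (op_src r) p q \<in> op_dom m r \<and> op_fun m r (F (op_src r) p q) = F (op_tgt r) (op_fun m r p) (op_fun m r q)"
    and F0: "F Pm 0 0 = 0"
  shows "(\<lambda>s. \<lambda>x\<in>pts X s. F s (\<phi> s x) (\<psi> s x)) \<in> mor (sug_sig m) X (sug_alter_ego m)"
  unfolding mor_iff
proof (intro conjI allI ballI)
  fix s
  have "continuous_map (stop X s) (discrete_topology (univ (sort_alg m s))) (\<lambda>x. F s (\<phi> s x) (\<psi> s x))"
    using mor_cont[OF \<phi>, of s, unfolded sug_alter_ego_simps] mor_cont[OF \<psi>, of s, unfolded sug_alter_ego_simps] F
    by (rule continuous_map_binary_discrete)
  then show "continuous_map (stop X s) (stop (sug_alter_ego m) s) (\<lambda>x\<in>pts X s. F s (\<phi> s x) (\<psi> s x))"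
    unfolding sug_alter_ego_simps by (rule continuous_map_eq) simp
next
  fix r x assume r: "r \<in> gops (sug_sig m) \<union> hops (sug_sig m)" and x: "x \<in> odom X r"
  have p: "x \<in> pts X (op_src r)" "oapp X r x \<in> pts X (op_tgt r)"
    using mstructure_pts[OF X r x] by simp_all
  have *: "\<phi> (op_src r) x \<in> op_dom m r" "\<phi> (op_tgt r) (oapp X r x) = op_fun m r (\<phi> (op_src r) x)"
    "\<psi> (op_src r) x \<in> op_dom m r" "\<psi> (op_tgt r) (oapp X r x) = op_fun m r (\<psi> (op_src r) x)"
    using mor_op[OF \<phi> r x] mor_op[OF \<psi> r x] by simp_all
  then show "(\<lambda>x\<in>pts X (src (sug_sig m) r). F (src (sug_sig m) r) (\<phi> (src (sug_sig m) r) x) (\<psi> (src (sug_sig m) r) x)) x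
      \<in> odom (sug_alter_ego m) r"
    "(\<lambda>x\<in>pts X (tgt (sug_sig m) r). F (tgt (sug_sig m) r) (\<phi> (tgt (sug_sig m) r) x) (\<psi> (tgt (sug_sig m) r) x)) (oapp X r x) =
      oapp (sug_alter_ego m) r
        ((\<lambda>x\<in>pts X (src (sug_sig m) r). F (src (sug_sig m) r) (\<phi> (src (sug_sig m) r) x) (\<psi> (src (sug_sig m) r) x)) x)"
    using Fr[OF r *(1,3)] p by simp_all
next
  fix k
  have "cval X Zero_Pm \<in> pts X Pm" using X by (simp add: mstructure_def)
  moreover have "\<phi> Pm (cval X Zero_Pm) = 0" "\<psi> Pm (cval X Zero_Pm) = 0"
    using mor_const[OF \<phi>, of Zero_Pm] mor_const[OF \<psi>, of Zero_Pm] by simp_all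
  ultimately show "(\<lambda>x\<in>pts X (csort (sug_sig m) k).
      F (csort (sug_sig m) k) (\<phi> (csort (sug_sig m) k) x) (\<psi> (csort (sug_sig m) k) x)) (cval X k) = cval (sug_alter_ego m) k"
    using F0 by (cases k) simp
qed simp

lemma sedual_simps [simp]:
  "univ (sedual m X) = mor (sug_sig m) X (sug_alter_ego m)"
  "meet (sedual m X) \<phi> \<psi> = (\<lambda>s. \<lambda>x\<in>pts X s. meet (sort_alg m s) (\<phi> s x) (\<psi> s x))"
  "join (sedual m X) \<phi> \<psi> = (\<lambda>s. \<lambda>x\<in>pts X s. join (sort_alg m s) (\<phi> s x) (\<psi> s x))"
  "imp (sedual m X) \<phi> \<psi> = (\<lambda>s. \<lambda>x\<in>pts X s. imp (sort_alg m s) (\<phi> s x) (\<psi> s x))"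
  "neg (sedual m X) \<phi> = (\<lambda>s. \<lambda>x\<in>pts X s. neg (sort_alg m s) (\<phi> s x))"
  by (simp_all add: Edual_def del: sort_alg.simps)

lemma salgebra_sedual:
  assumes "mor (sug_sig m) X (sug_alter_ego m) \<noteq> {}"
  shows "salgebra (sedual m X)"
proof -
  note cl = salgebra_closed[OF salgebra_sort_alg[OF m]]
  have ops: "meet (sort_alg m (op_src r)) p q \<in> op_dom m r" "join (sort_alg m (op_src r)) p q \<in> op_dom m r"
    "imp (sort_alg m (op_src r)) p q \<in> op_dom m r" "neg (sort_alg m (op_src r)) p \<in> op_dom m r"
    "op_fun m r (meet (sort_alg m (op_src r)) p q) = meet (sort_alg m (op_tgt r)) (op_fun m r p) (op_fun m r q)"
    "op_fun m r (join (sort_alg m (op_src r)) p q) = join (sort_alg m (op_tgt r)) (op_fun m r p) (op_fun m r q)"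
    "op_fun m r (imp (sort_alg m (op_src r)) p q) = imp (sort_alg m (op_tgt r)) (op_fun m r p) (op_fun m r q)"
    "op_fun m r (neg (sort_alg m (op_src r)) p) = neg (sort_alg m (op_tgt r)) (op_fun m r p)"
    if r: "r \<in> gops (sug_sig m) \<union> hops (sug_sig m)" and pq: "p \<in> op_dom m r" "q \<in> op_dom m r" for r p q
  proof -
    show D: "meet (sort_alg m (op_src r)) p q \<in> op_dom m r" "join (sort_alg m (op_src r)) p q \<in> op_dom m r"
      "imp (sort_alg m (op_src r)) p q \<in> op_dom m r" "neg (sort_alg m (op_src r)) p \<in> op_dom m r"
      using op_dom_subuniverse[OF m r] pq unfolding subuniverse_def by blast+
    show "op_fun m r (meet (sort_alg m (op_src r)) p q) = meet (sort_alg m (op_tgt r)) (op_fun m r p) (op_fun m r q)"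
      "op_fun m r (join (sort_alg m (op_src r)) p q) = join (sort_alg m (op_tgt r)) (op_fun m r p) (op_fun m r q)"
      "op_fun m r (imp (sort_alg m (op_src r)) p q) = imp (sort_alg m (op_tgt r)) (op_fun m r p) (op_fun m r q)"
      "op_fun m r (neg (sort_alg m (op_src r)) p) = neg (sort_alg m (op_tgt r)) (op_fun m r p)"
      using alg_homD[OF op_fun_hom[OF m r], unfolded subalg_simps, OF pq] D pq by simp_all
  qed
  have zero: "meet (sort_alg m Pm) 0 0 = 0" "join (sort_alg m Pm) 0 0 = 0" "imp (sort_alg m Pm) 0 0 = 0"
    "neg (sort_alg m Pm) 0 = 0"
    unfolding sort_alg_ops by simp_all
  have "neg (sedual m X) \<phi> \<in> univ (sedual m X)" "meet (sedual m X) \<phi> \<psi> \<in> univ (sedual m X)"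
    "join (sedual m X) \<phi> \<psi> \<in> univ (sedual m X)" "imp (sedual m X) \<phi> \<psi> \<in> univ (sedual m X)"
    if \<phi>: "\<phi> \<in> univ (sedual m X)" and \<psi>: "\<psi> \<in> univ (sedual m X)" for \<phi> \<psi>
  proof -
    note pm = pointwise_mor[OF \<phi>[unfolded sedual_simps] \<psi>[unfolded sedual_simps]]
    show "neg (sedual m X) \<phi> \<in> univ (sedual m X)"
      unfolding sedual_simps by (rule pm[of "\<lambda>s p q. neg (sort_alg m s) p"]) (simp_all only: cl ops zero simp_thms)
    show "meet (sedual m X) \<phi> \<psi> \<in> univ (sedual m X)"
      unfolding sedual_simps by (rule pm[of "\<lambda>s. meet (sort_alg m s)"]) (simp_all only: cl ops zero simp_thms)
    show "join (sedual m X) \<phi> \<psi> \<in> univ (sedual m X)"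
      unfolding sedual_simps by (rule pm[of "\<lambda>s. join (sort_alg m s)"]) (simp_all only: cl ops zero simp_thms)
    show "imp (sedual m X) \<phi> \<psi> \<in> univ (sedual m X)"
      unfolding sedual_simps by (rule pm[of "\<lambda>s. imp (sort_alg m s)"]) (simp_all only: cl ops zero simp_thms)
  qed
  then show ?thesis using assms unfolding salgebra_def subuniverse_def by auto
qed

lemma restrict_point_hom:
  assumes B: "subuniverse B (sedual m X)" and x: "x \<in> pts X s"
  shows "(\<lambda>\<phi>\<in>B. \<phi> s x) \<in> alg_hom (subalg (sedual m X) B) (sort_alg m s)"
proof (rule alg_homI)
  have BM: "\<phi> \<in> mor (sug_sig m) X (sug_alter_ego m)" if "\<phi> \<in> B" for \<phi>
    using B that by (auto simp: subuniverse_def)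
  have cl: "neg (sedual m X) \<phi> \<in> B" "meet (sedual m X) \<phi> \<psi> \<in> B" "join (sedual m X) \<phi> \<psi> \<in> B"
    "imp (sedual m X) \<phi> \<psi> \<in> B" if "\<phi> \<in> B" "\<psi> \<in> B" for \<phi> \<psi>
    using B that unfolding subuniverse_def by blast+
  show "(\<lambda>\<phi>\<in>B. \<phi> s x) \<phi> \<in> univ (sort_alg m s)" if "\<phi> \<in> univ (subalg (sedual m X) B)" for \<phi>
    using mor_pts[OF BM x] that by (simp del: sort_alg.simps)
  show "(\<lambda>\<phi>\<in>B. \<phi> s x) (neg (subalg (sedual m X) B) \<phi>) = neg (sort_alg m s) ((\<lambda>\<phi>\<in>B. \<phi> s x) \<phi>)"
    if "\<phi> \<in> univ (subalg (sedual m X) B)" for \<phi>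
    using cl(1) that x by (simp del: sort_alg.simps)
  fix \<phi> \<psi> assume "\<phi> \<in> univ (subalg (sedual m X) B)" "\<psi> \<in> univ (subalg (sedual m X) B)"
  then have *: "\<phi> \<in> B" "\<psi> \<in> B" by simp_all
  show "(\<lambda>\<phi>\<in>B. \<phi> s x) (meet (subalg (sedual m X) B) \<phi> \<psi>) = meet (sort_alg m s) ((\<lambda>\<phi>\<in>B. \<phi> s x) \<phi>) ((\<lambda>\<phi>\<in>B. \<phi> s x) \<psi>)"
    "(\<lambda>\<phi>\<in>B. \<phi> s x) (join (subalg (sedual m X) B) \<phi> \<psi>) = join (sort_alg m s) ((\<lambda>\<phi>\<in>B. \<phi> s x) \<phi>) ((\<lambda>\<phi>\<in>B. \<phi> s x) \<psi>)"
    "(\<lambda>\<phi>\<in>B. \<phi> s x) (imp (subalg (sedual m X) B) \<phi> \<psi>) = imp (sort_alg m s) ((\<lambda>\<phi>\<in>B. \<phi> s x) \<phi>) ((\<lambda>\<phi>\<in>B. \<phi> s x) \<psi>)"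
    using cl[OF *] * x by (simp_all del: sort_alg.simps)
qed simp

text \<open>\<open>B\<close> is kept general because it is used twice: with all morphisms for
  fullness, and with the restrictions of morphisms from a larger structure for injectivity.\<close>

lemma evaluation_iso_subalg:
  assumes B: "subuniverse B (sedual m X)"
    and sep: "\<And>s x y. x \<in> pts X s \<Longrightarrow> y \<in> pts X s \<Longrightarrow> (\<And>\<phi>. \<phi> \<in> B \<Longrightarrow> \<phi> s x = \<phi> s y) \<Longrightarrow> x = y"
    and dom: "\<And>r x. r \<in> gops (sug_sig m) \<union> hops (sug_sig m) \<Longrightarrow> x \<in> pts X (op_src r) \<Longrightarrow>
      (\<And>\<phi>. \<phi> \<in> B \<Longrightarrow> \<phi> (op_src r) x \<in> op_dom m r) \<Longrightarrow> x \<in> odom X r"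
  shows "(\<lambda>s. \<lambda>x\<in>pts X s. \<lambda>\<phi>\<in>B. \<phi> s x) \<in> mor_iso (sug_sig m) X (sdual m (subalg (sedual m X) B))"
proof (rule evaluation_iso[OF m salgebra_subalg[OF B] X])
  have BM: "\<phi> \<in> mor (sug_sig m) X (sug_alter_ego m)" if "\<phi> \<in> B" for \<phi>
    using B that by (auto simp: subuniverse_def)
  let ?ev = "\<lambda>s. \<lambda>x\<in>pts X s. \<lambda>\<phi>\<in>B. \<phi> s x"
  show "?ev s \<in> extensional (pts X s)" for s by simp
  show "?ev s x \<in> alg_hom (subalg (sedual m X) B) (sort_alg m s)" if "x \<in> pts X s" for s x
    using restrict_point_hom[OF B that] that by simp
  show "continuous_map (stop X s) (discrete_topology (univ (sort_alg m s))) (\<lambda>x. ?ev s x \<phi>)"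
    if "\<phi> \<in> univ (subalg (sedual m X) B)" for s \<phi>
  proof -
    have "\<phi> \<in> B" using that by simp
    then have "continuous_map (stop X s) (discrete_topology (univ (sort_alg m s))) (\<phi> s)"
      using mor_cont[OF BM, of \<phi> s] by (simp del: sort_alg.simps)
    then show ?thesis by (rule continuous_map_eq) (use \<open>\<phi> \<in> B\<close> in simp)
  qed
  show "(\<forall>\<phi>\<in>univ (subalg (sedual m X) B). ?ev (op_src r) x \<phi> \<in> op_dom m r) \<longleftrightarrow> x \<in> odom X r"
    if r: "r \<in> gops (sug_sig m) \<union> hops (sug_sig m)" and x: "x \<in> pts X (op_src r)" for r x
  proof
    assume "\<forall>\<phi>\<in>univ (subalg (sedual m X) B). ?ev (op_src r) x \<phi> \<in> op_dom m r"
    then show "x \<in> odom X r" by (intro dom[OF r x]) (use x in auto)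
  next
    assume xo: "x \<in> odom X r"
    show "\<forall>\<phi>\<in>univ (subalg (sedual m X) B). ?ev (op_src r) x \<phi> \<in> op_dom m r"
      using mor_op(1)[OF BM r xo] x by simp
  qed
  show "?ev (op_tgt r) (oapp X r x) \<phi> = op_fun m r (?ev (op_src r) x \<phi>)"
    if r: "r \<in> gops (sug_sig m) \<union> hops (sug_sig m)" and x: "x \<in> odom X r"
      and \<phi>: "\<phi> \<in> univ (subalg (sedual m X) B)" for r x \<phi>
    using mor_op(2)[OF BM r x] mstructure_pts[OF X r x] \<phi> by simp
  show "?ev Pm (cval X Zero_Pm) \<phi> = 0" if "\<phi> \<in> univ (subalg (sedual m X) B)" for \<phi>
    using mor_const[OF BM, of \<phi> Zero_Pm] X that by (simp add: mstructure_def)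
  show "\<phi> = \<psi>"
    if "\<phi> \<in> univ (subalg (sedual m X) B)" "\<psi> \<in> univ (subalg (sedual m X) B)"
      and eq: "\<And>s x. x \<in> pts X s \<Longrightarrow> ?ev s x \<phi> = ?ev s x \<psi>" for \<phi> \<psi>
  proof (rule ext)
    fix s
    have *: "\<phi> \<in> B" "\<psi> \<in> B" using that by simp_all
    show "\<phi> s = \<psi> s"
    proof (rule extensionalityI[of _ "pts X s"])
      show "\<phi> s \<in> extensional (pts X s)" "\<psi> s \<in> extensional (pts X s)"
        using BM[OF *(1)] BM[OF *(2)] unfolding mor_iff by blast+
      show "\<phi> s x = \<psi> s x" if "x \<in> pts X s" for x using eq[OF that] that * by simp
    qed
  qed
  show "x = y" if xy: "x \<in> pts X s" "y \<in> pts X s"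
    and eq: "\<And>\<phi>. \<phi> \<in> univ (subalg (sedual m X) B) \<Longrightarrow> ?ev s x \<phi> = ?ev s y \<phi>" for s x y
    using xy by (rule sep) (use eq xy in auto)
qed

end


section \<open>Strong duality\<close>

lemma eval_alg_iso:
  fixes A :: "'a salg"
  assumes m: "m \<ge> 2" and A: "A \<in> ISP (range (sort_alg m))"
  shows "eval_alg (sug_sig m) (sort_alg m) (sug_alter_ego m) A \<in> alg_iso A (sedual m (sdual m A))"
proof -
  let ?M = "sug_alter_ego m" and ?\<Sigma> = "sug_sig m"
  obtain I :: "('a \<times> 'a) set" and N B k where Aa: "salgebra A" and N: "N ` I \<subseteq> range (sort_alg m)"
    and B: "subuniverse B (prod_alg I N)" and k: "k \<in> alg_iso A (subalg (prod_alg I N) B)"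
    using A unfolding ISP_def by blast
  let ?e = "eval_alg ?\<Sigma> (sort_alg m) ?M A"
  have e: "?e a s x = x a" if "a \<in> univ A" "x \<in> alg_hom A (sort_alg m s)" for a s x
    using that by (simp add: eval_alg_def sdual_pts)
  have e_ext: "?e a s \<in> extensional (pts (sdual m A) s)" if "a \<in> univ A" for a s
    using that by (simp add: eval_alg_def)
  have eqI: "\<phi> = \<psi>" if "\<And>s. \<phi> s \<in> extensional (pts (sdual m A) s)" "\<And>s. \<psi> s \<in> extensional (pts (sdual m A) s)"
    "\<And>s x. x \<in> alg_hom A (sort_alg m s) \<Longrightarrow> \<phi> s x = \<psi> s x" for \<phi> \<psi> :: "sort \<Rightarrow> ('a \<Rightarrow> int) \<Rightarrow> int"
  proof
    show "\<phi> s = \<psi> s" for s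
      by (rule extensionalityI[of _ "pts (sdual m A) s"]) (use that in \<open>simp_all add: sdual_pts\<close>)
  qed
  have e_mor: "?e a \<in> mor ?\<Sigma> (sdual m A) ?M" if a: "a \<in> univ A" for a
    unfolding mor_iff
  proof (intro conjI allI ballI)
    fix s
    have "continuous_map (hom_topology A (sort_alg m s)) (discrete_topology (univ (sort_alg m s))) (\<lambda>x. x a)"
      by (rule continuous_map_product_projection[OF a])
    then have "continuous_map (stop (sdual m A) s) (stop ?M s) (\<lambda>x. x a)"
      unfolding sdual_simps sug_alter_ego_simps by (rule continuous_map_from_subtopology)
    then show "continuous_map (stop (sdual m A) s) (stop ?M s) (?e a s)"
      by (rule continuous_map_eq) (simp add: e[OF a] sdual_pts)
  next
    fix r x assume r: "r \<in> gops ?\<Sigma> \<union> hops ?\<Sigma>" and "x \<in> odom (sdual m A) r"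
    then have x: "x \<in> alg_hom A (sort_alg m (op_src r))" "\<And>a. a \<in> univ A \<Longrightarrow> x a \<in> op_dom m r"
      unfolding sdual_simps by blast+
    have "oapp (sdual m A) r x \<in> alg_hom A (sort_alg m (op_tgt r))"
      unfolding sdual_simps by (rule op_closedD[OF alg_hom_op_closed[OF m Aa] r x])
    then show "?e a (src ?\<Sigma> r) x \<in> odom ?M r"
      "?e a (tgt ?\<Sigma> r) (oapp (sdual m A) r x) = oapp ?M r (?e a (src ?\<Sigma> r) x)"
      using e[OF a] x a by (simp_all add: sdual_simps)
  next
    fix k show "?e a (csort ?\<Sigma> k) (cval (sdual m A) k) = cval ?M k"
      using e[OF a zero_hom[OF m Aa]] a by (simp add: sdual_simps)
  qed (rule e_ext[OF a])
  have "?e \<in> alg_hom A (sedual m (sdual m A))"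
  proof (rule alg_homI)
    show "?e \<in> extensional (univ A)" by (simp add: eval_alg_def)
    show "?e a \<in> univ (sedual m (sdual m A))" if "a \<in> univ A" for a
      using e_mor[OF that] by (simp add: Edual_def)
    show "?e (neg A a) = neg (sedual m (sdual m A)) (?e a)" if a: "a \<in> univ A" for a
      by (rule eqI) (use a e_ext e salgebra_closed(1)[OF Aa a a] in
          \<open>simp_all add: Edual_def sdual_pts alg_homD(1)[OF _ a a] del: sort_alg.simps\<close>)
    fix a b assume ab: "a \<in> univ A" "b \<in> univ A"
    show "?e (meet A a b) = meet (sedual m (sdual m A)) (?e a) (?e b)"
      by (rule eqI) (use ab e_ext e salgebra_closed[OF Aa ab] in
          \<open>simp_all add: Edual_def sdual_pts alg_homD(2)[OF _ ab] del: sort_alg.simps\<close>)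
    show "?e (join A a b) = join (sedual m (sdual m A)) (?e a) (?e b)"
      by (rule eqI) (use ab e_ext e salgebra_closed[OF Aa ab] in
          \<open>simp_all add: Edual_def sdual_pts alg_homD(3)[OF _ ab] del: sort_alg.simps\<close>)
    show "?e (imp A a b) = imp (sedual m (sdual m A)) (?e a) (?e b)"
      by (rule eqI) (use ab e_ext e salgebra_closed[OF Aa ab] in
          \<open>simp_all add: Edual_def sdual_pts alg_homD(4)[OF _ ab] del: sort_alg.simps\<close>)
  qed
  \<comment> \<open>The coordinates of the embedding of \<open>A\<close> into a product are
    homomorphisms into sorts, so equal evaluations agree in every coordinate.\<close>
  moreover have "inj_on ?e (univ A)"
  proof (rule inj_onI)
    fix a b assume ab: "a \<in> univ A" "b \<in> univ A" "?e a = ?e b"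
    have kh: "k \<in> alg_hom A (subalg (prod_alg I N) B)" and kb: "inj_on k (univ A)"
      using k by (auto simp: alg_iso_def bij_betw_def)
    have kB: "k c \<in> B" "k c \<in> (\<Pi>\<^sub>E i\<in>I. univ (N i))" if "c \<in> univ A" for c
      using hom_mem[OF kh that] B by (auto simp: subuniverse_def)
    have "k a i = k b i" if i: "i \<in> I" for i
    proof -
      obtain s where s: "N i = sort_alg m s" using N i by blast
      have "(\<lambda>c\<in>univ A. k c i) \<in> alg_hom A (N i)"
      proof (rule alg_homI)
        show "(\<lambda>c\<in>univ A. k c i) c \<in> univ (N i)" if "c \<in> univ A" for c
          using PiE_mem[OF kB(2)[OF that] i] that by simp
        show "(\<lambda>c\<in>univ A. k c i) (neg A c) = neg (N i) ((\<lambda>c\<in>univ A. k c i) c)" if "c \<in> univ A" for c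
          using alg_homD(1)[OF kh that that] salgebra_closed(1)[OF Aa that that] i that by simp
        fix c d assume cd: "c \<in> univ A" "d \<in> univ A"
        show "(\<lambda>c\<in>univ A. k c i) (meet A c d) = meet (N i) ((\<lambda>c\<in>univ A. k c i) c) ((\<lambda>c\<in>univ A. k c i) d)"
          "(\<lambda>c\<in>univ A. k c i) (join A c d) = join (N i) ((\<lambda>c\<in>univ A. k c i) c) ((\<lambda>c\<in>univ A. k c i) d)"
          "(\<lambda>c\<in>univ A. k c i) (imp A c d) = imp (N i) ((\<lambda>c\<in>univ A. k c i) c) ((\<lambda>c\<in>univ A. k c i) d)"
          using alg_homD[OF kh cd] salgebra_closed[OF Aa cd] i cd by simp_all
      qed simp
      then have "(\<lambda>c\<in>univ A. k c i) \<in> alg_hom A (sort_alg m s)" unfolding s .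
      from e[OF ab(1) this] e[OF ab(2) this] show ?thesis using ab by simp
    qed
    then have "k a = k b" using PiE_ext[OF kB(2)[OF ab(1)] kB(2)[OF ab(2)]] by blast
    then show "a = b" using kb ab(1,2) by (meson inj_onD)
  qed
  moreover have "mor ?\<Sigma> (sdual m A) ?M \<subseteq> ?e ` univ A"
  proof
    fix \<phi> assume \<phi>: "\<phi> \<in> mor ?\<Sigma> (sdual m A) ?M"
    then obtain a where a: "a \<in> univ A" "\<And>s x. x \<in> alg_hom A (sort_alg m s) \<Longrightarrow> \<phi> s x = x a"
      using dual_mor_eval[OF m Aa \<phi>] by blast
    have "\<phi> = ?e a"
    proof (rule eqI)
      show "\<phi> s \<in> extensional (pts (sdual m A) s)" for s using \<phi> unfolding mor_iff by blast
    qed (use a e e_ext in auto)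
    then show "\<phi> \<in> ?e ` univ A" using a(1) by blast
  qed
  ultimately show ?thesis using e_mor by (auto simp: alg_iso_def bij_betw_def Edual_def)
qed

lemma eval_struct_iso:
  assumes m: "m \<ge> 2" and X: "X \<in> IScP (sug_sig m) (sug_alter_ego m)"
  shows "eval_struct (sug_sig m) (sort_alg m) (sug_alter_ego m) X \<in> mor_iso (sug_sig m) X (sdual m (sedual m X))"
proof -
  have K: "Zero_Pm \<in> kops (sug_sig m)" by simp
  note Xm = IScP_mstructure[OF X K]
  have "salgebra (sedual m X)" by (rule salgebra_sedual[OF m Xm IScP_mor[OF X K]])
  then have B: "subuniverse (mor (sug_sig m) X (sug_alter_ego m)) (sedual m X)"
    by (simp add: salgebra_def sedual_simps[OF m Xm])
  have "(\<lambda>s. \<lambda>x\<in>pts X s. \<lambda>\<phi>\<in>mor (sug_sig m) X (sug_alter_ego m). \<phi> s x) \<in> mor_iso (sug_sig m) X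
      (sdual m (subalg (sedual m X) (mor (sug_sig m) X (sug_alter_ego m))))"
  proof (rule evaluation_iso_subalg[OF m Xm B])
    show "x = y" if "x \<in> pts X s" "y \<in> pts X s"
      "\<And>\<phi>. \<phi> \<in> mor (sug_sig m) X (sug_alter_ego m) \<Longrightarrow> \<phi> s x = \<phi> s y" for s x y
      using that by (rule IScP_separated[OF X K])
    show "x \<in> odom X r" if "r \<in> gops (sug_sig m) \<union> hops (sug_sig m)" "x \<in> pts X (op_src r)"
      "\<And>\<phi>. \<phi> \<in> mor (sug_sig m) X (sug_alter_ego m) \<Longrightarrow> \<phi> (op_src r) x \<in> op_dom m r" for r x
      using IScP_odom[OF X K that(1), of x] that(2,3) by simp
  qed
  moreover have "subalg (sedual m X) (mor (sug_sig m) X (sug_alter_ego m)) = sedual m X"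
    using subalg_univ[of "sedual m X"] unfolding sedual_simps[OF m Xm] .
  ultimately show ?thesis by (simp add: eval_struct_def)
qed

text \<open>The restrictions to \<open>X\<close> of the morphisms on \<open>Y\<close> form an algebra whose dual is \<open>X\<close>, because they
  separate the points of \<open>X\<close> and detect the domains; by duality every morphism on \<open>X\<close> is one of them.\<close>

lemma sug_alter_ego_injective:
  fixes X :: "(sort, 'x, opsym, constsym) mstruct" and Y :: "(sort, 'y, opsym, constsym) mstruct"
  assumes m: "m \<ge> 2" and X: "X \<in> IScP (sug_sig m) (sug_alter_ego m)"
    and Y: "Y \<in> IScP (sug_sig m) (sug_alter_ego m)" and \<epsilon>: "\<epsilon> \<in> embedding (sug_sig m) X Y"
    and \<phi>: "\<phi> \<in> mor (sug_sig m) X (sug_alter_ego m)"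
  shows "\<exists>\<psi> \<in> mor (sug_sig m) Y (sug_alter_ego m). \<forall>s. \<forall>x\<in>pts X s. \<psi> s (\<epsilon> s x) = \<phi> s x"
proof -
  let ?\<Sigma> = "sug_sig m" and ?M = "sug_alter_ego m"
  have K: "Zero_Pm \<in> kops ?\<Sigma>" by simp
  note Xm = IScP_mstructure[OF X K] and Ym = IScP_mstructure[OF Y K]
  note \<epsilon>m = embedding_mor[OF Xm \<epsilon>] and \<epsilon>p = mor_pts[OF embedding_mor[OF Xm \<epsilon>]]
  define res where "res \<psi> = (\<lambda>s. \<lambda>x\<in>pts X s. \<psi> s (\<epsilon> s x))" for \<psi> :: "sort \<Rightarrow> 'y \<Rightarrow> int"
  define B where "B = res ` mor ?\<Sigma> Y ?M"
  have resM: "res \<psi> \<in> mor ?\<Sigma> X ?M" if "\<psi> \<in> mor ?\<Sigma> Y ?M" for \<psi>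
    unfolding res_def by (rule mor_comp[OF Xm \<epsilon>m that])
  have Ya: "salgebra (sedual m Y)" by (rule salgebra_sedual[OF m Ym IScP_mor[OF Y K]])
  have cl: "neg (sedual m Y) \<psi> \<in> mor ?\<Sigma> Y ?M" "meet (sedual m Y) \<psi> \<psi>' \<in> mor ?\<Sigma> Y ?M"
    "join (sedual m Y) \<psi> \<psi>' \<in> mor ?\<Sigma> Y ?M" "imp (sedual m Y) \<psi> \<psi>' \<in> mor ?\<Sigma> Y ?M"
    if "\<psi> \<in> mor ?\<Sigma> Y ?M" "\<psi>' \<in> mor ?\<Sigma> Y ?M" for \<psi> \<psi>'
    using salgebra_closed[OF Ya, unfolded sedual_simps(1)[OF m Ym], OF that] .
  have ops: "neg (sedual m X) (res \<psi>) = res (neg (sedual m Y) \<psi>)"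
    "meet (sedual m X) (res \<psi>) (res \<psi>') = res (meet (sedual m Y) \<psi> \<psi>')"
    "join (sedual m X) (res \<psi>) (res \<psi>') = res (join (sedual m Y) \<psi> \<psi>')"
    "imp (sedual m X) (res \<psi>) (res \<psi>') = res (imp (sedual m Y) \<psi> \<psi>')" for \<psi> \<psi>'
    using \<epsilon>p unfolding sedual_simps[OF m Xm] sedual_simps[OF m Ym] res_def
    by (auto simp: fun_eq_iff simp del: sort_alg.simps)
  have B: "subuniverse B (sedual m X)"
    unfolding subuniverse_def
  proof (intro conjI ballI)
    show "B \<subseteq> univ (sedual m X)" using resM by (auto simp: B_def sedual_simps[OF m Xm])
    show "B \<noteq> {}" using IScP_mor[OF Y K] by (simp add: B_def)
  next
    fix f assume "f \<in> B"
    then obtain \<psi> where \<psi>: "f = res \<psi>" "\<psi> \<in> mor ?\<Sigma> Y ?M" by (auto simp: B_def)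
    show "neg (sedual m X) f \<in> B" unfolding \<psi>(1) ops B_def using cl(1)[OF \<psi>(2,2)] by blast
    fix g assume "g \<in> B"
    then obtain \<psi>' where \<psi>': "g = res \<psi>'" "\<psi>' \<in> mor ?\<Sigma> Y ?M" by (auto simp: B_def)
    show "meet (sedual m X) f g \<in> B" "join (sedual m X) f g \<in> B" "imp (sedual m X) f g \<in> B"
      unfolding \<psi>(1) \<psi>'(1) ops B_def using cl[OF \<psi>(2) \<psi>'(2)] by blast+
  qed
  let ?A = "subalg (sedual m X) B"
  have Aa: "salgebra ?A" by (rule salgebra_subalg[OF B])
  have resB: "res \<psi> \<in> B" if "\<psi> \<in> mor ?\<Sigma> Y ?M" for \<psi> using that by (simp add: B_def)
  let ?ev = "\<lambda>s. \<lambda>x\<in>pts X s. \<lambda>f\<in>B. f s x"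
  have "?ev \<in> mor_iso ?\<Sigma> X (sdual m ?A)"
  proof (rule evaluation_iso_subalg[OF m Xm B])
    fix s x y assume xy: "x \<in> pts X s" "y \<in> pts X s" and eq: "\<And>f. f \<in> B \<Longrightarrow> f s x = f s y"
    have "\<psi> s (\<epsilon> s x) = \<psi> s (\<epsilon> s y)" if "\<psi> \<in> mor ?\<Sigma> Y ?M" for \<psi>
      using eq[OF resB[OF that]] xy by (simp add: res_def)
    then have "\<epsilon> s x = \<epsilon> s y" by (rule IScP_separated[OF Y K \<epsilon>p[OF xy(1)] \<epsilon>p[OF xy(2)]])
    then show "x = y" by (rule embedding_inj[OF Xm \<epsilon> xy])
  next
    fix r x assume r: "r \<in> gops ?\<Sigma> \<union> hops ?\<Sigma>" and x: "x \<in> pts X (op_src r)"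
      and d: "\<And>f. f \<in> B \<Longrightarrow> f (op_src r) x \<in> op_dom m r"
    have "\<psi> (op_src r) (\<epsilon> (op_src r) x) \<in> op_dom m r" if "\<psi> \<in> mor ?\<Sigma> Y ?M" for \<psi>
      using d[OF resB[OF that]] x by (simp add: res_def)
    then have "\<epsilon> (op_src r) x \<in> odom Y r"
      using IScP_odom[OF Y K r, of "\<epsilon> (op_src r) x"] \<epsilon>p[OF x] by simp
    then show "x \<in> odom X r" using embedding_odom[OF Xm \<epsilon> r, of x] x by simp
  qed
  then obtain d where evm: "?ev \<in> mor ?\<Sigma> X (sdual m ?A)" and d: "d \<in> mor ?\<Sigma> (sdual m ?A) X"
    and dev: "\<And>s x. x \<in> pts X s \<Longrightarrow> d s (?ev s x) = x"
    unfolding mor_iso_def by blast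
  \<comment> \<open>Transported along the inverse \<open>d\<close>, the given morphism lives on a
    dual, where every morphism is an evaluation.\<close>
  have Dm: "(\<lambda>s. \<lambda>y\<in>pts (sdual m ?A) s. \<phi> s (d s y)) \<in> mor ?\<Sigma> (sdual m ?A) ?M"
    unfolding mor_iff
  proof (intro conjI allI ballI)
    show "continuous_map (stop (sdual m ?A) s) (stop ?M s) (\<lambda>y\<in>pts (sdual m ?A) s. \<phi> s (d s y))" for s
      using continuous_map_compose[OF mor_cont[OF d] mor_cont[OF \<phi>], of s]
      by (rule continuous_map_eq) simp
  next
    fix r y assume r: "r \<in> gops ?\<Sigma> \<union> hops ?\<Sigma>" and y: "y \<in> odom (sdual m ?A) r"
    have y': "y \<in> alg_hom ?A (sort_alg m (op_src r))" "\<And>a. a \<in> univ ?A \<Longrightarrow> y a \<in> op_dom m r"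
      using y unfolding sdual_simps by blast+
    have "oapp (sdual m ?A) r y \<in> alg_hom ?A (sort_alg m (op_tgt r))"
      unfolding sdual_simps by (rule op_closedD[OF alg_hom_op_closed[OF m Aa] r y'])
    then show "(\<lambda>y\<in>pts (sdual m ?A) (src ?\<Sigma> r). \<phi> (src ?\<Sigma> r) (d (src ?\<Sigma> r) y)) y \<in> odom ?M r"
      "(\<lambda>y\<in>pts (sdual m ?A) (tgt ?\<Sigma> r). \<phi> (tgt ?\<Sigma> r) (d (tgt ?\<Sigma> r) y)) (oapp (sdual m ?A) r y) =
        oapp ?M r ((\<lambda>y\<in>pts (sdual m ?A) (src ?\<Sigma> r). \<phi> (src ?\<Sigma> r) (d (src ?\<Sigma> r) y)) y)"
      using mor_op[OF d r y] mor_op[OF \<phi> r mor_op(1)[OF d r y]] y'(1) by (simp_all add: sdual_pts)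
  next
    fix k assume k: "k \<in> kops ?\<Sigma>"
    have "cval (sdual m ?A) k \<in> pts (sdual m ?A) Pm"
      unfolding sdual_pts sdual_simps(4) by (rule zero_hom[OF m Aa])
    then show "(\<lambda>y\<in>pts (sdual m ?A) (csort ?\<Sigma> k). \<phi> (csort ?\<Sigma> k) (d (csort ?\<Sigma> k) y)) (cval (sdual m ?A) k) = cval ?M k"
      using mor_const[OF d k] mor_const[OF \<phi> k] by simp
  qed simp
  \<comment> \<open>The universe of \<open>?A\<close> is \<open>B\<close>, so the representing
    element is itself the restriction of a morphism on \<open>Y\<close>, which is the required
    extension.\<close>
  obtain a where a: "a \<in> B" "\<And>s y. y \<in> alg_hom ?A (sort_alg m s) \<Longrightarrow> \<phi> s (d s y) = y a"
    using dual_mor_eval[OF m Aa Dm] by (auto simp: sdual_pts)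
  have "\<phi> s x = a s x" if x: "x \<in> pts X s" for s x
    using a(2)[OF mor_pts[OF evm x, unfolded sdual_pts]] dev[OF x] a(1) x by simp
  moreover obtain \<psi> where "\<psi> \<in> mor ?\<Sigma> Y ?M" "a = res \<psi>" using a(1) by (auto simp: B_def)
  ultimately show ?thesis by (auto simp: res_def)
qed

theorem theorem4p8:
  fixes m :: nat
  assumes "m \<ge> 2"
  shows "(HSP {Z_alg (2 * m)} :: 'a salg set) = ISP {Z_alg (2 * m), Z_alg (2 * m - 1)} \<and>
    yields_strong_duality TYPE('x) TYPE('y) (sug_sig m) (sort_alg m) (sug_alter_ego m)
      (HSP {Z_alg (2 * m)} :: 'a salg set)"
proof -
  have eq: "(HSP {Z_alg (2 * m)} :: 'a salg set) = ISP {Z_alg (2 * m), Z_alg (2 * m - 1)}"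
    by (rule HSP_eq_ISP[OF assms])
  have "range (sort_alg m) = {Z_alg (2 * m), Z_alg (2 * m - 1)}" by (auto simp: UNIV_sort)
  then have eq': "(HSP {Z_alg (2 * m)} :: 'a salg set) = ISP (range (sort_alg m))" using eq by simp
  have "yields_duality (sug_sig m) (sort_alg m) (sug_alter_ego m) (HSP {Z_alg (2 * m)} :: 'a salg set)"
    unfolding yields_duality_def eq' using sug_alter_ego[OF assms] eval_alg_iso[OF assms] by blast
  then show ?thesis
    unfolding yields_strong_duality_def yields_full_duality_def
    using eq eval_struct_iso[OF assms] sug_alter_ego_injective[OF assms] by blast
qed

end
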